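(* Let $Q$ be a quiver. Then the $\mathbb{C}$-subspaces $$I=\langle[M]\mid\operatorname{nice}(M)=\infty\rangle\subseteq H_Q,\qquad I_{\mathrm{nil}}=\langle[M]\mid M\text{ is nilpotent and }\operatorname{nice}(M)=\infty\rangle\subseteq H_{Q,\mathrm{nil}}$$ are Hopf ideals in $H_Q$ and $H_{Q,\mathrm{nil}}$, respectively. We have Hopf algebra isomorphisms $H_Q/I\cong H_Q^{\operatorname{nice}}$ and $H_{Q,\mathrm{nil}}/I_{\mathrm{nil}}\cong H_{Q,\mathrm{nil}}^{\operatorname{nice}}$.
   Context: Quivers $Q=(Q_0,Q_1,s,t)$ are finite; loops and multiple arrows are allowed. An $\mathbb{F}_1$-vector space is a finite pointed set; an $\mathbb{F}_1$-linear map is a pointed function injective on the complement of the preimage of $0$. An $\mathbb{F}_1$-representation $M$ of $Q$ consists of $\mathbb{F}_1$-vector spaces $M_v$ ($v\in Q_0$) and $\mathbb{F}_1$-linear maps $M_\alpha:M_{s(\alpha)}\to M_{t(\alpha)}$ ($\alpha\in Q_1$). A subrepresentation $L\le R$ consists of pointed subsets stable under the maps; $R/L$ is obtained by collapsing each $L_v$ to $0$; direct sums are obtained by gluing pointed sets at $0$. $M$ is nilpotent if there is $N$ such that for all $n\ge N$ the composite of the $M_\alpha$ along every directed path of length $n$ is zero. Hall algebras. $H_Q$ (resp. $H_{Q,\mathrm{nil}}$) is the $\mathbb{C}$-vector space with basis the isomorphism classes $[M]$ of all (resp. nilpotent) $\mathbb{F}_1$-representations of $Q$, with product $$[M]\cdot[N]=\sum_{[R]}\bigl|\{L\le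 R\mid L\simeq N,\ R/L\simeq M\}\bigr|\,[R],$$ unit $[0]$, and coproduct $\Delta(f)([M],[N])=f([M\oplus N])$, where elements are viewed as finitely supported functions $f$ on isomorphism classes; it is a graded connected cocommutative Hopf algebra. $H_Q^{\operatorname{nice}}$ (resp. $H_{Q,\mathrm{nil}}^{\operatorname{nice}}$) is the Hall algebra defined by the same formulas using only the full subcategory of $\mathbb{F}_1$-representations (resp. nilpotent $\mathbb{F}_1$-representations) $M$ with $\operatorname{nice}(M)<\infty$ (basis elements $[M]$ and the sum over $[R]$ are restricted to this subcategory). Nice length. The coefficient quiver $\Gamma_M$ has as vertices the nonzero elements of all the $M_v$, with one arrow $\beta:x\to y$ for each $\alpha$ with $M_\alpha(x)=y\ne0$; put $c_M(\beta)=\alpha$. A grading of $M$ is a map $\partial:(\Gamma_M)_0\to\mathbb{Z}$. It is nice if $c_M(\beta)=c_M(\beta')$ implies $\partial(t(\beta))-\partial(s(\beta))=\partial(t(\beta'))-\partial(s(\beta'))$. It is $(\partial_0,\dots,\partial_{i-1})$-nice if this equality holds for all arrows $\beta,\beta'$ of $\Gamma_M$ with $c_M(\beta)=c_M(\beta')$, $\partial_j(s(\beta))=\partial_j(s(\beta'))$ and $\partial_j(t(\beta))=\partial_j(t(\beta'))$ for all $j<i$. A nice sequence is $(\partial_i)_{i\ge0}$ with $\partial_0$ nice and $\partial_i$ a $(\partial_0,\dots,\partial_{i-1})$-nice grading for all $i>0$. The nice length $\operatorname{nice}(M)$ is the smallest $n\ge0$ for which there is a nice sequence such that for all distinct vertices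 $x,y$ one has $\partial_i(x)\ne\partial_i(y)$ for some $i\le n$; $\operatorname{nice}(M)=\infty$ if none exists. *)

theory Defs
  imports
    "Graph_Theory.Arc_Walk"
    "HOL-Algebra.QuotRing"
    "HOL-Algebra.Module"
    "HOL-Algebra.Algebraic_Closure_Type"
    "HOL-Library.Poly_Mapping"
    "HOL-Library.Extended_Nat"
    "HOL-Library.FuncSet"
    Complex_Main
begin

section \<open>Representations of quivers over the field with one element\<close>

text \<open>
  A quiver is a digraph in the sense of \<^locale>\<open>fin_digraph\<close>; loops and multiple arcs are
  allowed there. As only isomorphism classes matter, we take every finite pointed set to be a
  finite set of natural numbers containing its base point \<open>0\<close>. The fields of a representation
  are irrelevant outside the vertices, arcs and carriers; \<open>rep_iso\<close> ignores these values.
\<close>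

record ('v, 'a) rep =
  car :: "'v \<Rightarrow> nat set"
  act :: "'a \<Rightarrow> nat \<Rightarrow> nat"

definition f1_space :: "nat set \<Rightarrow> bool" where
  "f1_space A \<longleftrightarrow> finite A \<and> 0 \<in> A"

definition f1_linear :: "nat set \<Rightarrow> nat set \<Rightarrow> (nat \<Rightarrow> nat) \<Rightarrow> bool" where
  "f1_linear A B f \<longleftrightarrow> f ` A \<subseteq> B \<and> f 0 = 0 \<and> inj_on f {x \<in> A. f x \<noteq> 0}"

definition reps :: "('v, 'a) pre_digraph \<Rightarrow> ('v, 'a) rep set" where
  "reps Q = {M. (\<forall>v\<in>verts Q. f1_space (car M v)) \<and>
     (\<forall>\<alpha>\<in>arcs Q. f1_linear (car M (tail Q \<alpha>)) (car M (head Q \<alpha>)) (act M \<alpha>))}"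

definition rep_iso :: "('v, 'a) pre_digraph \<Rightarrow> ('v, 'a) rep \<Rightarrow> ('v, 'a) rep \<Rightarrow> bool" where
  "rep_iso Q M N \<longleftrightarrow> (\<exists>h.
     (\<forall>v\<in>verts Q. f1_linear (car M v) (car N v) (h v) \<and> bij_betw (h v) (car M v) (car N v)) \<and>
     (\<forall>\<alpha>\<in>arcs Q. \<forall>x\<in>car M (tail Q \<alpha>).
        h (head Q \<alpha>) (act M \<alpha> x) = act N \<alpha> (h (tail Q \<alpha>) x)))"

definition iso_class :: "('v, 'a) pre_digraph \<Rightarrow> ('v, 'a) rep \<Rightarrow> ('v, 'a) rep set" where
  "iso_class Q M = {N \<in> reps Q. rep_iso Q M N}"

definition rep_of :: "('v, 'a) rep set \<Rightarrow> ('v, 'a) rep" where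
  "rep_of U = (SOME M. M \<in> U)"

definition zero_rep :: "('v, 'a) rep" where
  "zero_rep = \<lparr>car = (\<lambda>_. {0}), act = (\<lambda>_ _. 0)\<rparr>"

text \<open>
  A subrepresentation is given by its family of subsets. The family is extensional, so that
  subrepresentations are counted correctly.
\<close>

definition subreps :: "('v, 'a) pre_digraph \<Rightarrow> ('v, 'a) rep \<Rightarrow> ('v \<Rightarrow> nat set) set" where
  "subreps Q R = {L \<in> (\<Pi>\<^sub>E v\<in>verts Q. {A. A \<subseteq> car R v \<and> 0 \<in> A}).
     \<forall>\<alpha>\<in>arcs Q. act R \<alpha> ` L (tail Q \<alpha>) \<subseteq> L (head Q \<alpha>)}"

definition sub_rep :: "('v, 'a) rep \<Rightarrow> ('v \<Rightarrow> nat set) \<Rightarrow> ('v, 'a) rep" where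
  "sub_rep R L = \<lparr>car = L, act = act R\<rparr>"

definition quot_rep ::
    "('v, 'a) pre_digraph \<Rightarrow> ('v, 'a) rep \<Rightarrow> ('v \<Rightarrow> nat set) \<Rightarrow> ('v, 'a) rep" where
  "quot_rep Q R L = \<lparr>car = (\<lambda>v. insert 0 (car R v - L v)),
     act = (\<lambda>\<alpha> x. if act R \<alpha> x \<in> L (head Q \<alpha>) then 0 else act R \<alpha> x)\<rparr>"

text \<open>
  Two pointed sets are glued at \<open>0\<close> by sending \<open>x\<close> in the first one to \<open>2 * x\<close> and \<open>x\<close> in the
  second one to \<open>2 * x - 1\<close>. With truncated subtraction both maps fix \<open>0\<close>, and the nonzero
  elements of the summands become the nonzero even and the odd numbers, respectively.
\<close>

definition dsum :: "('v, 'a) rep \<Rightarrow> ('v, 'a) rep \<Rightarrow> ('v, 'a) rep" where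
  "dsum M N = \<lparr>car = (\<lambda>v. (\<lambda>x. 2 * x) ` car M v \<union> (\<lambda>x. 2 * x - 1) ` car N v),
     act = (\<lambda>\<alpha> y. if even y then 2 * act M \<alpha> (y div 2) else 2 * act N \<alpha> ((y + 1) div 2) - 1)\<rparr>"

definition nilpotent_rep :: "('v, 'a) pre_digraph \<Rightarrow> ('v, 'a) rep \<Rightarrow> bool" where
  "nilpotent_rep Q M \<longleftrightarrow> (\<exists>N. \<forall>n\<ge>N. \<forall>u p v. pre_digraph.awalk Q u p v \<and> length p = n \<longrightarrow>
     (\<forall>x\<in>car M u. fold (act M) p x = 0))"

definition nil_reps :: "('v, 'a) pre_digraph \<Rightarrow> ('v, 'a) rep set" where
  "nil_reps Q = {M \<in> reps Q. nilpotent_rep Q M}"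


section \<open>Nice length\<close>

text \<open>
  An arc of the coefficient quiver is a pair of an arc of \<open>Q\<close>, which is its colour, and a nonzero
  element at which this arc acts by a nonzero value.
\<close>

definition coeff_quiver ::
    "('v, 'a) pre_digraph \<Rightarrow> ('v, 'a) rep \<Rightarrow> ('v \<times> nat, 'a \<times> nat) pre_digraph" where
  "coeff_quiver Q M = \<lparr>
     verts = {(v, x). v \<in> verts Q \<and> x \<in> car M v \<and> x \<noteq> 0},
     arcs = {(\<alpha>, x). \<alpha> \<in> arcs Q \<and> x \<in> car M (tail Q \<alpha>) \<and> x \<noteq> 0 \<and> act M \<alpha> x \<noteq> 0},
     tail = (\<lambda>(\<alpha>, x). (tail Q \<alpha>, x)),
     head = (\<lambda>(\<alpha>, x). (head Q \<alpha>, act M \<alpha> x))\<rparr>"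

definition colour :: "'a \<times> nat \<Rightarrow> 'a" where
  "colour \<beta> = fst \<beta>"

definition nice_grading ::
    "('v, 'a) pre_digraph \<Rightarrow> ('v, 'a) rep \<Rightarrow> ('v \<times> nat \<Rightarrow> int) \<Rightarrow> bool" where
  "nice_grading Q M d \<longleftrightarrow> (let \<Gamma> = coeff_quiver Q M in
     \<forall>\<beta>\<in>arcs \<Gamma>. \<forall>\<beta>'\<in>arcs \<Gamma>. colour \<beta> = colour \<beta>' \<longrightarrow>
       d (head \<Gamma> \<beta>) - d (tail \<Gamma> \<beta>) = d (head \<Gamma> \<beta>') - d (tail \<Gamma> \<beta>'))"

text \<open>The condition that \<open>d\<close> is \<open>(D 0, \<dots>, D (i - 1))\<close>-nice:\<close>

definition rel_nice_grading ::
    "('v, 'a) pre_digraph \<Rightarrow> ('v, 'a) rep \<Rightarrow> (nat \<Rightarrow> 'v \<times> nat \<Rightarrow> int) \<Rightarrow> nat \<Rightarrow>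
     ('v \<times> nat \<Rightarrow> int) \<Rightarrow> bool" where
  "rel_nice_grading Q M D i d \<longleftrightarrow> (let \<Gamma> = coeff_quiver Q M in
     \<forall>\<beta>\<in>arcs \<Gamma>. \<forall>\<beta>'\<in>arcs \<Gamma>. colour \<beta> = colour \<beta>' \<and>
       (\<forall>j<i. D j (tail \<Gamma> \<beta>) = D j (tail \<Gamma> \<beta>') \<and> D j (head \<Gamma> \<beta>) = D j (head \<Gamma> \<beta>')) \<longrightarrow>
       d (head \<Gamma> \<beta>) - d (tail \<Gamma> \<beta>) = d (head \<Gamma> \<beta>') - d (tail \<Gamma> \<beta>'))"

definition nice_sequence ::
    "('v, 'a) pre_digraph \<Rightarrow> ('v, 'a) rep \<Rightarrow> (nat \<Rightarrow> 'v \<times> nat \<Rightarrow> int) \<Rightarrow> bool" where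
  "nice_sequence Q M D \<longleftrightarrow>
     nice_grading Q M (D 0) \<and> (\<forall>i>0. rel_nice_grading Q M D i (D i))"

text \<open>The infimum of the empty set in \<^typ>\<open>enat\<close> is \<open>\<infinity>\<close>.\<close>

definition nice_length :: "('v, 'a) pre_digraph \<Rightarrow> ('v, 'a) rep \<Rightarrow> enat" where
  "nice_length Q M = Inf {enat n | n. \<exists>D. nice_sequence Q M D \<and>
     (\<forall>x\<in>verts (coeff_quiver Q M). \<forall>y\<in>verts (coeff_quiver Q M).
        x \<noteq> y \<longrightarrow> (\<exists>i\<le>n. D i x \<noteq> D i y))}"


section \<open>Hopf algebras over the complex numbers\<close>

text \<open>
  \<open>V \<otimes> V\<close> is the vector space of formal linear combinations of pairs of elements of \<open>V\<close>, i.e.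
  finitely supported functions, modulo the subspace spanned by the bilinearity relations;
  similarly for \<open>V \<otimes> V \<otimes> V\<close> and triples. Tensors are represented by formal linear combinations,
  and equality of tensors is congruence modulo that subspace. The relations for pairs and triples
  are treated uniformly: \<open>K\<close> is the set of all maps inserting a vector into one slot of a pure
  tensor whose other slots are filled.
\<close>

type_synonym 'k formal = "'k \<Rightarrow>\<^sub>0 complex"

inductive_set null_tensors :: "(complex, 'h, 'm) module_scheme \<Rightarrow> ('h \<Rightarrow> 'k) set \<Rightarrow> 'k formal set"
  for V :: "(complex, 'h, 'm) module_scheme" and K :: "('h \<Rightarrow> 'k) set" where
  zero: "0 \<in> null_tensors V K"
| plus: "s \<in> null_tensors V K \<Longrightarrow> t \<in> null_tensors V K \<Longrightarrow> s + t \<in> null_tensors V K"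
| additive: "\<kappa> \<in> K \<Longrightarrow> x \<in> carrier V \<Longrightarrow> y \<in> carrier V \<Longrightarrow>
    Poly_Mapping.single (\<kappa> (x \<oplus>\<^bsub>V\<^esub> y)) c - Poly_Mapping.single (\<kappa> x) c
      - Poly_Mapping.single (\<kappa> y) c \<in> null_tensors V K"
| homogeneous: "\<kappa> \<in> K \<Longrightarrow> x \<in> carrier V \<Longrightarrow>
    Poly_Mapping.single (\<kappa> (a \<odot>\<^bsub>V\<^esub> x)) c - Poly_Mapping.single (\<kappa> x) (a * c)
      \<in> null_tensors V K"

definition slots2 :: "(complex, 'h, 'm) module_scheme \<Rightarrow> ('h \<Rightarrow> 'h \<times> 'h) set" where
  "slots2 V = (\<Union>y\<in>carrier V. {\<lambda>x. (x, y), \<lambda>x. (y, x)})"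

definition slots3 :: "(complex, 'h, 'm) module_scheme \<Rightarrow> ('h \<Rightarrow> 'h \<times> 'h \<times> 'h) set" where
  "slots3 V = (\<Union>y\<in>carrier V. \<Union>z\<in>carrier V. {\<lambda>x. (x, y, z), \<lambda>x. (y, x, z), \<lambda>x. (y, z, x)})"

definition tensor2_eq ::
    "(complex, 'h, 'm) module_scheme \<Rightarrow> ('h \<times> 'h) formal \<Rightarrow> ('h \<times> 'h) formal \<Rightarrow> bool" where
  "tensor2_eq V s t \<longleftrightarrow> s - t \<in> null_tensors V (slots2 V)"

definition tensor3_eq ::
    "(complex, 'h, 'm) module_scheme \<Rightarrow> ('h \<times> 'h \<times> 'h) formal \<Rightarrow> ('h \<times> 'h \<times> 'h) formal \<Rightarrow> bool" where
  "tensor3_eq V s t \<longleftrightarrow> s - t \<in> null_tensors V (slots3 V)"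

definition pure :: "'k \<Rightarrow> 'k formal" where
  "pure k = Poly_Mapping.single k 1"

definition formal_smult :: "complex \<Rightarrow> 'k formal \<Rightarrow> 'k formal" where
  "formal_smult c t = Poly_Mapping.map ((*) c) t"

text \<open>Linear extensions of maps given on pure tensors:\<close>

definition formal_ext :: "('k \<Rightarrow> 'l formal) \<Rightarrow> 'k formal \<Rightarrow> 'l formal" where
  "formal_ext F t = (\<Sum>k\<in>Poly_Mapping.keys t. formal_smult (Poly_Mapping.lookup t k) (F k))"

definition formal_eval ::
    "(complex, 'h, 'm) module_scheme \<Rightarrow> ('k \<Rightarrow> 'h) \<Rightarrow> 'k formal \<Rightarrow> 'h" where
  "formal_eval V F t = (\<Oplus>\<^bsub>V\<^esub>k\<in>Poly_Mapping.keys t. Poly_Mapping.lookup t k \<odot>\<^bsub>V\<^esub> F k)"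

record 'h hopf = "(complex, 'h) module" +
  comult :: "'h \<Rightarrow> ('h \<times> 'h) formal"
  counit :: "'h \<Rightarrow> complex"

abbreviation complex_ring :: "complex ring" where
  "complex_ring \<equiv> ring_of_type_algebra"

definition linear_on ::
    "(complex, 'h, 'm) module_scheme \<Rightarrow> (complex, 'k, 'n) module_scheme \<Rightarrow> ('h \<Rightarrow> 'k) \<Rightarrow> bool" where
  "linear_on V W f \<longleftrightarrow> f ` carrier V \<subseteq> carrier W \<and>
     (\<forall>x\<in>carrier V. \<forall>y\<in>carrier V. f (x \<oplus>\<^bsub>V\<^esub> y) = f x \<oplus>\<^bsub>W\<^esub> f y) \<and>
     (\<forall>c. \<forall>x\<in>carrier V. f (c \<odot>\<^bsub>V\<^esub> x) = c \<odot>\<^bsub>W\<^esub> f x)"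

text \<open>The tensor square of a map, the product of \<open>H \<otimes> H\<close>, and \<open>\<Delta> \<otimes> id\<close> and \<open>id \<otimes> \<Delta>\<close>:\<close>

definition tensor_map :: "('h \<Rightarrow> 'k) \<Rightarrow> ('h \<times> 'h) formal \<Rightarrow> ('k \<times> 'k) formal" where
  "tensor_map f = formal_ext (\<lambda>(x, y). pure (f x, f y))"

definition tensor_mult ::
    "'h hopf \<Rightarrow> ('h \<times> 'h) formal \<Rightarrow> ('h \<times> 'h) formal \<Rightarrow> ('h \<times> 'h) formal" where
  "tensor_mult H s t =
     formal_ext (\<lambda>(a, b). formal_ext (\<lambda>(c, d). pure (a \<otimes>\<^bsub>H\<^esub> c, b \<otimes>\<^bsub>H\<^esub> d)) t) s"

definition comult_id :: "'h hopf \<Rightarrow> ('h \<times> 'h) formal \<Rightarrow> ('h \<times> 'h \<times> 'h) formal" where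
  "comult_id H = formal_ext (\<lambda>(x, y). formal_ext (\<lambda>(a, b). pure (a, b, y)) (comult H x))"

definition id_comult :: "'h hopf \<Rightarrow> ('h \<times> 'h) formal \<Rightarrow> ('h \<times> 'h \<times> 'h) formal" where
  "id_comult H = formal_ext (\<lambda>(x, y). formal_ext (\<lambda>(a, b). pure (x, a, b)) (comult H y))"

definition is_antipode :: "'h hopf \<Rightarrow> ('h \<Rightarrow> 'h) \<Rightarrow> bool" where
  "is_antipode H S \<longleftrightarrow> linear_on H H S \<and>
     (\<forall>x\<in>carrier H.
        formal_eval H (\<lambda>(a, b). S a \<otimes>\<^bsub>H\<^esub> b) (comult H x) = counit H x \<odot>\<^bsub>H\<^esub> \<one>\<^bsub>H\<^esub> \<and>
        formal_eval H (\<lambda>(a, b). a \<otimes>\<^bsub>H\<^esub> S b) (comult H x) = counit H x \<odot>\<^bsub>H\<^esub> \<one>\<^bsub>H\<^esub>)"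

locale hopf_algebra = ring H + Module.module complex_ring H
  for H :: "'h hopf" (structure) +
  assumes smult_mult_left:
      "\<lbrakk>x \<in> carrier H; y \<in> carrier H\<rbrakk> \<Longrightarrow> (c \<odot>\<^bsub>H\<^esub> x) \<otimes>\<^bsub>H\<^esub> y = c \<odot>\<^bsub>H\<^esub> (x \<otimes>\<^bsub>H\<^esub> y)"
    and smult_mult_right:
      "\<lbrakk>x \<in> carrier H; y \<in> carrier H\<rbrakk> \<Longrightarrow> x \<otimes>\<^bsub>H\<^esub> (c \<odot>\<^bsub>H\<^esub> y) = c \<odot>\<^bsub>H\<^esub> (x \<otimes>\<^bsub>H\<^esub> y)"
    and comult_closed:
      "x \<in> carrier H \<Longrightarrow> Poly_Mapping.keys (comult H x) \<subseteq> carrier H \<times> carrier H"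
    and comult_add:
      "\<lbrakk>x \<in> carrier H; y \<in> carrier H\<rbrakk> \<Longrightarrow>
         tensor2_eq H (comult H (x \<oplus>\<^bsub>H\<^esub> y)) (comult H x + comult H y)"
    and comult_smult:
      "x \<in> carrier H \<Longrightarrow> tensor2_eq H (comult H (c \<odot>\<^bsub>H\<^esub> x)) (formal_smult c (comult H x))"
    and counit_add:
      "\<lbrakk>x \<in> carrier H; y \<in> carrier H\<rbrakk> \<Longrightarrow> counit H (x \<oplus>\<^bsub>H\<^esub> y) = counit H x + counit H y"
    and counit_smult:
      "x \<in> carrier H \<Longrightarrow> counit H (c \<odot>\<^bsub>H\<^esub> x) = c * counit H x"
    and coassoc:
      "x \<in> carrier H \<Longrightarrow>
         tensor3_eq H (comult_id H (comult H x)) (id_comult H (comult H x))"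
    and counit_left:
      "x \<in> carrier H \<Longrightarrow> formal_eval H (\<lambda>(a, b). counit H a \<odot>\<^bsub>H\<^esub> b) (comult H x) = x"
    and counit_right:
      "x \<in> carrier H \<Longrightarrow> formal_eval H (\<lambda>(a, b). counit H b \<odot>\<^bsub>H\<^esub> a) (comult H x) = x"
    and comult_mult:
      "\<lbrakk>x \<in> carrier H; y \<in> carrier H\<rbrakk> \<Longrightarrow>
         tensor2_eq H (comult H (x \<otimes>\<^bsub>H\<^esub> y)) (tensor_mult H (comult H x) (comult H y))"
    and comult_one: "tensor2_eq H (comult H \<one>\<^bsub>H\<^esub>) (pure (\<one>\<^bsub>H\<^esub>, \<one>\<^bsub>H\<^esub>))"
    and counit_mult:
      "\<lbrakk>x \<in> carrier H; y \<in> carrier H\<rbrakk> \<Longrightarrow> counit H (x \<otimes>\<^bsub>H\<^esub> y) = counit H x * counit H y"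
    and counit_one: "counit H \<one>\<^bsub>H\<^esub> = 1"
    and antipode: "\<exists>S. is_antipode H S"

text \<open>
  A coideal satisfies \<open>\<Delta>(I) \<subseteq> I \<otimes> H + H \<otimes> I\<close>, i.e. each \<open>\<Delta>(x)\<close> is represented by a combination of
  pairs one of whose entries is in \<open>I\<close>. The antipode is unique on the carrier, so it does not
  matter how \<open>S\<close> is quantified.
\<close>

definition hopf_ideal :: "'h set \<Rightarrow> 'h hopf \<Rightarrow> bool" where
  "hopf_ideal I H \<longleftrightarrow> hopf_algebra H \<and> submodule I complex_ring H \<and> ideal I H \<and>
     (\<forall>x\<in>I. \<exists>t. Poly_Mapping.keys t \<subseteq> I \<times> carrier H \<union> carrier H \<times> I \<and>
        tensor2_eq H (comult H x) t) \<and>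
     (\<forall>x\<in>I. counit H x = 0) \<and>
     (\<exists>S. is_antipode H S \<and> S ` I \<subseteq> I)"

text \<open>
  The quotient by a Hopf ideal extends the quotient ring; the remaining operations do not depend
  on the choice of a representative of a coset.
\<close>

definition hopf_quot :: "'h hopf \<Rightarrow> 'h set \<Rightarrow> 'h set hopf" where
  "hopf_quot H I = \<lparr>
     carrier = carrier (H Quot I),
     monoid.mult = (\<otimes>\<^bsub>H Quot I\<^esub>),
     monoid.one = \<one>\<^bsub>H Quot I\<^esub>,
     ring.zero = \<zero>\<^bsub>H Quot I\<^esub>,
     ring.add = (\<oplus>\<^bsub>H Quot I\<^esub>),
     module.smult = (\<lambda>c U. I +>\<^bsub>H\<^esub> (c \<odot>\<^bsub>H\<^esub> (SOME x. x \<in> U))),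
     comult = (\<lambda>U. tensor_map (\<lambda>x. I +>\<^bsub>H\<^esub> x) (comult H (SOME x. x \<in> U))),
     counit = (\<lambda>U. counit H (SOME x. x \<in> U))\<rparr>"

text \<open>A morphism of bialgebras between Hopf algebras automatically preserves antipodes.\<close>

definition hopf_iso :: "'h hopf \<Rightarrow> 'k hopf \<Rightarrow> ('h \<Rightarrow> 'k) set" where
  "hopf_iso A B = {f \<in> ring_iso A B. linear_on A B f \<and>
     (\<forall>x\<in>carrier A. tensor2_eq B (comult B (f x)) (tensor_map f (comult A x))) \<and>
     (\<forall>x\<in>carrier A. counit B (f x) = counit A x)}"

definition hopf_isomorphic :: "'h hopf \<Rightarrow> 'k hopf \<Rightarrow> bool" where
  "hopf_isomorphic A B \<longleftrightarrow> hopf_algebra A \<and> hopf_algebra B \<and> hopf_iso A B \<noteq> {}"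

definition lin_span :: "(complex, 'h, 'm) module_scheme \<Rightarrow> 'h set \<Rightarrow> 'h set" where
  "lin_span V B = {\<Oplus>\<^bsub>V\<^esub>b\<in>F. c b \<odot>\<^bsub>V\<^esub> b | F c. finite F \<and> F \<subseteq> B}"


section \<open>Hall algebras\<close>

definition hall_number ::
    "('v, 'a) pre_digraph \<Rightarrow> ('v, 'a) rep \<Rightarrow> ('v, 'a) rep \<Rightarrow> ('v, 'a) rep \<Rightarrow> nat" where
  "hall_number Q M N R =
     card {L \<in> subreps Q R. rep_iso Q (sub_rep R L) N \<and> rep_iso Q (quot_rep Q R L) M}"

type_synonym ('v, 'a) hall = "('v, 'a) rep set \<Rightarrow> complex"

definition class_basis :: "('v, 'a) rep set \<Rightarrow> ('v, 'a) hall" where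
  "class_basis U = (\<lambda>W. if W = U then 1 else 0)"

abbreviation rep_basis :: "('v, 'a) pre_digraph \<Rightarrow> ('v, 'a) rep \<Rightarrow> ('v, 'a) hall" where
  "rep_basis Q M \<equiv> class_basis (iso_class Q M)"

text \<open>
  The Hall algebra of the full subcategory with objects \<open>C \<subseteq> reps Q\<close>. Its elements are the finitely
  supported functions on the isomorphism classes of \<open>C\<close>, and the product is the bilinear extension
  of the one of the basis elements. The function \<open>\<Delta>(f)\<close> on pairs of isomorphism classes stands
  for the tensor \<open>\<Sum> \<Delta>(f)(U, W) [U] \<otimes> [W]\<close>; there are only finitely many nonzero terms as a
  representation has only finitely many direct sum decompositions. The counit is the evaluation at
  the class of \<open>0\<close>, the only counit for this coproduct.
\<close>

definition hall_algebra ::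
    "('v, 'a) pre_digraph \<Rightarrow> ('v, 'a) rep set \<Rightarrow> ('v, 'a) hall hopf" where
  "hall_algebra Q C = (let cls = iso_class Q ` C in \<lparr>
     carrier = {f. finite {U. f U \<noteq> 0} \<and> {U. f U \<noteq> 0} \<subseteq> cls},
     monoid.mult = (\<lambda>f g U. if U \<in> cls
        then (\<Sum>A | f A \<noteq> 0. \<Sum>B | g B \<noteq> 0.
                f A * g B * of_nat (hall_number Q (rep_of A) (rep_of B) (rep_of U)))
        else 0),
     monoid.one = rep_basis Q zero_rep,
     ring.zero = (\<lambda>_. 0),
     ring.add = (\<lambda>f g U. f U + g U),
     module.smult = (\<lambda>c f U. c * f U),
     comult = (\<lambda>f.
        let \<Delta>f = (\<lambda>(U, W). f (iso_class Q (dsum (rep_of U) (rep_of W))))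
        in \<Sum>(U, W) | (U, W) \<in> cls \<times> cls \<and> \<Delta>f (U, W) \<noteq> 0.
             Poly_Mapping.single (class_basis U, class_basis W) (\<Delta>f (U, W))),
     counit = (\<lambda>f. f (iso_class Q zero_rep))\<rparr>)"

abbreviation hall :: "('v, 'a) pre_digraph \<Rightarrow> ('v, 'a) hall hopf" where
  "hall Q \<equiv> hall_algebra Q (reps Q)"

abbreviation hall_nil :: "('v, 'a) pre_digraph \<Rightarrow> ('v, 'a) hall hopf" where
  "hall_nil Q \<equiv> hall_algebra Q (nil_reps Q)"

abbreviation hall_nice :: "('v, 'a) pre_digraph \<Rightarrow> ('v, 'a) hall hopf" where
  "hall_nice Q \<equiv> hall_algebra Q {M \<in> reps Q. nice_length Q M < \<infinity>}"

abbreviation hall_nil_nice :: "('v, 'a) pre_digraph \<Rightarrow> ('v, 'a) hall hopf" where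
  "hall_nil_nice Q \<equiv> hall_algebra Q {M \<in> nil_reps Q. nice_length Q M < \<infinity>}"

definition non_nice_span :: "('v, 'a) pre_digraph \<Rightarrow> ('v, 'a) hall set" where
  "non_nice_span Q = lin_span (hall Q) {rep_basis Q M | M. M \<in> reps Q \<and> nice_length Q M = \<infinity>}"

definition nil_non_nice_span :: "('v, 'a) pre_digraph \<Rightarrow> ('v, 'a) hall set" where
  "nil_non_nice_span Q =
     lin_span (hall_nil Q) {rep_basis Q M | M. M \<in> nil_reps Q \<and> nice_length Q M = \<infinity>}"

end

theory Submission
  imports Defs
begin


text \<open>
  Two closure properties carry the theorem. A representation embeds in another one (\<open>rep_emb\<close>)
  if its coefficient quiver maps injectively into the other one, preserving arrows and colours;
  subrepresentations and quotients of \<open>R\<close> embed in \<open>R\<close>. Nilpotency and finite nice length pass to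
  embedded representations, because nonzero composites and nice sequences can be transported along
  the embedding, and both pass to direct sums (\<open>nilpotent_dsum\<close>, \<open>nice_length_dsum\<close>): a nice
  sequence for \<open>M \<oplus> N\<close> starts with a grading that tells the summands apart and then runs the
  sequences of \<open>M\<close> and \<open>N\<close> side by side. So all representations, the nilpotent ones, and those of
  finite nice length in either class form classes that are closed under embedded representations
  and direct sums (\<open>hall_class\<close>).

  For every such class \<open>C\<close> the Hall algebra is a Hopf algebra. An element is a class function with
  finite support; the product has at \<open>R\<close> the value \<open>\<Sum>L. f (R/L) * g L\<close> over the
  subrepresentations \<open>L\<close>, and the coproduct has at \<open>(M, N)\<close> the value \<open>f (M \<oplus> N)\<close>. Associativity
  counts chains of two subrepresentations in two ways. The coproduct is multiplicative because a
  subrepresentation of \<open>M \<oplus> N\<close> is a sum of subrepresentations of \<open>M\<close> and \<open>N\<close>, as subsets of a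
  disjoint union split. The antipode is explicit: \<open>S f\<close> has at \<open>R\<close> the value
  \<open>\<Sum>F. (-1)^k * f (gr F)\<close>, where \<open>F\<close> runs over the flags \<open>0 = L\<^sub>0 < \<dots> < L\<^sub>k = R\<close> and \<open>gr F\<close> is the
  associated graded representation. In the antipode identities one sums over all chains that are
  fixed at one end only, and inserting or deleting the other end reverses the sign without changing
  the associated graded representation (\<open>hanti_left\<close>, \<open>hanti_right\<close>).

  If \<open>D \<subseteq> C\<close> is another such class, then the functions that vanish on \<open>D\<close> form the span of the
  basis elements outside \<open>D\<close>. They form a Hopf ideal: for \<open>R \<in> D\<close> the values at \<open>R\<close> of products and
  antipodes only involve subrepresentations, quotients and associated graded representations of
  \<open>R\<close>, which embed in \<open>R\<close> and thus lie in \<open>D\<close>, and \<open>M, N \<in> D\<close> implies \<open>M \<oplus> N \<in> D\<close>. Restriction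
  of functions to \<open>D\<close> identifies the quotient with the Hall algebra of \<open>D\<close>.

  Equality of tensors is congruence modulo the bilinearity relations. It is decided by the
  functionals that evaluate products of coordinates (\<open>tensor2_eqI\<close>, \<open>tensor3_eqI\<close>), so that all
  axioms become identities between values of class functions. They are verified once for every
  structure that has such coordinates (\<open>hall_coords\<close>), and this covers both the Hall algebra and its
  quotient.
\<close>


section \<open>Representations and their coefficient quivers\<close>

locale quiver = fin_digraph Q for Q :: "('v, 'a) pre_digraph"

context quiver
begin

lemma reps_finite: "M \<in> reps Q \<Longrightarrow> v \<in> verts Q \<Longrightarrow> finite (car M v)"
  by (simp add: reps_def f1_space_def)

lemma reps_zero: "M \<in> reps Q \<Longrightarrow> v \<in> verts Q \<Longrightarrow> 0 \<in> car M v"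
  by (simp add: reps_def f1_space_def)

lemma act_closed:
  "M \<in> reps Q \<Longrightarrow> \<alpha> \<in> arcs Q \<Longrightarrow> x \<in> car M (tail Q \<alpha>) \<Longrightarrow> act M \<alpha> x \<in> car M (head Q \<alpha>)"
  by (auto simp: reps_def f1_linear_def)

lemma act_zero: "M \<in> reps Q \<Longrightarrow> \<alpha> \<in> arcs Q \<Longrightarrow> act M \<alpha> 0 = 0"
  by (auto simp: reps_def f1_linear_def)

lemma act_inj:
  "M \<in> reps Q \<Longrightarrow> \<alpha> \<in> arcs Q \<Longrightarrow> x \<in> car M (tail Q \<alpha>) \<Longrightarrow> y \<in> car M (tail Q \<alpha>) \<Longrightarrow>
    act M \<alpha> x = act M \<alpha> y \<Longrightarrow> act M \<alpha> x \<noteq> 0 \<Longrightarrow> x = y"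
  by (auto simp: reps_def f1_linear_def inj_on_def)

lemma repsI:
  assumes "\<And>v. v \<in> verts Q \<Longrightarrow> finite (car M v)"
    and "\<And>v. v \<in> verts Q \<Longrightarrow> 0 \<in> car M v"
    and "\<And>\<alpha> x. \<alpha> \<in> arcs Q \<Longrightarrow> x \<in> car M (tail Q \<alpha>) \<Longrightarrow> act M \<alpha> x \<in> car M (head Q \<alpha>)"
    and "\<And>\<alpha>. \<alpha> \<in> arcs Q \<Longrightarrow> act M \<alpha> 0 = 0"
    and "\<And>\<alpha> x y. \<alpha> \<in> arcs Q \<Longrightarrow> x \<in> car M (tail Q \<alpha>) \<Longrightarrow> y \<in> car M (tail Q \<alpha>) \<Longrightarrow>
      act M \<alpha> x = act M \<alpha> y \<Longrightarrow> act M \<alpha> y \<noteq> 0 \<Longrightarrow> x = y"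
  shows "M \<in> reps Q"
  using assms by (auto simp: reps_def f1_space_def f1_linear_def inj_on_def)

lemma zero_rep_in_reps: "zero_rep \<in> reps Q"
  by (rule repsI) (auto simp: zero_rep_def)


subsection \<open>Isomorphisms and isomorphism classes\<close>

definition iso_via :: "('v \<Rightarrow> nat \<Rightarrow> nat) \<Rightarrow> ('v, 'a) rep \<Rightarrow> ('v, 'a) rep \<Rightarrow> bool" where
  "iso_via h M N \<longleftrightarrow>
     (\<forall>v\<in>verts Q. bij_betw (h v) (car M v) (car N v) \<and> h v 0 = 0) \<and>
     (\<forall>\<alpha>\<in>arcs Q. \<forall>x\<in>car M (tail Q \<alpha>). h (head Q \<alpha>) (act M \<alpha> x) = act N \<alpha> (h (tail Q \<alpha>) x))"

text \<open>A bijection is injective wherever it is nonzero, so of \<open>f1_linear\<close> only \<open>h v 0 = 0\<close> remains.\<close>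

lemma rep_iso_iff: "rep_iso Q M N \<longleftrightarrow> (\<exists>h. iso_via h M N)"
proof -
  have "f1_linear A B f \<and> bij_betw f A B \<longleftrightarrow> bij_betw f A B \<and> f 0 = 0" for A B f
    unfolding f1_linear_def bij_betw_def by (auto intro: inj_on_subset)
  then show ?thesis unfolding rep_iso_def iso_via_def by simp
qed

lemma iso_viaD:
  assumes "iso_via h M N" "v \<in> verts Q"
  shows "bij_betw (h v) (car M v) (car N v)" "h v 0 = 0" "inj_on (h v) (car M v)"
    "h v ` car M v = car N v" "\<And>x. x \<in> car M v \<Longrightarrow> h v x \<in> car N v"
  using assms by (auto simp: iso_via_def bij_betw_def)

lemma iso_via_act:
  "iso_via h M N \<Longrightarrow> \<alpha> \<in> arcs Q \<Longrightarrow> x \<in> car M (tail Q \<alpha>) \<Longrightarrow>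
    h (head Q \<alpha>) (act M \<alpha> x) = act N \<alpha> (h (tail Q \<alpha>) x)"
  by (simp add: iso_via_def)

lemma iso_via_nonzero:
  assumes "iso_via h M N" "M \<in> reps Q" "v \<in> verts Q" "x \<in> car M v"
  shows "h v x = 0 \<longleftrightarrow> x = 0"
  using iso_viaD[OF assms(1,3)] reps_zero[OF assms(2,3)] assms(4) by (metis inj_onD)

lemma rep_iso_idI:
  assumes "\<And>v. v \<in> verts Q \<Longrightarrow> car M v = car N v"
    and "\<And>\<alpha> x. \<alpha> \<in> arcs Q \<Longrightarrow> x \<in> car M (tail Q \<alpha>) \<Longrightarrow> act M \<alpha> x = act N \<alpha> x"
  shows "rep_iso Q M N"
  unfolding rep_iso_iff iso_via_def
  by (rule exI[of _ "\<lambda>_ x. x"]) (auto simp: assms bij_betw_def)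

lemma rep_iso_refl: "rep_iso Q M M"
  by (rule rep_iso_idI) auto

lemma iso_via_inv:
  assumes "M \<in> reps Q" "iso_via h M N"
  shows "iso_via (\<lambda>v. inv_into (car M v) (h v)) N M" (is "iso_via ?g N M")
proof -
  have gh: "?g v (h v x) = x" if "v \<in> verts Q" "x \<in> car M v" for v x
    using iso_viaD(3)[OF assms(2) that(1)] that(2) by simp
  show ?thesis
    unfolding iso_via_def
  proof (intro conjI ballI)
    fix v assume v: "v \<in> verts Q"
    show "bij_betw (?g v) (car N v) (car M v)"
      by (rule bij_betw_inv_into[OF iso_viaD(1)[OF assms(2) v]])
    show "?g v 0 = 0"
      using gh[OF v reps_zero[OF assms(1) v]] iso_viaD(2)[OF assms(2) v] by simp
  next
    fix \<alpha> x assume a: "\<alpha> \<in> arcs Q" "x \<in> car N (tail Q \<alpha>)"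
    have t: "tail Q \<alpha> \<in> verts Q" "head Q \<alpha> \<in> verts Q" using a by auto
    obtain y where y: "y \<in> car M (tail Q \<alpha>)" "x = h (tail Q \<alpha>) y"
      using a(2) iso_viaD(4)[OF assms(2) t(1)] by blast
    show "?g (head Q \<alpha>) (act N \<alpha> x) = act M \<alpha> (?g (tail Q \<alpha>) x)"
      using gh[OF t(2) act_closed[OF assms(1) a(1) y(1)]] gh[OF t(1) y(1)]
        iso_via_act[OF assms(2) a(1) y(1)] y(2)
      by simp
  qed
qed

lemma rep_iso_sym: "M \<in> reps Q \<Longrightarrow> rep_iso Q M N \<Longrightarrow> rep_iso Q N M"
  using iso_via_inv unfolding rep_iso_iff by blast

lemma rep_iso_trans:
  assumes "rep_iso Q L M" "rep_iso Q M N"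
  shows "rep_iso Q L N"
proof -
  obtain h where h: "iso_via h L M" using assms(1) rep_iso_iff by blast
  obtain k where k: "iso_via k M N" using assms(2) rep_iso_iff by blast
  have "iso_via (\<lambda>v. k v \<circ> h v) L N"
    unfolding iso_via_def
  proof (intro conjI ballI)
    fix v assume v: "v \<in> verts Q"
    show "bij_betw (k v \<circ> h v) (car L v) (car N v)"
      by (rule bij_betw_trans[OF iso_viaD(1)[OF h v] iso_viaD(1)[OF k v]])
    show "(k v \<circ> h v) 0 = 0" using iso_viaD(2)[OF h v] iso_viaD(2)[OF k v] by simp
  next
    fix \<alpha> x assume a: "\<alpha> \<in> arcs Q" "x \<in> car L (tail Q \<alpha>)"
    then have "h (tail Q \<alpha>) x \<in> car M (tail Q \<alpha>)"
      using iso_viaD(5)[OF h] by simp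
    then show "(k (head Q \<alpha>) \<circ> h (head Q \<alpha>)) (act L \<alpha> x) = act N \<alpha> ((k (tail Q \<alpha>) \<circ> h (tail Q \<alpha>)) x)"
      using iso_via_act[OF h a] iso_via_act[OF k a(1)] by simp
  qed
  then show ?thesis using rep_iso_iff by blast
qed

abbreviation cl :: "('v, 'a) rep \<Rightarrow> ('v, 'a) rep set" where
  "cl \<equiv> iso_class Q"

lemma iso_class_eq_iff:
  assumes "M \<in> reps Q" "N \<in> reps Q"
  shows "cl M = cl N \<longleftrightarrow> rep_iso Q M N"
proof
  assume "cl M = cl N"
  moreover have "N \<in> cl N" using assms by (simp add: iso_class_def rep_iso_refl)
  ultimately show "rep_iso Q M N" by (auto simp: iso_class_def)
next
  assume "rep_iso Q M N"
  then show "cl M = cl N"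
    using rep_iso_trans rep_iso_sym assms unfolding iso_class_def by blast
qed

lemma iso_class_eqI:
  "M \<in> reps Q \<Longrightarrow> N \<in> reps Q \<Longrightarrow> rep_iso Q M N \<Longrightarrow> cl M = cl N"
  by (simp add: iso_class_eq_iff)

lemma rep_of_iso_class:
  assumes "M \<in> reps Q"
  shows "rep_of (cl M) \<in> reps Q" "rep_iso Q M (rep_of (cl M))"
proof -
  have "M \<in> cl M" using assms by (simp add: iso_class_def rep_iso_refl)
  then have "rep_of (cl M) \<in> cl M" unfolding rep_of_def by (rule someI)
  then show "rep_of (cl M) \<in> reps Q" "rep_iso Q M (rep_of (cl M))"
    by (auto simp: iso_class_def)
qed

lemma iso_class_rep_of: "M \<in> reps Q \<Longrightarrow> cl (rep_of (cl M)) = cl M"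
  using rep_of_iso_class iso_class_eq_iff by metis


subsection \<open>Embeddings of coefficient quivers\<close>

text \<open>
  An embedding is only defined on the nonzero elements, and the target may have further arrows
  between the images. Thus a representation that is obtained from \<open>R\<close> by omitting elements and
  arrows embeds in \<open>R\<close>.
\<close>

definition emb_via :: "('v \<Rightarrow> nat \<Rightarrow> nat) \<Rightarrow> ('v, 'a) rep \<Rightarrow> ('v, 'a) rep \<Rightarrow> bool" where
  "emb_via h M N \<longleftrightarrow>
     (\<forall>v\<in>verts Q. h v ` (car M v - {0}) \<subseteq> car N v - {0} \<and> inj_on (h v) (car M v - {0})) \<and>
     (\<forall>\<alpha>\<in>arcs Q. \<forall>x\<in>car M (tail Q \<alpha>). x \<noteq> 0 \<longrightarrow> act M \<alpha> x \<noteq> 0 \<longrightarrow>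
        act N \<alpha> (h (tail Q \<alpha>) x) = h (head Q \<alpha>) (act M \<alpha> x))"

definition rep_emb :: "('v, 'a) rep \<Rightarrow> ('v, 'a) rep \<Rightarrow> bool" where
  "rep_emb M N \<longleftrightarrow> (\<exists>h. emb_via h M N)"

lemma emb_viaD:
  assumes "emb_via h M N" "v \<in> verts Q" "x \<in> car M v" "x \<noteq> 0"
  shows "h v x \<in> car N v" "h v x \<noteq> 0"
    "\<And>y. y \<in> car M v \<Longrightarrow> y \<noteq> 0 \<Longrightarrow> h v x = h v y \<Longrightarrow> x = y"
proof -
  have "h v x \<in> car N v - {0}" "inj_on (h v) (car M v - {0})"
    using assms unfolding emb_via_def by blast+
  then show "h v x \<in> car N v" "h v x \<noteq> 0"
    "\<And>y. y \<in> car M v \<Longrightarrow> y \<noteq> 0 \<Longrightarrow> h v x = h v y \<Longrightarrow> x = y"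
    using assms by (auto simp del: neq0_conv dest: inj_onD)
qed

lemma emb_via_act:
  "emb_via h M N \<Longrightarrow> \<alpha> \<in> arcs Q \<Longrightarrow> x \<in> car M (tail Q \<alpha>) \<Longrightarrow> x \<noteq> 0 \<Longrightarrow> act M \<alpha> x \<noteq> 0 \<Longrightarrow>
    act N \<alpha> (h (tail Q \<alpha>) x) = h (head Q \<alpha>) (act M \<alpha> x)"
  by (simp add: emb_via_def)

lemma rep_emb_idI:
  assumes "\<And>v. v \<in> verts Q \<Longrightarrow> car M v \<subseteq> car N v"
    and "\<And>\<alpha> x. \<alpha> \<in> arcs Q \<Longrightarrow> x \<in> car M (tail Q \<alpha>) \<Longrightarrow> act M \<alpha> x \<noteq> 0 \<Longrightarrow> act M \<alpha> x = act N \<alpha> x"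
  shows "rep_emb M N"
proof -
  have "emb_via (\<lambda>_ x. x) M N"
    unfolding emb_via_def
  proof (intro conjI ballI impI)
    fix \<alpha> x assume "\<alpha> \<in> arcs Q" "x \<in> car M (tail Q \<alpha>)" "act M \<alpha> x \<noteq> 0"
    then show "act N \<alpha> x = act M \<alpha> x" using assms(2) by metis
  qed (use assms(1) in auto)
  then show ?thesis unfolding rep_emb_def by blast
qed

lemma rep_iso_emb:
  assumes "M \<in> reps Q" "rep_iso Q M N"
  shows "rep_emb M N"
proof -
  obtain h where h: "iso_via h M N" using assms(2) rep_iso_iff by blast
  have "emb_via h M N"
    unfolding emb_via_def
  proof (intro conjI ballI impI)
    fix v assume v: "v \<in> verts Q"
    show "h v ` (car M v - {0}) \<subseteq> car N v - {0}"
    proof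
      fix y assume "y \<in> h v ` (car M v - {0})"
      then obtain x where "x \<in> car M v" "x \<noteq> 0" "y = h v x" by blast
      then show "y \<in> car N v - {0}"
        using iso_viaD(5)[OF h v] iso_via_nonzero[OF h assms(1) v] by simp
    qed
    show "inj_on (h v) (car M v - {0})" using iso_viaD(3)[OF h v] by (rule inj_on_subset) auto
  next
    fix \<alpha> x assume a: "\<alpha> \<in> arcs Q" "x \<in> car M (tail Q \<alpha>)"
    show "act N \<alpha> (h (tail Q \<alpha>) x) = h (head Q \<alpha>) (act M \<alpha> x)"
      using iso_via_act[OF h a] by (rule sym)
  qed
  then show ?thesis unfolding rep_emb_def by blast
qed

text \<open>
  An embedding maps a nonzero composite along a path of \<open>Q\<close> to a nonzero composite along the same
  path.
\<close>

lemma nilpotent_rep_emb: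
  assumes M: "M \<in> reps Q" and N: "nilpotent_rep Q N" and "rep_emb M N"
  shows "nilpotent_rep Q M"
proof -
  obtain h where h: "emb_via h M N" using assms(3) rep_emb_def by blast
  have fold0: "fold (act M) p 0 = 0" if "set p \<subseteq> arcs Q" for p
    using that by (induction p) (auto simp: act_zero[OF M])
  have key: "fold (act M) p x \<noteq> 0 \<Longrightarrow>
      fold (act M) p x \<in> car M v \<and> fold (act N) p (h u x) = h v (fold (act M) p x)"
    if "u \<in> verts Q" "set p \<subseteq> arcs Q" "cas u p v" "x \<in> car M u" for u p v x
    using that
  proof (induction p arbitrary: u x)
    case (Cons e p)
    have e: "e \<in> arcs Q" "tail Q e = u" "cas (head Q e) p v" using Cons.prems by auto
    have nz: "act M e x \<noteq> 0" using Cons.prems(1,3) fold0[of p] by (intro notI) simp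
    then have "x \<noteq> 0" using act_zero[OF M e(1)] by metis
    have ac: "act M e x \<in> car M (head Q e)" using act_closed[OF M e(1)] e(2) Cons.prems by auto
    show ?case
      using Cons.IH[of "act M e x" "head Q e"] Cons.prems e ac
        emb_via_act[OF h e(1) _ \<open>x \<noteq> 0\<close> nz] by auto
  qed auto
  obtain K where K: "\<forall>n\<ge>K. \<forall>u p v. awalk u p v \<and> length p = n \<longrightarrow> (\<forall>x\<in>car N u. fold (act N) p x = 0)"
    using N unfolding nilpotent_rep_def by (elim exE)
  show ?thesis
    unfolding nilpotent_rep_def
  proof (intro exI[of _ K] allI impI ballI, elim conjE, rule ccontr)
    fix n u p v x
    assume a: "K \<le> n" "x \<in> car M u" "awalk u p v" "length p = n" and nz: "fold (act M) p x \<noteq> 0"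
    have w: "u \<in> verts Q" "set p \<subseteq> arcs Q" "cas u p v" "v \<in> verts Q"
      using a(3) awalk_last_in_verts[OF a(3)] by (auto simp: awalk_def)
    have "x \<noteq> 0" using nz fold0[OF w(2)] by metis
    have "fold (act N) p (h u x) = 0" using K[rule_format, OF a(1) _ emb_viaD(1)[OF h w(1) a(2) \<open>x \<noteq> 0\<close>]] a(3,4) by blast
    then show False using key[OF w(1-3) a(2) nz] emb_viaD(2)[OF h w(4)] nz by simp
  qed
qed


subsection \<open>Finite nice length\<close>

lemma rel_nice_grading_iff:
  "rel_nice_grading Q M D i d \<longleftrightarrow> (\<forall>\<alpha>\<in>arcs Q. \<forall>x\<in>car M (tail Q \<alpha>). \<forall>y\<in>car M (tail Q \<alpha>).
     x \<noteq> 0 \<longrightarrow> y \<noteq> 0 \<longrightarrow> act M \<alpha> x \<noteq> 0 \<longrightarrow> act M \<alpha> y \<noteq> 0 \<longrightarrow>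
     (\<forall>j<i. D j (tail Q \<alpha>, x) = D j (tail Q \<alpha>, y) \<and>
       D j (head Q \<alpha>, act M \<alpha> x) = D j (head Q \<alpha>, act M \<alpha> y)) \<longrightarrow>
     d (head Q \<alpha>, act M \<alpha> x) - d (tail Q \<alpha>, x) = d (head Q \<alpha>, act M \<alpha> y) - d (tail Q \<alpha>, y))"
  unfolding rel_nice_grading_def Let_def coeff_quiver_def colour_def by auto

text \<open>
  A nice grading is one that is nice relative to the empty sequence, so that all members
  of a nice sequence satisfy the same kind of condition.
\<close>

lemma nice_sequence_iff: "nice_sequence Q M D \<longleftrightarrow> (\<forall>i. rel_nice_grading Q M D i (D i))"
proof -
  have "nice_grading Q M (D 0) = rel_nice_grading Q M D 0 (D 0)"
    unfolding nice_grading_def rel_nice_grading_def Let_def by simp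
  then show ?thesis unfolding nice_sequence_def by (metis gr0I)
qed

definition separates :: "('v, 'a) rep \<Rightarrow> nat \<Rightarrow> (nat \<Rightarrow> 'v \<times> nat \<Rightarrow> int) \<Rightarrow> bool" where
  "separates M n D \<longleftrightarrow> (\<forall>v\<in>verts Q. \<forall>w\<in>verts Q. \<forall>x\<in>car M v. \<forall>y\<in>car M w.
     x \<noteq> 0 \<longrightarrow> y \<noteq> 0 \<longrightarrow> (v, x) \<noteq> (w, y) \<longrightarrow> (\<exists>i\<le>n. D i (v, x) \<noteq> D i (w, y)))"

lemma nice_length_finite_iff:
  "nice_length Q M < \<infinity> \<longleftrightarrow> (\<exists>n D. (\<forall>i. rel_nice_grading Q M D i (D i)) \<and> separates M n D)"
proof -
  have "(\<forall>x\<in>verts (coeff_quiver Q M). \<forall>y\<in>verts (coeff_quiver Q M).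
        x \<noteq> y \<longrightarrow> (\<exists>i\<le>n. D i x \<noteq> D i y)) = separates M n D" for n D
    unfolding separates_def by (auto simp: coeff_quiver_def)
  then have "nice_length Q M =
      Inf {enat n | n. \<exists>D. (\<forall>i. rel_nice_grading Q M D i (D i)) \<and> separates M n D}"
    unfolding nice_length_def nice_sequence_iff by simp
  then have "nice_length Q M < \<infinity> \<longleftrightarrow>
      (\<exists>e\<in>{enat n | n. \<exists>D. (\<forall>i. rel_nice_grading Q M D i (D i)) \<and> separates M n D}. e < \<infinity>)"
    by (simp only: Inf_less_iff)
  also have "\<dots> \<longleftrightarrow> (\<exists>n D. (\<forall>i. rel_nice_grading Q M D i (D i)) \<and> separates M n D)"
    by auto
  finally show ?thesis .
qed

text \<open>
  The nice sequence of \<open>N\<close> is pulled back along the embedding, which maps arrows to arrows of the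
  same colour and distinct vertices to distinct vertices.
\<close>

lemma nice_length_emb:
  assumes M: "M \<in> reps Q" and N: "nice_length Q N < \<infinity>" and "rep_emb M N"
  shows "nice_length Q M < \<infinity>"
proof -
  obtain h where h: "emb_via h M N" using assms(3) rep_emb_def by blast
  obtain n D where D: "\<And>i. rel_nice_grading Q N D i (D i)" and sep: "separates N n D"
    using N unfolding nice_length_finite_iff by blast
  define E where "E i = (\<lambda>(v, x). D i (v, h v x))" for i
  show ?thesis
    unfolding nice_length_finite_iff
  proof (intro exI[of _ n] exI[of _ E] conjI allI)
    fix i
    show "rel_nice_grading Q M E i (E i)"
      unfolding rel_nice_grading_iff
    proof (intro ballI impI)
      fix \<alpha> x y
      assume a: "\<alpha> \<in> arcs Q" "x \<in> car M (tail Q \<alpha>)" "y \<in> car M (tail Q \<alpha>)" "x \<noteq> 0" "y \<noteq> 0"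
        and nz: "act M \<alpha> x \<noteq> 0" "act M \<alpha> y \<noteq> 0"
        and eq: "\<forall>j<i. E j (tail Q \<alpha>, x) = E j (tail Q \<alpha>, y) \<and>
          E j (head Q \<alpha>, act M \<alpha> x) = E j (head Q \<alpha>, act M \<alpha> y)"
      have t: "tail Q \<alpha> \<in> verts Q" "head Q \<alpha> \<in> verts Q" using a by auto
      have e: "act N \<alpha> (h (tail Q \<alpha>) x) = h (head Q \<alpha>) (act M \<alpha> x)"
        "act N \<alpha> (h (tail Q \<alpha>) y) = h (head Q \<alpha>) (act M \<alpha> y)"
        using emb_via_act[OF h] a nz by auto
      have m: "h (tail Q \<alpha>) x \<in> car N (tail Q \<alpha>)" "h (tail Q \<alpha>) y \<in> car N (tail Q \<alpha>)"
        "h (tail Q \<alpha>) x \<noteq> 0" "h (tail Q \<alpha>) y \<noteq> 0"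
        by (rule emb_viaD[OF h t(1)], fact+)+
      have m': "h (head Q \<alpha>) (act M \<alpha> x) \<noteq> 0" "h (head Q \<alpha>) (act M \<alpha> y) \<noteq> 0"
        using emb_viaD(2)[OF h t(2) act_closed[OF M a(1)]] a nz by simp_all
      show "E i (head Q \<alpha>, act M \<alpha> x) - E i (tail Q \<alpha>, x)
          = E i (head Q \<alpha>, act M \<alpha> y) - E i (tail Q \<alpha>, y)"
        using D[of i, unfolded rel_nice_grading_iff, rule_format, OF a(1) m] m' eq
        by (simp add: e E_def)
    qed
  next
    show "separates M n E"
      unfolding separates_def
    proof (intro ballI impI)
      fix v w x y
      assume a: "v \<in> verts Q" "w \<in> verts Q" "x \<in> car M v" "y \<in> car M w" "x \<noteq> 0" "y \<noteq> 0"
        "(v, x) \<noteq> (w, y)"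
      have ne: "(v, h v x) \<noteq> (w, h w y)" using a emb_viaD(3)[OF h] by blast
      show "\<exists>i\<le>n. E i (v, x) \<noteq> E i (w, y)"
        using sep[unfolded separates_def, rule_format, OF a(1,2) _ _ _ _ ne] emb_viaD(1,2)[OF h] a
        unfolding E_def by simp
    qed
  qed
qed


section \<open>Subrepresentations, quotients and direct sums\<close>

lemma subrepsD:
  assumes "L \<in> subreps Q R"
  shows "v \<in> verts Q \<Longrightarrow> L v \<subseteq> car R v" "v \<in> verts Q \<Longrightarrow> 0 \<in> L v"
    "\<alpha> \<in> arcs Q \<Longrightarrow> x \<in> L (tail Q \<alpha>) \<Longrightarrow> act R \<alpha> x \<in> L (head Q \<alpha>)"
    "v \<notin> verts Q \<Longrightarrow> L v = undefined"
  using assms by (fastforce simp: subreps_def PiE_iff extensional_def)+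

lemma subrepsI:
  assumes "\<And>v. v \<in> verts Q \<Longrightarrow> L v \<subseteq> car R v" "\<And>v. v \<in> verts Q \<Longrightarrow> 0 \<in> L v"
    and "\<And>\<alpha> x. \<alpha> \<in> arcs Q \<Longrightarrow> x \<in> L (tail Q \<alpha>) \<Longrightarrow> act R \<alpha> x \<in> L (head Q \<alpha>)"
    and "\<And>v. v \<notin> verts Q \<Longrightarrow> L v = undefined"
  shows "L \<in> subreps Q R"
  using assms by (auto simp: subreps_def PiE_iff extensional_def)

lemma subreps_eqI:
  assumes "K \<in> subreps Q R" "L \<in> subreps Q R'" "\<And>v. v \<in> verts Q \<Longrightarrow> K v = L v"
  shows "K = L"
  using assms subrepsD(4)[OF assms(1)] subrepsD(4)[OF assms(2)] by (intro ext) metis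

lemma finite_subreps:
  assumes "R \<in> reps Q"
  shows "finite (subreps Q R)"
proof -
  have "finite (\<Pi>\<^sub>E v\<in>verts Q. {A. A \<subseteq> car R v \<and> 0 \<in> A})"
    by (intro finite_PiE) (auto simp: reps_finite[OF assms])
  then show ?thesis unfolding subreps_def by simp
qed

lemma sub_rep_simps [simp]: "car (sub_rep R L) = L" "act (sub_rep R L) = act R"
  by (simp_all add: sub_rep_def)

lemma quot_rep_simps [simp]:
  "car (quot_rep Q R L) v = insert 0 (car R v - L v)"
  "act (quot_rep Q R L) \<alpha> x = (if act R \<alpha> x \<in> L (head Q \<alpha>) then 0 else act R \<alpha> x)"
  by (simp_all add: quot_rep_def)

lemma sub_rep_reps:
  assumes "R \<in> reps Q" "L \<in> subreps Q R"
  shows "sub_rep R L \<in> reps Q"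
proof (rule repsI)
  fix \<alpha> x y assume "\<alpha> \<in> arcs Q" "x \<in> car (sub_rep R L) (tail Q \<alpha>)" "y \<in> car (sub_rep R L) (tail Q \<alpha>)"
    "act (sub_rep R L) \<alpha> x = act (sub_rep R L) \<alpha> y" "act (sub_rep R L) \<alpha> y \<noteq> 0"
  then show "x = y"
    using act_inj[OF assms(1), of \<alpha> x y] subrepsD(1)[OF assms(2), of "tail Q \<alpha>"] by auto
next
  fix v assume "v \<in> verts Q"
  then show "finite (car (sub_rep R L) v)"
    using finite_subset[OF subrepsD(1)[OF assms(2)] reps_finite[OF assms(1)]] by simp
qed (use subrepsD[OF assms(2)] act_zero[OF assms(1)] in auto)

lemma sub_rep_emb: "L \<in> subreps Q R \<Longrightarrow> rep_emb (sub_rep R L) R"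
  by (rule rep_emb_idI) (auto dest: subrepsD(1))

lemma quot_rep_reps:
  assumes "R \<in> reps Q" "L \<in> subreps Q R"
  shows "quot_rep Q R L \<in> reps Q"
proof (rule repsI)
  fix \<alpha> x assume a: "\<alpha> \<in> arcs Q" "x \<in> car (quot_rep Q R L) (tail Q \<alpha>)"
  then have "x \<in> car R (tail Q \<alpha>)" using reps_zero[OF assms(1), of "tail Q \<alpha>"] by auto
  then show "act (quot_rep Q R L) \<alpha> x \<in> car (quot_rep Q R L) (head Q \<alpha>)"
    using act_closed[OF assms(1) a(1)] by simp
next
  fix \<alpha> x y assume a: "\<alpha> \<in> arcs Q" "x \<in> car (quot_rep Q R L) (tail Q \<alpha>)"
    "y \<in> car (quot_rep Q R L) (tail Q \<alpha>)"
    "act (quot_rep Q R L) \<alpha> x = act (quot_rep Q R L) \<alpha> y" "act (quot_rep Q R L) \<alpha> y \<noteq> 0"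
  have "x \<in> car R (tail Q \<alpha>)" "y \<in> car R (tail Q \<alpha>)"
    using a reps_zero[OF assms(1), of "tail Q \<alpha>"] by auto
  moreover have "act R \<alpha> x = act R \<alpha> y" "act R \<alpha> x \<noteq> 0" using a(4,5) by (auto split: if_splits)
  ultimately show "x = y" using act_inj[OF assms(1) a(1)] by blast
qed (use reps_finite[OF assms(1)] act_zero[OF assms(1)] in auto)

lemma quot_rep_emb:
  assumes "R \<in> reps Q"
  shows "rep_emb (quot_rep Q R L) R"
proof (rule rep_emb_idI)
  fix v assume "v \<in> verts Q"
  then show "car (quot_rep Q R L) v \<subseteq> car R v" using reps_zero[OF assms] by auto
qed (simp split: if_splits)


subsection \<open>Direct sums\<close>

lemma car_dsum: "car (dsum M N) v = (\<lambda>x. 2 * x) ` car M v \<union> (\<lambda>x. 2 * x - 1) ` car N v"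
  by (simp add: dsum_def)

lemma act_dsum_left [simp]: "act (dsum M N) \<alpha> (2 * x) = 2 * act M \<alpha> x"
  by (simp add: dsum_def)

lemma act_dsum_right:
  fixes M N :: "('v, 'a) rep"
  shows "x \<noteq> 0 \<Longrightarrow> act (dsum M N) \<alpha> (2 * x - 1) = 2 * act N \<alpha> x - 1"
  by (simp add: dsum_def)

lemma act_dsum_zero: "act (dsum M N) \<alpha> 0 = 2 * act M \<alpha> 0"
  by (simp add: dsum_def)

text \<open>Both summands contain \<open>0\<close>; it is counted as an element of the first one.\<close>

lemma car_dsum_cases:
  assumes "y \<in> car (dsum M N) v" "0 \<in> car M v"
  obtains x where "x \<in> car M v" "y = 2 * x"
  | x where "x \<in> car N v" "x \<noteq> 0" "y = 2 * x - 1"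
proof -
  consider x where "x \<in> car M v" "y = 2 * x" | x where "x \<in> car N v" "y = 2 * x - 1"
    using assms(1) unfolding car_dsum by blast
  then show thesis
  proof cases
    case 1
    then show thesis using that(1) by blast
  next
    case (2 x)
    show thesis
    proof (cases "x = 0")
      case True
      then have "y = 2 * 0" using 2 by simp
      then show thesis using that(1) assms(2) by blast
    next
      case False
      then show thesis using that(2) 2 by blast
    qed
  qed
qed

lemma odd_double_minus_one: "(x::nat) \<noteq> 0 \<Longrightarrow> odd (2 * x - 1)"
  by presburger

lemma half_double_minus_one: "(x::nat) \<noteq> 0 \<Longrightarrow> (2 * x - 1 + 1) div 2 = x"
  by presburger

lemma dsum_reps:
  assumes M: "M \<in> reps Q" and N: "N \<in> reps Q"
  shows "dsum M N \<in> reps Q"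
proof (rule repsI)
  fix v assume v: "v \<in> verts Q"
  show "finite (car (dsum M N) v)"
    using reps_finite[OF M v] reps_finite[OF N v] by (simp add: car_dsum)
  show "0 \<in> car (dsum M N) v"
    using reps_zero[OF M v] by (auto simp: car_dsum)
next
  fix \<alpha> y assume a: "\<alpha> \<in> arcs Q" "y \<in> car (dsum M N) (tail Q \<alpha>)"
  then have t: "tail Q \<alpha> \<in> verts Q" by simp
  from a(2) reps_zero[OF M t] show "act (dsum M N) \<alpha> y \<in> car (dsum M N) (head Q \<alpha>)"
  proof (cases rule: car_dsum_cases)
    case (1 x)
    then show ?thesis using act_closed[OF M a(1)] by (auto simp: car_dsum)
  next
    case (2 x)
    then show ?thesis
      unfolding 2(3) act_dsum_right[OF 2(2)] car_dsum using act_closed[OF N a(1) 2(1)] by blast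
  qed
next
  fix \<alpha> assume "\<alpha> \<in> arcs Q"
  then show "act (dsum M N) \<alpha> 0 = 0" using act_zero[OF M] by (simp add: act_dsum_zero)
next
  fix \<alpha> y z assume a: "\<alpha> \<in> arcs Q" "y \<in> car (dsum M N) (tail Q \<alpha>)" "z \<in> car (dsum M N) (tail Q \<alpha>)"
    "act (dsum M N) \<alpha> y = act (dsum M N) \<alpha> z" "act (dsum M N) \<alpha> z \<noteq> 0"
  then have t: "tail Q \<alpha> \<in> verts Q" by simp
  note z0 = reps_zero[OF M t]
  from a(2) z0 show "y = z"
  proof (cases rule: car_dsum_cases)
    case y: (1 x)
    from a(3) z0 show ?thesis
    proof (cases rule: car_dsum_cases)
      case (1 x')
      then show ?thesis using y a(4,5) act_inj[OF M a(1) y(1) 1(1)] by simp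
    next
      case (2 x')
      have "2 * act N \<alpha> x' - 1 \<noteq> 0"
        using a(5) unfolding 2(3) act_dsum_right[OF 2(2)] by simp
      then have "odd (act (dsum M N) \<alpha> z)"
        unfolding 2(3) act_dsum_right[OF 2(2)] by presburger
      moreover have "even (act (dsum M N) \<alpha> y)" using y by simp
      ultimately show ?thesis using a(4) by simp
    qed
  next
    case y: (2 x)
    from a(3) z0 show ?thesis
    proof (cases rule: car_dsum_cases)
      case (1 x')
      have "2 * act N \<alpha> x - 1 \<noteq> 0"
        using a(4,5) unfolding y(3) act_dsum_right[OF y(2)] by simp
      then have "odd (act (dsum M N) \<alpha> y)"
        unfolding y(3) act_dsum_right[OF y(2)] by presburger
      moreover have "even (act (dsum M N) \<alpha> z)" using 1 by simp
      ultimately show ?thesis using a(4) by simp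
    next
      case (2 x')
      have *: "2 * act N \<alpha> x - 1 = 2 * act N \<alpha> x' - 1" "2 * act N \<alpha> x' - 1 \<noteq> 0"
        using y 2 a(4,5) act_dsum_right[OF y(2), of M N \<alpha>] act_dsum_right[OF 2(2), of M N \<alpha>] by auto
      then have "act N \<alpha> x = act N \<alpha> x'" "act N \<alpha> x \<noteq> 0" by presburger+
      then show ?thesis using act_inj[OF N a(1) y(1) 2(1)] y 2 by blast
    qed
  qed
qed

text \<open>
  The recognition principle for internal direct sums, from which all isomorphisms between direct
  sums are obtained: \<open>a\<close> and \<open>b\<close> embed \<open>M\<close> and \<open>N\<close> in \<open>R\<close>, the images cover \<open>R\<close> and only meet in
  \<open>0\<close>.
\<close>

lemma dsum_isoI:
  assumes M: "M \<in> reps Q" and N: "N \<in> reps Q"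
    and zero: "\<And>v. v \<in> verts Q \<Longrightarrow> a v 0 = 0" "\<And>v. v \<in> verts Q \<Longrightarrow> b v 0 = 0"
    and inj: "\<And>v. v \<in> verts Q \<Longrightarrow> inj_on (a v) (car M v)"
      "\<And>v. v \<in> verts Q \<Longrightarrow> inj_on (b v) (car N v)"
    and surj: "\<And>v. v \<in> verts Q \<Longrightarrow> a v ` car M v \<union> b v ` car N v = car R v"
    and disj: "\<And>v x y. v \<in> verts Q \<Longrightarrow> x \<in> car M v \<Longrightarrow> y \<in> car N v \<Longrightarrow> a v x = b v y \<Longrightarrow> y = 0"
    and act: "\<And>\<alpha> x. \<alpha> \<in> arcs Q \<Longrightarrow> x \<in> car M (tail Q \<alpha>) \<Longrightarrow>
        a (head Q \<alpha>) (act M \<alpha> x) = act R \<alpha> (a (tail Q \<alpha>) x)"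
      "\<And>\<alpha> x. \<alpha> \<in> arcs Q \<Longrightarrow> x \<in> car N (tail Q \<alpha>) \<Longrightarrow>
        b (head Q \<alpha>) (act N \<alpha> x) = act R \<alpha> (b (tail Q \<alpha>) x)"
  shows "rep_iso Q (dsum M N) R"
proof -
  define h where "h v y = (if even y then a v (y div 2) else b v ((y + 1) div 2))" for v y :: _
  have ha: "h v (2 * x) = a v x" for v x by (simp add: h_def)
  have hb: "h v (2 * x - 1) = b v x" if "v \<in> verts Q" for v x
    using zero that by (cases "x = 0") (auto simp: h_def odd_double_minus_one half_double_minus_one)
  have "iso_via h (dsum M N) R"
    unfolding iso_via_def
  proof (intro conjI ballI)
    fix v assume v: "v \<in> verts Q"
    show "h v 0 = 0" using zero v by (simp add: h_def)
    have "h v ` car (dsum M N) v = a v ` car M v \<union> b v ` car N v"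
      by (simp add: car_dsum image_Un image_image ha hb[OF v, simplified])
    moreover have "inj_on (h v) (car (dsum M N) v)"
    proof (rule inj_onI)
      fix y z assume a: "y \<in> car (dsum M N) v" "z \<in> car (dsum M N) v" "h v y = h v z"
      note z0 = reps_zero[OF M v]
      from a(1) z0 show "y = z"
      proof (cases rule: car_dsum_cases)
        case y: (1 x)
        from a(2) z0 show ?thesis
        proof (cases rule: car_dsum_cases)
          case (1 x')
          then show ?thesis using y a(3) inj(1)[OF v] by (simp add: ha inj_on_def)
        next
          case (2 x')
          then have "a v x = b v x'" using y a(3) hb[OF v, of x'] by (simp add: ha)
          then show ?thesis using disj[OF v y(1) 2(1)] 2(2) by blast
        qed
      next
        case y: (2 x)
        from a(2) z0 show ?thesis
        proof (cases rule: car_dsum_cases)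
          case (1 x')
          then have "a v x' = b v x" using y a(3) hb[OF v, of x] by (simp add: ha)
          then show ?thesis using disj[OF v 1(1) y(1)] y(2) by blast
        next
          case (2 x')
          then have "b v x = b v x'" using y a(3) hb[OF v] by metis
          then have "x = x'" using y 2 inj(2)[OF v] by (simp add: inj_on_def)
          then show ?thesis using y 2 by simp
        qed
      qed
    qed
    ultimately show "bij_betw (h v) (car (dsum M N) v) (car R v)"
      using surj[OF v] by (simp add: bij_betw_def)
  next
    fix \<alpha> y assume al: "\<alpha> \<in> arcs Q" and y: "y \<in> car (dsum M N) (tail Q \<alpha>)"
    then have t: "tail Q \<alpha> \<in> verts Q" "head Q \<alpha> \<in> verts Q" by simp_all
    from y reps_zero[OF M t(1)]
    show "h (head Q \<alpha>) (act (dsum M N) \<alpha> y) = act R \<alpha> (h (tail Q \<alpha>) y)"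
    proof (cases rule: car_dsum_cases)
      case (1 x)
      then show ?thesis using act(1)[OF al 1(1)] by (simp add: ha)
    next
      case (2 x)
      show ?thesis
        unfolding 2(3) act_dsum_right[OF 2(2)] hb[OF t(1)] hb[OF t(2)] by (rule act(2)[OF al 2(1)])
    qed
  qed
  then show ?thesis using rep_iso_iff by blast
qed

lemma dsum_iso_cong:
  assumes reps: "M \<in> reps Q" "N \<in> reps Q" "M' \<in> reps Q" "N' \<in> reps Q"
    and "rep_iso Q M M'" "rep_iso Q N N'"
  shows "rep_iso Q (dsum M N) (dsum M' N')"
proof -
  obtain h where h: "iso_via h M M'" using assms(5) rep_iso_iff by blast
  obtain k where k: "iso_via k N N'" using assms(6) rep_iso_iff by blast
  show ?thesis
  proof (rule dsum_isoI[where a = "\<lambda>v x. 2 * h v x" and b = "\<lambda>v x. 2 * k v x - 1"])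
    fix v assume v: "v \<in> verts Q"
    show "2 * h v 0 = 0" "2 * k v 0 - 1 = 0"
      using iso_viaD(2)[OF h v] iso_viaD(2)[OF k v] by simp_all
    show "inj_on (\<lambda>x. 2 * h v x) (car M v)"
      using iso_viaD(3)[OF h v] by (simp add: inj_on_def)
    show "inj_on (\<lambda>x. 2 * k v x - 1) (car N v)"
    proof (rule inj_onI)
      fix x y assume xy: "x \<in> car N v" "y \<in> car N v" "2 * k v x - 1 = 2 * k v y - 1"
      then have "k v x = k v y" by presburger
      then show "x = y" using iso_viaD(3)[OF k v] xy by (simp add: inj_on_def)
    qed
    have "(\<lambda>x. 2 * h v x) ` car M v = (\<lambda>x. 2 * x) ` car M' v"
      "(\<lambda>x. 2 * k v x - 1) ` car N v = (\<lambda>x. 2 * x - 1) ` car N' v"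
      unfolding iso_viaD(4)[OF h v, symmetric] iso_viaD(4)[OF k v, symmetric] image_image
      by (rule refl)+
    then show "(\<lambda>x. 2 * h v x) ` car M v \<union> (\<lambda>x. 2 * k v x - 1) ` car N v = car (dsum M' N') v"
      by (simp add: car_dsum)
    fix x y assume "x \<in> car M v" "y \<in> car N v" "2 * h v x = 2 * k v y - 1"
    then have "k v y = 0" by presburger
    then show "y = 0" using iso_via_nonzero[OF k reps(2) v \<open>y \<in> car N v\<close>] by simp
  next
    fix \<alpha> x assume a: "\<alpha> \<in> arcs Q" "x \<in> car M (tail Q \<alpha>)"
    show "2 * h (head Q \<alpha>) (act M \<alpha> x) = act (dsum M' N') \<alpha> (2 * h (tail Q \<alpha>) x)"
      using iso_via_act[OF h a] by simp
  next
    fix \<alpha> x assume a: "\<alpha> \<in> arcs Q" "x \<in> car N (tail Q \<alpha>)"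
    then have t: "tail Q \<alpha> \<in> verts Q" "head Q \<alpha> \<in> verts Q" by simp_all
    show "2 * k (head Q \<alpha>) (act N \<alpha> x) - 1 = act (dsum M' N') \<alpha> (2 * k (tail Q \<alpha>) x - 1)"
    proof (cases "k (tail Q \<alpha>) x = 0")
      case True
      then have "x = 0" using iso_via_nonzero[OF k reps(2) t(1) a(2)] by simp
      then show ?thesis
        using True iso_viaD(2)[OF k t(2)] act_zero[OF reps(2) a(1)] act_zero[OF reps(3) a(1)]
        by (simp add: act_dsum_zero)
    next
      case False
      then show ?thesis using iso_via_act[OF k a] act_dsum_right[OF False] by simp
    qed
  qed fact+
qed

lemma dsum_assoc:
  assumes reps: "A \<in> reps Q" "B \<in> reps Q" "C \<in> reps Q"
  shows "rep_iso Q (dsum (dsum A B) C) (dsum A (dsum B C))"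
proof (rule dsum_isoI[where a = "\<lambda>v y. if even y then y else 2 * (y + 1) - 1"
      and b = "\<lambda>v x. 2 * (2 * x - 1) - 1"])
  show "dsum A B \<in> reps Q" "C \<in> reps Q" using reps dsum_reps by auto
  fix v assume v: "v \<in> verts Q"
  note z = reps_zero[OF reps(1) v] reps_zero[OF reps(2) v] reps_zero[OF reps(3) v]
  show "inj_on (\<lambda>y::nat. if even y then y else 2 * (y + 1) - 1) (car (dsum A B) v)"
  proof (rule inj_onI)
    fix x y :: nat
    assume "(if even x then x else 2 * (x + 1) - 1) = (if even y then y else 2 * (y + 1) - 1)"
    then show "x = y" by (cases "even x"; cases "even y"; simp; presburger)
  qed
  show "inj_on (\<lambda>x::nat. 2 * (2 * x - 1) - 1) (car C v)"
    by (rule inj_onI) presburger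
  have "(\<lambda>y. if even y then y else 2 * (y + 1) - 1) ` (\<lambda>x. 2 * x) ` car A v = (\<lambda>x. 2 * x) ` car A v"
    by (auto simp: image_image)
  moreover have "(\<lambda>y. if even y then y else 2 * (y + 1) - 1) (2 * x - 1) = 2 * (2 * x) - 1" for x :: nat
    by (cases "x = 0") auto
  then have "(\<lambda>y. if even y then y else 2 * (y + 1) - 1) ` (\<lambda>x. 2 * x - 1) ` car B v
      = (\<lambda>x. 2 * (2 * x) - 1) ` car B v"
    unfolding image_image by simp
  ultimately show "(\<lambda>y. if even y then y else 2 * (y + 1) - 1) ` car (dsum A B) v
      \<union> (\<lambda>x. 2 * (2 * x - 1) - 1) ` car C v = car (dsum A (dsum B C)) v"
    unfolding car_dsum image_Un by (simp add: image_image Un_assoc)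
  fix x y
  assume "x \<in> car (dsum A B) v" "y \<in> car C v"
    "(if even x then x else 2 * (x + 1) - 1) = 2 * (2 * y - 1) - 1"
  then have "(if even x then x else 2 * (x + 1) - 1) = 2 * (2 * y - 1) - 1" by simp
  then show "y = 0" by (cases "even x"; simp; presburger)
next
  fix \<alpha> y assume a: "\<alpha> \<in> arcs Q" "y \<in> car (dsum A B) (tail Q \<alpha>)"
  then have t: "tail Q \<alpha> \<in> verts Q" by simp
  from a(2) reps_zero[OF reps(1) t]
  show "(if even (act (dsum A B) \<alpha> y) then act (dsum A B) \<alpha> y else 2 * (act (dsum A B) \<alpha> y + 1) - 1)
    = act (dsum A (dsum B C)) \<alpha> (if even y then y else 2 * (y + 1) - 1)"
  proof (cases rule: car_dsum_cases)
    case (1 x)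
    then show ?thesis by simp
  next
    case (2 x)
    have "act (dsum A (dsum B C)) \<alpha> (2 * (2 * x) - 1) = 2 * (2 * act B \<alpha> x) - 1"
      using act_dsum_right[of "2 * x" A "dsum B C" \<alpha>] 2 by simp
    moreover have "(if even y then y else 2 * (y + 1) - 1) = 2 * (2 * x) - 1" using 2 by auto
    moreover have "act (dsum A B) \<alpha> y = 2 * act B \<alpha> x - 1" using 2 act_dsum_right[OF 2(2)] by simp
    ultimately show ?thesis by (cases "act B \<alpha> x = 0") auto
  qed
next
  fix \<alpha> x assume a: "\<alpha> \<in> arcs Q" "x \<in> car C (tail Q \<alpha>)"
  show "2 * (2 * act C \<alpha> x - 1) - 1 = act (dsum A (dsum B C)) \<alpha> (2 * (2 * x - 1) - 1)"
  proof (cases "x = 0")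
    case True
    then show ?thesis using act_zero[OF reps(3) a(1)] act_zero[OF reps(1) a(1)] by (simp add: act_dsum_zero)
  next
    case False
    then have nz: "2 * x - 1 \<noteq> 0" by presburger
    show ?thesis unfolding act_dsum_right[OF nz] act_dsum_right[OF False] by (rule refl)
  qed
qed auto

lemma dsum_zero_left:
  assumes "M \<in> reps Q"
  shows "rep_iso Q (dsum zero_rep M) M"
  by (rule dsum_isoI[where a = "\<lambda>_ x. x" and b = "\<lambda>_ x. x"])
    (use assms reps_zero[OF assms] act_zero[OF assms] zero_rep_in_reps in \<open>auto simp: zero_rep_def\<close>)

lemma dsum_zero_right:
  assumes "M \<in> reps Q"
  shows "rep_iso Q (dsum M zero_rep) M"
  by (rule dsum_isoI[where a = "\<lambda>_ x. x" and b = "\<lambda>_ x. x"])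
    (use assms reps_zero[OF assms] act_zero[OF assms] zero_rep_in_reps in \<open>auto simp: zero_rep_def\<close>)

lemma nilpotent_dsum:
  assumes M: "M \<in> reps Q" "nilpotent_rep Q M" and N: "N \<in> reps Q" "nilpotent_rep Q N"
  shows "nilpotent_rep Q (dsum M N)"
proof -
  obtain K where K: "\<forall>n\<ge>K. \<forall>u p v. awalk u p v \<and> length p = n \<longrightarrow> (\<forall>x\<in>car M u. fold (act M) p x = 0)"
    using M(2) unfolding nilpotent_rep_def by (elim exE)
  obtain K' where K': "\<forall>n\<ge>K'. \<forall>u p v. awalk u p v \<and> length p = n \<longrightarrow> (\<forall>x\<in>car N u. fold (act N) p x = 0)"
    using N(2) unfolding nilpotent_rep_def by (elim exE)
  have left: "fold (act (dsum M N)) p (2 * x) = 2 * fold (act M) p x" for p x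
    by (induction p arbitrary: x) simp_all
  have right: "fold (act (dsum M N)) p (2 * x - 1) = 2 * fold (act N) p x - 1"
    if "set p \<subseteq> arcs Q" for p x
    using that
  proof (induction p arbitrary: x)
    case (Cons e p)
    have "act (dsum M N) e (2 * x - 1) = 2 * act N e x - 1"
      using Cons.prems act_zero[OF M(1), of e] act_zero[OF N(1), of e] act_dsum_right[of x M N e]
      by (cases "x = 0") (simp_all add: act_dsum_zero)
    then show ?case using Cons.IH[of "act N e x"] Cons.prems by simp
  qed simp
  show ?thesis
    unfolding nilpotent_rep_def
  proof (intro exI[of _ "max K K'"] allI impI ballI, elim conjE)
    fix n u p v y
    assume a: "max K K' \<le> n" "y \<in> car (dsum M N) u" "awalk u p v" "length p = n"
    have u: "u \<in> verts Q" "set p \<subseteq> arcs Q" using a(3) by (auto simp: awalk_def)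
    from a(2) reps_zero[OF M(1) u(1)] show "fold (act (dsum M N)) p y = 0"
    proof (cases rule: car_dsum_cases)
      case (1 x)
      then show ?thesis using K[rule_format, of n u p v x] a left by simp
    next
      case (2 x)
      then show ?thesis using K'[rule_format, of n u p v x] a right[OF u(2), of x] by simp
    qed
  qed
qed

text \<open>
  No arrow joins the two summands. Hence a grading that is constant on each of them is nice, and
  once it takes different values on them, arrows of different summands are never compared again:
  the sequences of \<open>M\<close> and \<open>N\<close>, shifted by one step, can be used side by side.
\<close>

lemma nice_length_dsum:
  assumes M: "M \<in> reps Q" "nice_length Q M < \<infinity>" and N: "N \<in> reps Q" "nice_length Q N < \<infinity>"
  shows "nice_length Q (dsum M N) < \<infinity>"
proof -
  obtain m D where D: "\<And>i. rel_nice_grading Q M D i (D i)" and m: "separates M m D"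
    using M(2) unfolding nice_length_finite_iff by blast
  obtain n E where E: "\<And>i. rel_nice_grading Q N E i (E i)" and n: "separates N n E"
    using N(2) unfolding nice_length_finite_iff by blast
  define F where "F i = (case i of 0 \<Rightarrow> (\<lambda>(v :: 'v, y :: nat). if even y then 0 else 1)
    | Suc i \<Rightarrow> (\<lambda>(v, y). if even y then D i (v, y div 2) else E i (v, (y + 1) div 2)))" for i
  have F0: "F 0 (v, 2 * x) = 0" "x \<noteq> 0 \<Longrightarrow> F 0 (v, 2 * x - 1) = 1" for v x
    by (auto simp: F_def odd_double_minus_one)
  have FS: "F (Suc i) (v, 2 * x) = D i (v, x)" "x \<noteq> 0 \<Longrightarrow> F (Suc i) (v, 2 * x - 1) = E i (v, x)" for i v x
    by (auto simp: F_def odd_double_minus_one half_double_minus_one)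
  show ?thesis
    unfolding nice_length_finite_iff
  proof (intro exI[of _ "Suc (max m n)"] exI[of _ F] conjI allI)
    fix i
    show "rel_nice_grading Q (dsum M N) F i (F i)"
      unfolding rel_nice_grading_iff
    proof (intro ballI impI)
      fix \<alpha> y z
      assume al: "\<alpha> \<in> arcs Q" and y: "y \<in> car (dsum M N) (tail Q \<alpha>)"
        and z: "z \<in> car (dsum M N) (tail Q \<alpha>)" and nz: "y \<noteq> 0" "z \<noteq> 0"
        and ay: "act (dsum M N) \<alpha> y \<noteq> 0" and az: "act (dsum M N) \<alpha> z \<noteq> 0"
        and eq: "\<forall>j<i. F j (tail Q \<alpha>, y) = F j (tail Q \<alpha>, z) \<and>
          F j (head Q \<alpha>, act (dsum M N) \<alpha> y) = F j (head Q \<alpha>, act (dsum M N) \<alpha> z)"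
      have z0: "0 \<in> car M (tail Q \<alpha>)" using reps_zero[OF M(1)] al by simp
      show "F i (head Q \<alpha>, act (dsum M N) \<alpha> y) - F i (tail Q \<alpha>, y) =
        F i (head Q \<alpha>, act (dsum M N) \<alpha> z) - F i (tail Q \<alpha>, z)"
      proof (cases i)
        case 0
        have "F 0 (head Q \<alpha>, act (dsum M N) \<alpha> w) - F 0 (tail Q \<alpha>, w) = 0"
          if w: "w \<in> car (dsum M N) (tail Q \<alpha>)" "act (dsum M N) \<alpha> w \<noteq> 0" for w
          using w(1) z0
        proof (cases rule: car_dsum_cases)
          case (1 x)
          then show ?thesis by (simp add: F0)
        next
          case (2 x)
          have "act N \<alpha> x \<noteq> 0" using w(2) act_dsum_right[OF 2(2), of M N \<alpha>] 2 by (intro notI) simp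
          then show ?thesis
            unfolding 2(3) act_dsum_right[OF 2(2)] F0(2)[OF 2(2)] F0(2)[OF \<open>act N \<alpha> x \<noteq> 0\<close>] by simp
        qed
        then show ?thesis using 0 y z ay az by simp
      next
        case (Suc k)
        have eq0: "F 0 (tail Q \<alpha>, y) = F 0 (tail Q \<alpha>, z)"
          and eqS: "\<And>j. j < k \<Longrightarrow> F (Suc j) (tail Q \<alpha>, y) = F (Suc j) (tail Q \<alpha>, z) \<and>
            F (Suc j) (head Q \<alpha>, act (dsum M N) \<alpha> y) = F (Suc j) (head Q \<alpha>, act (dsum M N) \<alpha> z)"
          using eq Suc by auto
        from y z0 show ?thesis
        proof (cases rule: car_dsum_cases)
          case y: (1 x)
          from z z0 show ?thesis
          proof (cases rule: car_dsum_cases)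
            case z: (1 x')
            have "D k (head Q \<alpha>, act M \<alpha> x) - D k (tail Q \<alpha>, x)
                = D k (head Q \<alpha>, act M \<alpha> x') - D k (tail Q \<alpha>, x')"
              using D[of k, unfolded rel_nice_grading_iff, rule_format, OF al y(1) z(1)]
                nz ay az eqS y z by (simp add: FS)
            then show ?thesis using y z Suc by (simp add: FS)
          next
            case (2 x')
            then show ?thesis using eq0 y F0(1)[of "tail Q \<alpha>" x] F0(2)[OF 2(2), of "tail Q \<alpha>"] by simp
          qed
        next
          case y: (2 x)
          from z z0 show ?thesis
          proof (cases rule: car_dsum_cases)
            case (1 x')
            then show ?thesis using eq0 y F0(1)[of "tail Q \<alpha>" x'] F0(2)[OF y(2), of "tail Q \<alpha>"] by simp
          next
            case z: (2 x')
            have A: "act (dsum M N) \<alpha> y = 2 * act N \<alpha> x - 1" "act (dsum M N) \<alpha> z = 2 * act N \<alpha> x' - 1"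
              using y z act_dsum_right by simp_all
            then have B: "act N \<alpha> x \<noteq> 0" "act N \<alpha> x' \<noteq> 0" using ay az by (auto intro!: notI)
            note FE = FS(2)[OF y(2)] FS(2)[OF z(2)] FS(2)[OF B(1)] FS(2)[OF B(2)]
            have "E k (head Q \<alpha>, act N \<alpha> x) - E k (tail Q \<alpha>, x)
                = E k (head Q \<alpha>, act N \<alpha> x') - E k (tail Q \<alpha>, x')"
              using E[of k, unfolded rel_nice_grading_iff, rule_format, OF al y(1) z(1) y(2) z(2) B]
                eqS[unfolded y(3) z(3) act_dsum_right[OF y(2)] act_dsum_right[OF z(2)] FE] by blast
            then show ?thesis
              unfolding Suc y(3) z(3) act_dsum_right[OF y(2)] act_dsum_right[OF z(2)] FE .
          qed
        qed
      qed
    qed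
  next
    show "separates (dsum M N) (Suc (max m n)) F"
      unfolding separates_def
    proof (intro ballI impI)
      fix v w y z
      assume v: "v \<in> verts Q" and w: "w \<in> verts Q" and y: "y \<in> car (dsum M N) v"
        and z: "z \<in> car (dsum M N) w" and nz: "y \<noteq> 0" "z \<noteq> 0" and ne: "(v, y) \<noteq> (w, z)"
      from y reps_zero[OF M(1) v] show "\<exists>i\<le>Suc (max m n). F i (v, y) \<noteq> F i (w, z)"
      proof (cases rule: car_dsum_cases)
        case y: (1 x)
        from z reps_zero[OF M(1) w] show ?thesis
        proof (cases rule: car_dsum_cases)
          case z: (1 x')
          obtain i where "i \<le> m" "D i (v, x) \<noteq> D i (w, x')"
            using m[unfolded separates_def, rule_format, OF v w y(1) z(1)] nz ne y z by auto
          then have "F (Suc i) (v, y) \<noteq> F (Suc i) (w, z)" "Suc i \<le> Suc (max m n)"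
            using y z by (simp_all add: FS)
          then show ?thesis by blast
        next
          case (2 x')
          then have "F 0 (v, y) \<noteq> F 0 (w, z)" using y F0(1) F0(2)[OF 2(2)] by simp
          then show ?thesis by blast
        qed
      next
        case y: (2 x)
        from z reps_zero[OF M(1) w] show ?thesis
        proof (cases rule: car_dsum_cases)
          case (1 x')
          then have "F 0 (v, y) \<noteq> F 0 (w, z)" using y F0(1) F0(2)[OF y(2)] by simp
          then show ?thesis by blast
        next
          case z: (2 x')
          have "(v, x) \<noteq> (w, x')" using ne y z by blast
          then obtain i where "i \<le> n" "E i (v, x) \<noteq> E i (w, x')"
            using n[unfolded separates_def, rule_format, OF v w y(1) z(1) y(2) z(2)] by blast
          then have "F (Suc i) (v, y) \<noteq> F (Suc i) (w, z)" "Suc i \<le> Suc (max m n)"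
            unfolding y(3) z(3) FS(2)[OF y(2)] FS(2)[OF z(2)] by simp_all
          then show ?thesis by blast
        qed
      qed
    qed
  qed
qed


section \<open>The lattice of subrepresentations and its flags\<close>

definition sub_le :: "('v \<Rightarrow> nat set) \<Rightarrow> ('v \<Rightarrow> nat set) \<Rightarrow> bool" where
  "sub_le K L \<longleftrightarrow> (\<forall>v\<in>verts Q. K v \<subseteq> L v)"

definition bot_sub :: "'v \<Rightarrow> nat set" where
  "bot_sub = (\<lambda>v\<in>verts Q. {0})"

definition top_sub :: "('v, 'a) rep \<Rightarrow> 'v \<Rightarrow> nat set" where
  "top_sub R = (\<lambda>v\<in>verts Q. car R v)"

definition sub_chains :: "('v, 'a) rep \<Rightarrow> ('v \<Rightarrow> nat set) set set" where
  "sub_chains R = {F \<in> Pow (subreps Q R). \<forall>K\<in>F. \<forall>L\<in>F. sub_le K L \<or> sub_le L K}"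

text \<open>A flag with \<open>k\<close> steps has \<open>k + 1\<close> members, as both ends belong to it.\<close>

definition flags :: "('v, 'a) rep \<Rightarrow> ('v \<Rightarrow> nat set) set set" where
  "flags R = {F \<in> sub_chains R. bot_sub \<in> F \<and> top_sub R \<in> F}"

text \<open>
  The associated graded representation has the elements of \<open>R\<close>, since nothing is lost when pointed
  sets are divided into steps. An arrow survives iff it stays within one step, that is, iff it
  enters no member of \<open>F\<close> from outside.
\<close>

definition gr_rep :: "('v, 'a) rep \<Rightarrow> ('v \<Rightarrow> nat set) set \<Rightarrow> ('v, 'a) rep" where
  "gr_rep R F = \<lparr>car = car R,
     act = (\<lambda>\<alpha> x. if \<forall>L\<in>F. act R \<alpha> x \<in> L (head Q \<alpha>) \<longrightarrow> x \<in> L (tail Q \<alpha>) then act R \<alpha> x else 0)\<rparr>"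

lemma gr_rep_simps [simp]:
  "car (gr_rep R F) = car R"
  "act (gr_rep R F) \<alpha> x =
    (if \<forall>L\<in>F. act R \<alpha> x \<in> L (head Q \<alpha>) \<longrightarrow> x \<in> L (tail Q \<alpha>) then act R \<alpha> x else 0)"
  by (simp_all add: gr_rep_def)

lemma sub_le_refl: "sub_le L L"
  by (simp add: sub_le_def)

lemma sub_le_antisym: "K \<in> subreps Q R \<Longrightarrow> L \<in> subreps Q R' \<Longrightarrow> sub_le K L \<Longrightarrow> sub_le L K \<Longrightarrow> K = L"
  by (rule subreps_eqI) (auto simp: sub_le_def)

lemma bot_sub_subreps: "R \<in> reps Q \<Longrightarrow> bot_sub \<in> subreps Q R"
  by (rule subrepsI) (auto simp: bot_sub_def reps_zero act_zero)

lemma top_sub_subreps: "R \<in> reps Q \<Longrightarrow> top_sub R \<in> subreps Q R"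
  by (rule subrepsI) (auto simp: top_sub_def reps_zero act_closed)

lemma bot_sub_le: "L \<in> subreps Q R \<Longrightarrow> sub_le bot_sub L"
  by (auto simp: sub_le_def bot_sub_def dest: subrepsD(2))

lemma le_top_sub: "L \<in> subreps Q R \<Longrightarrow> sub_le L (top_sub R)"
  using subrepsD(1) by (auto simp: sub_le_def top_sub_def)

lemma finite_sub_chains: "R \<in> reps Q \<Longrightarrow> finite (sub_chains R)"
  unfolding sub_chains_def using finite_subreps by simp

lemma sub_chains_finite: "R \<in> reps Q \<Longrightarrow> F \<in> sub_chains R \<Longrightarrow> finite F"
  unfolding sub_chains_def using finite_subreps finite_subset by blast

lemma gr_rep_reps:
  assumes R: "R \<in> reps Q"
  shows "gr_rep R F \<in> reps Q"
proof (rule repsI)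
  fix \<alpha> x y assume a: "\<alpha> \<in> arcs Q" "x \<in> car (gr_rep R F) (tail Q \<alpha>)" "y \<in> car (gr_rep R F) (tail Q \<alpha>)"
    "act (gr_rep R F) \<alpha> x = act (gr_rep R F) \<alpha> y" "act (gr_rep R F) \<alpha> y \<noteq> 0"
  then have "act R \<alpha> x = act R \<alpha> y" "act R \<alpha> x \<noteq> 0" by (simp_all split: if_splits)
  then show "x = y" using act_inj[OF R a(1), of x y] a(2,3) by simp
qed (use reps_finite[OF R] reps_zero[OF R] act_closed[OF R] act_zero[OF R] in auto)

lemma gr_rep_emb: "rep_emb (gr_rep R F) R"
  by (rule rep_emb_idI) (auto split: if_splits)


subsection \<open>Transport along isomorphisms\<close>

definition push_sub :: "('v \<Rightarrow> nat \<Rightarrow> nat) \<Rightarrow> ('v \<Rightarrow> nat set) \<Rightarrow> 'v \<Rightarrow> nat set" where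
  "push_sub h L = (\<lambda>v\<in>verts Q. h v ` L v)"

lemma push_sub_subreps:
  assumes h: "iso_via h M N" and L: "L \<in> subreps Q M"
  shows "push_sub h L \<in> subreps Q N"
proof (rule subrepsI)
  fix v assume v: "v \<in> verts Q"
  show "push_sub h L v \<subseteq> car N v"
    using iso_viaD(5)[OF h v] subrepsD(1)[OF L v] v by (auto simp: push_sub_def)
  have "h v 0 \<in> h v ` L v" using subrepsD(2)[OF L v] by (rule imageI)
  then show "0 \<in> push_sub h L v" using iso_viaD(2)[OF h v] v by (simp add: push_sub_def)
next
  fix \<alpha> y assume a: "\<alpha> \<in> arcs Q" "y \<in> push_sub h L (tail Q \<alpha>)"
  then have t: "tail Q \<alpha> \<in> verts Q" "head Q \<alpha> \<in> verts Q" by simp_all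
  obtain x where x: "x \<in> L (tail Q \<alpha>)" "y = h (tail Q \<alpha>) x"
    using a(2) t by (auto simp: push_sub_def)
  have "x \<in> car M (tail Q \<alpha>)" using subrepsD(1)[OF L t(1)] x by blast
  then have "act N \<alpha> y = h (head Q \<alpha>) (act M \<alpha> x)" using iso_via_act[OF h a(1)] x by simp
  then show "act N \<alpha> y \<in> push_sub h L (head Q \<alpha>)"
    using subrepsD(3)[OF L a(1) x(1)] t by (simp add: push_sub_def)
qed (simp add: push_sub_def)

lemma push_sub_mem:
  assumes h: "iso_via h M N" and L: "L \<in> subreps Q M" and v: "v \<in> verts Q" and x: "x \<in> car M v"
  shows "h v x \<in> push_sub h L v \<longleftrightarrow> x \<in> L v"
  using iso_viaD(3)[OF h v] subrepsD(1)[OF L v] x v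
  by (simp add: push_sub_def inj_on_image_mem_iff)

lemma bij_push_sub:
  assumes h: "iso_via h M N" and M: "M \<in> reps Q"
  shows "bij_betw (push_sub h) (subreps Q M) (subreps Q N)"
proof -
  let ?g = "\<lambda>v. inv_into (car M v) (h v)"
  have g: "iso_via ?g N M" by (rule iso_via_inv[OF M h])
  show ?thesis
  proof (rule bij_betw_byWitness[where f' = "push_sub ?g"])
    show "\<forall>L\<in>subreps Q M. push_sub ?g (push_sub h L) = L"
    proof
      fix L assume L: "L \<in> subreps Q M"
      show "push_sub ?g (push_sub h L) = L"
      proof (rule subreps_eqI[OF push_sub_subreps[OF g push_sub_subreps[OF h L]] L])
        fix v assume v: "v \<in> verts Q"
        show "push_sub ?g (push_sub h L) v = L v"
          using inv_into_image_cancel[OF iso_viaD(3)[OF h v] subrepsD(1)[OF L v]] v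
          by (simp add: push_sub_def)
      qed
    qed
    show "\<forall>L\<in>subreps Q N. push_sub h (push_sub ?g L) = L"
    proof
      fix L assume L: "L \<in> subreps Q N"
      show "push_sub h (push_sub ?g L) = L"
      proof (rule subreps_eqI[OF push_sub_subreps[OF h push_sub_subreps[OF g L]] L])
        fix v assume v: "v \<in> verts Q"
        show "push_sub h (push_sub ?g L) v = L v"
          using image_inv_into_cancel[OF iso_viaD(4)[OF h v] subrepsD(1)[OF L v]] v
          by (simp add: push_sub_def)
      qed
    qed
  qed (use push_sub_subreps[OF h] push_sub_subreps[OF g] in auto)
qed

lemma push_sub_le:
  assumes h: "iso_via h M N" and K: "K \<in> subreps Q M" and L: "L \<in> subreps Q M"
  shows "sub_le (push_sub h K) (push_sub h L) \<longleftrightarrow> sub_le K L"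
  unfolding sub_le_def
proof (rule ball_cong[OF refl])
  fix v assume v: "v \<in> verts Q"
  have "h v x \<in> push_sub h L v \<longleftrightarrow> x \<in> L v" if "x \<in> K v" for x
    using push_sub_mem[OF h L v] subrepsD(1)[OF K v] that by blast
  then show "(push_sub h K v \<subseteq> push_sub h L v) = (K v \<subseteq> L v)"
    unfolding push_sub_def[of h K] using v by auto
qed

lemma push_sub_bot_top:
  assumes "iso_via h M N"
  shows "push_sub h bot_sub = bot_sub" "push_sub h (top_sub M) = top_sub N"
  using iso_viaD(2,4)[OF assms] by (simp_all add: push_sub_def bot_sub_def top_sub_def fun_eq_iff)

lemma sub_rep_iso:
  assumes h: "iso_via h M N" and L: "L \<in> subreps Q M"
  shows "rep_iso Q (sub_rep M L) (sub_rep N (push_sub h L))"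
proof -
  have "iso_via h (sub_rep M L) (sub_rep N (push_sub h L))"
    unfolding iso_via_def
  proof (intro conjI ballI)
    fix v assume v: "v \<in> verts Q"
    show "bij_betw (h v) (car (sub_rep M L) v) (car (sub_rep N (push_sub h L)) v)"
      using inj_on_subset[OF iso_viaD(3)[OF h v] subrepsD(1)[OF L v]] v
      by (simp add: bij_betw_def push_sub_def)
    show "h v 0 = 0" by (rule iso_viaD(2)[OF h v])
  next
    fix \<alpha> x assume a: "\<alpha> \<in> arcs Q" "x \<in> car (sub_rep M L) (tail Q \<alpha>)"
    then have "x \<in> car M (tail Q \<alpha>)" using subrepsD(1)[OF L, of "tail Q \<alpha>"] by auto
    then show "h (head Q \<alpha>) (act (sub_rep M L) \<alpha> x) = act (sub_rep N (push_sub h L)) \<alpha> (h (tail Q \<alpha>) x)"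
      using iso_via_act[OF h a(1)] by simp
  qed
  then show ?thesis using rep_iso_iff by blast
qed

lemma quot_rep_iso:
  assumes h: "iso_via h M N" and M: "M \<in> reps Q" and L: "L \<in> subreps Q M"
  shows "rep_iso Q (quot_rep Q M L) (quot_rep Q N (push_sub h L))"
proof -
  have "iso_via h (quot_rep Q M L) (quot_rep Q N (push_sub h L))"
    unfolding iso_via_def
  proof (intro conjI ballI)
    fix v assume v: "v \<in> verts Q"
    have sub: "car (quot_rep Q M L) v \<subseteq> car M v" using reps_zero[OF M v] by auto
    have "h v ` car (quot_rep Q M L) v = insert (h v 0) (h v ` car M v - h v ` L v)"
      using inj_on_image_set_diff[OF iso_viaD(3)[OF h v], of "car M v" "L v"] subrepsD(1)[OF L v]
      by auto
    then have "h v ` car (quot_rep Q M L) v = car (quot_rep Q N (push_sub h L)) v"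
      using iso_viaD(2,4)[OF h v] v by (simp add: push_sub_def)
    then show "bij_betw (h v) (car (quot_rep Q M L) v) (car (quot_rep Q N (push_sub h L)) v)"
      using inj_on_subset[OF iso_viaD(3)[OF h v] sub] unfolding bij_betw_def by blast
    show "h v 0 = 0" by (rule iso_viaD(2)[OF h v])
  next
    fix \<alpha> x assume a: "\<alpha> \<in> arcs Q" "x \<in> car (quot_rep Q M L) (tail Q \<alpha>)"
    then have t: "tail Q \<alpha> \<in> verts Q" "head Q \<alpha> \<in> verts Q" by simp_all
    have x: "x \<in> car M (tail Q \<alpha>)" using a(2) reps_zero[OF M t(1)] by auto
    show "h (head Q \<alpha>) (act (quot_rep Q M L) \<alpha> x) = act (quot_rep Q N (push_sub h L)) \<alpha> (h (tail Q \<alpha>) x)"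
      using push_sub_mem[OF h L t(2) act_closed[OF M a(1) x]] iso_via_act[OF h a(1) x]
        iso_viaD(2)[OF h t(2)] by simp
  qed
  then show ?thesis using rep_iso_iff by blast
qed

lemma gr_rep_iso:
  assumes h: "iso_via h M N" and M: "M \<in> reps Q" and F: "F \<subseteq> subreps Q M"
  shows "rep_iso Q (gr_rep M F) (gr_rep N (push_sub h ` F))"
proof -
  have "iso_via h (gr_rep M F) (gr_rep N (push_sub h ` F))"
    unfolding iso_via_def
  proof (intro conjI ballI)
    fix v assume v: "v \<in> verts Q"
    show "bij_betw (h v) (car (gr_rep M F) v) (car (gr_rep N (push_sub h ` F)) v)" "h v 0 = 0"
      using iso_viaD(1,2)[OF h v] by simp_all
  next
    fix \<alpha> x assume a: "\<alpha> \<in> arcs Q" "x \<in> car (gr_rep M F) (tail Q \<alpha>)"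
    then have t: "tail Q \<alpha> \<in> verts Q" "head Q \<alpha> \<in> verts Q" by simp_all
    have x: "x \<in> car M (tail Q \<alpha>)" using a(2) by simp
    have "act N \<alpha> (h (tail Q \<alpha>) x) \<in> push_sub h L (head Q \<alpha>) \<longleftrightarrow> act M \<alpha> x \<in> L (head Q \<alpha>)"
      "h (tail Q \<alpha>) x \<in> push_sub h L (tail Q \<alpha>) \<longleftrightarrow> x \<in> L (tail Q \<alpha>)" if "L \<in> F" for L
      using push_sub_mem[OF h _ t(2) act_closed[OF M a(1) x]] push_sub_mem[OF h _ t(1) x] that F
        iso_via_act[OF h a(1) x] by auto
    then have cond: "(\<forall>L\<in>push_sub h ` F. act N \<alpha> (h (tail Q \<alpha>) x) \<in> L (head Q \<alpha>) \<longrightarrow> h (tail Q \<alpha>) x \<in> L (tail Q \<alpha>))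
      \<longleftrightarrow> (\<forall>L\<in>F. act M \<alpha> x \<in> L (head Q \<alpha>) \<longrightarrow> x \<in> L (tail Q \<alpha>))"
      by auto
    show "h (head Q \<alpha>) (act (gr_rep M F) \<alpha> x) = act (gr_rep N (push_sub h ` F)) \<alpha> (h (tail Q \<alpha>) x)"
      unfolding gr_rep_simps cond using iso_via_act[OF h a(1) x] iso_viaD(2)[OF h t(2)] by auto
  qed
  then show ?thesis using rep_iso_iff by blast
qed

text \<open>This transfers bijections of subrepresentations to flags.\<close>

lemma bij_image_chains:
  assumes \<phi>: "bij_betw \<phi> A B"
    and le: "\<And>K L. K \<in> A \<Longrightarrow> L \<in> A \<Longrightarrow> s (\<phi> K) (\<phi> L) \<longleftrightarrow> r K L"
  shows "bij_betw ((`) \<phi>) {F \<in> Pow A. \<forall>K\<in>F. \<forall>L\<in>F. r K L \<or> r L K}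
    {F \<in> Pow B. \<forall>K\<in>F. \<forall>L\<in>F. s K L \<or> s L K}"
proof (rule bij_betw_Collect[OF bij_betw_Pow[OF \<phi>]])
  fix F assume "F \<in> Pow A"
  then have "s (\<phi> K) (\<phi> L) \<longleftrightarrow> r K L" if "K \<in> F" "L \<in> F" for K L
    using that le by blast
  then show "(\<forall>K\<in>\<phi> ` F. \<forall>L\<in>\<phi> ` F. s K L \<or> s L K) \<longleftrightarrow> (\<forall>K\<in>F. \<forall>L\<in>F. r K L \<or> r L K)"
    by simp
qed

lemma bij_push_flags:
  assumes h: "iso_via h M N" and M: "M \<in> reps Q"
  shows "bij_betw ((`) (push_sub h)) (flags M) (flags N)"
  unfolding flags_def
proof (rule bij_betw_Collect)
  note bij = bij_push_sub[OF h M]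
  show "bij_betw ((`) (push_sub h)) (sub_chains M) (sub_chains N)"
    unfolding sub_chains_def by (rule bij_image_chains[OF bij]) (rule push_sub_le[OF h])
  fix F assume "F \<in> sub_chains M"
  then have F: "F \<subseteq> subreps Q M" by (simp add: sub_chains_def)
  have inj: "inj_on (push_sub h) (subreps Q M)" using bij by (simp add: bij_betw_def)
  have "push_sub h bot_sub \<in> push_sub h ` F \<longleftrightarrow> bot_sub \<in> F"
    "push_sub h (top_sub M) \<in> push_sub h ` F \<longleftrightarrow> top_sub M \<in> F"
    using inj_on_image_mem_iff[OF inj _ F] bot_sub_subreps[OF M] top_sub_subreps[OF M] by blast+
  then show "(bot_sub \<in> push_sub h ` F \<and> top_sub N \<in> push_sub h ` F) = (bot_sub \<in> F \<and> top_sub M \<in> F)"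
    using push_sub_bot_top[OF h] by simp
qed


subsection \<open>Subrepresentations of subrepresentations, quotients and direct sums\<close>

lemma subreps_sub_rep:
  assumes "R \<in> reps Q" "L \<in> subreps Q R"
  shows "subreps Q (sub_rep R L) = {K \<in> subreps Q R. sub_le K L}"
proof (intro equalityI subsetI)
  fix K assume K: "K \<in> subreps Q (sub_rep R L)"
  then have le: "sub_le K L" using subrepsD(1)[OF K] by (simp add: sub_le_def)
  have "K \<in> subreps Q R"
  proof (rule subrepsI)
    fix v assume v: "v \<in> verts Q"
    show "K v \<subseteq> car R v" "0 \<in> K v"
      using le subrepsD(1)[OF assms(2) v] subrepsD(2)[OF K v] v by (auto simp: sub_le_def)
  qed (use subrepsD(3,4)[OF K] in auto)
  then show "K \<in> {K \<in> subreps Q R. sub_le K L}" using le by simp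
next
  fix K assume "K \<in> {K \<in> subreps Q R. sub_le K L}"
  then have K: "K \<in> subreps Q R" "sub_le K L" by auto
  show "K \<in> subreps Q (sub_rep R L)"
    by (rule subrepsI) (use subrepsD(2-)[OF K(1)] K(2) in \<open>auto simp: sub_le_def\<close>)
qed

definition lift_sub :: "('v \<Rightarrow> nat set) \<Rightarrow> ('v \<Rightarrow> nat set) \<Rightarrow> 'v \<Rightarrow> nat set" where
  "lift_sub L K = (\<lambda>v\<in>verts Q. K v \<union> L v)"

lemma lift_sub_subreps:
  assumes R: "R \<in> reps Q" and L: "L \<in> subreps Q R" and K: "K \<in> subreps Q (quot_rep Q R L)"
  shows "lift_sub L K \<in> subreps Q R" "sub_le L (lift_sub L K)"
proof -
  show "lift_sub L K \<in> subreps Q R"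
  proof (rule subrepsI)
    fix v assume v: "v \<in> verts Q"
    show "lift_sub L K v \<subseteq> car R v" "0 \<in> lift_sub L K v"
      using subrepsD(1,2)[OF L v] subrepsD(1,2)[OF K v] reps_zero[OF R v] v
      by (auto simp: lift_sub_def)
  next
    fix \<alpha> x assume a: "\<alpha> \<in> arcs Q" "x \<in> lift_sub L K (tail Q \<alpha>)"
    then consider "x \<in> L (tail Q \<alpha>)" | "x \<in> K (tail Q \<alpha>)" by (auto simp: lift_sub_def)
    then have "act R \<alpha> x \<in> K (head Q \<alpha>) \<union> L (head Q \<alpha>)"
    proof cases
      case 1
      then show ?thesis using subrepsD(3)[OF L a(1)] by blast
    next
      case 2
      then show ?thesis using subrepsD(3)[OF K a(1) 2] by (simp split: if_splits)
    qed
    then show "act R \<alpha> x \<in> lift_sub L K (head Q \<alpha>)" using a by (simp add: lift_sub_def)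
  qed (simp add: lift_sub_def)
  show "sub_le L (lift_sub L K)" by (simp add: sub_le_def lift_sub_def)
qed

text \<open>The correspondence theorem: adding \<open>L\<close> is inverse to deleting the nonzero elements of \<open>L\<close>.\<close>

lemma bij_lift_sub:
  assumes R: "R \<in> reps Q" and L: "L \<in> subreps Q R"
  shows "bij_betw (lift_sub L) (subreps Q (quot_rep Q R L)) {K \<in> subreps Q R. sub_le L K}"
proof (rule bij_betw_byWitness[where f' = "\<lambda>K. \<lambda>v\<in>verts Q. insert 0 (K v - L v)"])
  show "\<forall>K\<in>subreps Q (quot_rep Q R L). (\<lambda>v\<in>verts Q. insert 0 (lift_sub L K v - L v)) = K"
  proof
    fix K assume K: "K \<in> subreps Q (quot_rep Q R L)"
    have "insert 0 (lift_sub L K v - L v) = K v" if "v \<in> verts Q" for v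
      using subrepsD(1,2)[OF K that] subrepsD(2)[OF L that] that by (auto simp: lift_sub_def)
    then show "(\<lambda>v\<in>verts Q. insert 0 (lift_sub L K v - L v)) = K"
      using subrepsD(4)[OF K] by (simp add: fun_eq_iff)
  qed
  show "\<forall>K\<in>{K \<in> subreps Q R. sub_le L K}. lift_sub L (\<lambda>v\<in>verts Q. insert 0 (K v - L v)) = K"
  proof
    fix K assume "K \<in> {K \<in> subreps Q R. sub_le L K}"
    then have K: "K \<in> subreps Q R" "sub_le L K" by auto
    show "lift_sub L (\<lambda>v\<in>verts Q. insert 0 (K v - L v)) = K"
    proof (rule ext)
      fix v
      show "lift_sub L (\<lambda>v\<in>verts Q. insert 0 (K v - L v)) v = K v"
        using K(2) subrepsD(2,4)[OF K(1), of v]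
        by (cases "v \<in> verts Q") (auto simp: lift_sub_def sub_le_def)
    qed
  qed
  show "lift_sub L ` subreps Q (quot_rep Q R L) \<subseteq> {K \<in> subreps Q R. sub_le L K}"
    using lift_sub_subreps[OF R L] by auto
  show "(\<lambda>K. \<lambda>v\<in>verts Q. insert 0 (K v - L v)) ` {K \<in> subreps Q R. sub_le L K}
    \<subseteq> subreps Q (quot_rep Q R L)"
  proof (rule image_subsetI)
    fix K assume "K \<in> {K \<in> subreps Q R. sub_le L K}"
    then have K: "K \<in> subreps Q R" by auto
    show "(\<lambda>v\<in>verts Q. insert 0 (K v - L v)) \<in> subreps Q (quot_rep Q R L)"
    proof (rule subrepsI)
      fix v assume v: "v \<in> verts Q"
      show "(\<lambda>v\<in>verts Q. insert 0 (K v - L v)) v \<subseteq> car (quot_rep Q R L) v"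
        using subrepsD(1)[OF K v] v by auto
    next
      fix \<alpha> x assume a: "\<alpha> \<in> arcs Q" "x \<in> (\<lambda>v\<in>verts Q. insert 0 (K v - L v)) (tail Q \<alpha>)"
      have "x \<in> K (tail Q \<alpha>)" using a subrepsD(2)[OF K, of "tail Q \<alpha>"] by auto
      then show "act (quot_rep Q R L) \<alpha> x \<in> (\<lambda>v\<in>verts Q. insert 0 (K v - L v)) (head Q \<alpha>)"
        using subrepsD(3)[OF K a(1)] a(1) by simp
    qed simp_all
  qed
qed

lemma lift_sub_le:
  assumes L: "L \<in> subreps Q R"
    and K: "K \<in> subreps Q (quot_rep Q R L)" and K': "K' \<in> subreps Q (quot_rep Q R L)"
  shows "sub_le (lift_sub L K) (lift_sub L K') \<longleftrightarrow> sub_le K K'"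
  unfolding sub_le_def
proof (rule ball_cong[OF refl])
  fix v assume v: "v \<in> verts Q"
  show "(lift_sub L K v \<subseteq> lift_sub L K' v) = (K v \<subseteq> K' v)"
    using subrepsD(1)[OF K v] subrepsD(2)[OF K' v] v by (auto simp: lift_sub_def)
qed

lemma lift_sub_bot_top:
  assumes R: "R \<in> reps Q" and L: "L \<in> subreps Q R"
  shows "lift_sub L bot_sub = L" "lift_sub L (top_sub (quot_rep Q R L)) = top_sub R"
proof -
  show "lift_sub L bot_sub = L"
  proof (rule ext)
    fix v
    show "lift_sub L bot_sub v = L v"
      using subrepsD(2,4)[OF L, of v] by (cases "v \<in> verts Q") (auto simp: lift_sub_def bot_sub_def)
  qed
  show "lift_sub L (top_sub (quot_rep Q R L)) = top_sub R"
  proof (rule ext)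
    fix v
    show "lift_sub L (top_sub (quot_rep Q R L)) v = top_sub R v"
      using subrepsD(1,2)[OF L, of v] reps_zero[OF R, of v]
      by (cases "v \<in> verts Q") (auto simp: lift_sub_def top_sub_def)
  qed
qed

lemma quot_quot_iso:
  assumes L: "L \<in> subreps Q R" and K: "K \<in> subreps Q (quot_rep Q R L)"
  shows "rep_iso Q (quot_rep Q (quot_rep Q R L) K) (quot_rep Q R (lift_sub L K))"
proof (rule rep_iso_idI)
  fix v assume v: "v \<in> verts Q"
  show "car (quot_rep Q (quot_rep Q R L) K) v = car (quot_rep Q R (lift_sub L K)) v"
    using v by (auto simp: lift_sub_def)
next
  fix \<alpha> x assume a: "\<alpha> \<in> arcs Q"
  have "0 \<in> K (head Q \<alpha>)" using subrepsD(2)[OF K] a by simp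
  then show "act (quot_rep Q (quot_rep Q R L) K) \<alpha> x = act (quot_rep Q R (lift_sub L K)) \<alpha> x"
    using a by (simp add: lift_sub_def)
qed

lemma sub_quot_iso:
  assumes L: "L \<in> subreps Q R" and K: "K \<in> subreps Q (quot_rep Q R L)"
  shows "rep_iso Q (sub_rep (quot_rep Q R L) K) (quot_rep Q (sub_rep R (lift_sub L K)) L)"
proof (rule rep_iso_idI)
  fix v assume v: "v \<in> verts Q"
  show "car (sub_rep (quot_rep Q R L) K) v = car (quot_rep Q (sub_rep R (lift_sub L K)) L) v"
    using v subrepsD(1,2)[OF K v] subrepsD(2)[OF L v] by (auto simp: lift_sub_def)
qed simp

definition pair_sub :: "('v \<Rightarrow> nat set) \<Rightarrow> ('v \<Rightarrow> nat set) \<Rightarrow> 'v \<Rightarrow> nat set" where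
  "pair_sub L L' = (\<lambda>v\<in>verts Q. (\<lambda>x. 2 * x) ` L v \<union> (\<lambda>x. 2 * x - 1) ` L' v)"

lemma pair_sub_mem:
  assumes v: "v \<in> verts Q" and zero: "0 \<in> L v" "0 \<in> L' v"
  shows "2 * x \<in> pair_sub L L' v \<longleftrightarrow> x \<in> L v" "2 * x - 1 \<in> pair_sub L L' v \<longleftrightarrow> x \<in> L' v"
proof -
  have eqs: "2 * x = 2 * y - 1 \<longleftrightarrow> x = 0 \<and> y = 0" "2 * x - 1 = 2 * y \<longleftrightarrow> x = 0 \<and> y = 0"
    "2 * x - 1 = 2 * y - 1 \<longleftrightarrow> x = y" "2 * x = 2 * y \<longleftrightarrow> x = y" for x y :: nat
    by presburger+
  have iff: "z \<in> pair_sub L L' v \<longleftrightarrow> (\<exists>y\<in>L v. z = 2 * y) \<or> (\<exists>y\<in>L' v. z = 2 * y - 1)" for z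
    using v by (simp add: pair_sub_def image_iff)
  show "2 * x \<in> pair_sub L L' v \<longleftrightarrow> x \<in> L v" "2 * x - 1 \<in> pair_sub L L' v \<longleftrightarrow> x \<in> L' v"
    unfolding iff eqs using zero by blast+
qed

lemma pair_sub_subreps:
  assumes M: "M \<in> reps Q" and N: "N \<in> reps Q" and L: "L \<in> subreps Q M" and L': "L' \<in> subreps Q N"
  shows "pair_sub L L' \<in> subreps Q (dsum M N)"
proof (rule subrepsI)
  fix v assume v: "v \<in> verts Q"
  show "pair_sub L L' v \<subseteq> car (dsum M N) v" "0 \<in> pair_sub L L' v"
    using subrepsD(1,2)[OF L v] subrepsD(1,2)[OF L' v] v by (auto simp: pair_sub_def car_dsum)
next
  fix \<alpha> y assume a: "\<alpha> \<in> arcs Q" "y \<in> pair_sub L L' (tail Q \<alpha>)"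
  then have t: "tail Q \<alpha> \<in> verts Q" "head Q \<alpha> \<in> verts Q" by simp_all
  from a t consider x where "x \<in> L (tail Q \<alpha>)" "y = 2 * x" | x where "x \<in> L' (tail Q \<alpha>)" "y = 2 * x - 1"
    unfolding pair_sub_def by auto
  then show "act (dsum M N) \<alpha> y \<in> pair_sub L L' (head Q \<alpha>)"
  proof cases
    case (1 x)
    then show ?thesis using subrepsD(3)[OF L a(1) 1(1)] t by (simp add: pair_sub_def)
  next
    case (2 x)
    have "act (dsum M N) \<alpha> (2 * x - 1) = 2 * act N \<alpha> x - 1"
      using act_dsum_right[of x M N \<alpha>] act_zero[OF M a(1)] act_zero[OF N a(1)]
      by (cases "x = 0") (simp_all add: act_dsum_zero)
    then show ?thesis using 2 subrepsD(3)[OF L' a(1) 2(1)] t by (auto simp: pair_sub_def)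
  qed
qed (simp add: pair_sub_def)

text \<open>
  A subset of a disjoint union splits. This has no counterpart over other fields, and it is what
  makes the coproduct multiplicative.
\<close>

lemma bij_pair_sub:
  assumes M: "M \<in> reps Q" and N: "N \<in> reps Q"
  shows "bij_betw (\<lambda>(L, L'). pair_sub L L') (subreps Q M \<times> subreps Q N) (subreps Q (dsum M N))"
proof (rule bij_betw_byWitness[where
      f' = "\<lambda>L. (\<lambda>v\<in>verts Q. {x. 2 * x \<in> L v}, \<lambda>v\<in>verts Q. {x. 2 * x - 1 \<in> L v})"])
  show "\<forall>p\<in>subreps Q M \<times> subreps Q N. (\<lambda>v\<in>verts Q. {x. 2 * x \<in> (case p of (L, L') \<Rightarrow> pair_sub L L') v},
      \<lambda>v\<in>verts Q. {x. 2 * x - 1 \<in> (case p of (L, L') \<Rightarrow> pair_sub L L') v}) = p"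
  proof (clarify, intro conjI)
    fix L L' assume L: "L \<in> subreps Q M" and L': "L' \<in> subreps Q N"
    note mem = pair_sub_mem[where L = L and L' = L', OF _ subrepsD(2)[OF L] subrepsD(2)[OF L']]
    show "(\<lambda>v\<in>verts Q. {x. 2 * x \<in> pair_sub L L' v}) = L"
      using mem(1) subrepsD(4)[OF L] by (auto simp: fun_eq_iff)
    show "(\<lambda>v\<in>verts Q. {x. 2 * x - 1 \<in> pair_sub L L' v}) = L'"
      using mem(2) subrepsD(4)[OF L'] by (auto simp: fun_eq_iff)
  qed
  have split: "pair_sub (\<lambda>v\<in>verts Q. {x. 2 * x \<in> L v}) (\<lambda>v\<in>verts Q. {x. 2 * x - 1 \<in> L v}) = L"
    if L: "L \<in> subreps Q (dsum M N)" for L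
  proof
    fix v
    show "pair_sub (\<lambda>v\<in>verts Q. {x. 2 * x \<in> L v}) (\<lambda>v\<in>verts Q. {x. 2 * x - 1 \<in> L v}) v = L v"
    proof (cases "v \<in> verts Q")
      case True
      have "y \<in> (\<lambda>x. 2 * x) ` {x. 2 * x \<in> L v} \<union> (\<lambda>x. 2 * x - 1) ` {x. 2 * x - 1 \<in> L v}"
        if "y \<in> L v" for y
      proof (cases "even y")
        case True
        then obtain x where "y = 2 * x" by (rule evenE)
        then show ?thesis using that by blast
      next
        case False
        then obtain x where "y = 2 * x + 1" by (rule oddE)
        then have "y = 2 * (x + 1) - 1" by simp
        then show ?thesis using that by blast
      qed
      then show ?thesis using True by (auto simp: pair_sub_def)
    next
      case False
      then show ?thesis using subrepsD(4)[OF L] by (simp add: pair_sub_def)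
    qed
  qed
  then show "\<forall>L\<in>subreps Q (dsum M N). (case (\<lambda>v\<in>verts Q. {x. 2 * x \<in> L v},
      \<lambda>v\<in>verts Q. {x. 2 * x - 1 \<in> L v}) of (L, L') \<Rightarrow> pair_sub L L') = L"
    by simp
  show "(\<lambda>(L, L'). pair_sub L L') ` (subreps Q M \<times> subreps Q N) \<subseteq> subreps Q (dsum M N)"
    using pair_sub_subreps[OF M N] by auto
  show "(\<lambda>L. (\<lambda>v\<in>verts Q. {x. 2 * x \<in> L v}, \<lambda>v\<in>verts Q. {x. 2 * x - 1 \<in> L v})) ` subreps Q (dsum M N)
    \<subseteq> subreps Q M \<times> subreps Q N"
  proof (rule image_subsetI, rule SigmaI)
    fix L assume L: "L \<in> subreps Q (dsum M N)"
    have in_dsum: "(2 * x \<in> car (dsum M N) v \<longrightarrow> x \<in> car M v) \<and> (2 * x - 1 \<in> car (dsum M N) v \<longrightarrow> x \<in> car N v)"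
      if v: "v \<in> verts Q" for v x
      using pair_sub_mem[where L = "car M" and L' = "car N", OF v reps_zero[OF M v] reps_zero[OF N v], of x] v
      by (simp add: pair_sub_def car_dsum)
    show "(\<lambda>v\<in>verts Q. {x. 2 * x \<in> L v}) \<in> subreps Q M"
    proof (rule subrepsI)
      fix \<alpha> x assume a: "\<alpha> \<in> arcs Q" "x \<in> (\<lambda>v\<in>verts Q. {x. 2 * x \<in> L v}) (tail Q \<alpha>)"
      then show "act M \<alpha> x \<in> (\<lambda>v\<in>verts Q. {x. 2 * x \<in> L v}) (head Q \<alpha>)"
        using subrepsD(3)[OF L a(1), of "2 * x"] by simp
    next
      fix v assume v: "v \<in> verts Q"
      show "(\<lambda>v\<in>verts Q. {x. 2 * x \<in> L v}) v \<subseteq> car M v"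
        using subrepsD(1)[OF L v] in_dsum[OF v] v by auto
    qed (use subrepsD(2)[OF L] in auto)
    show "(\<lambda>v\<in>verts Q. {x. 2 * x - 1 \<in> L v}) \<in> subreps Q N"
    proof (rule subrepsI)
      fix v assume v: "v \<in> verts Q"
      show "(\<lambda>v\<in>verts Q. {x. 2 * x - 1 \<in> L v}) v \<subseteq> car N v"
        using subrepsD(1)[OF L v] in_dsum[OF v] v by auto
    next
      fix \<alpha> x assume a: "\<alpha> \<in> arcs Q" "x \<in> (\<lambda>v\<in>verts Q. {x. 2 * x - 1 \<in> L v}) (tail Q \<alpha>)"
      then have t: "tail Q \<alpha> \<in> verts Q" "head Q \<alpha> \<in> verts Q" by simp_all
      have "2 * act N \<alpha> x - 1 \<in> L (head Q \<alpha>)"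
      proof (cases "x = 0")
        case True
        then show ?thesis using act_zero[OF N a(1)] subrepsD(2)[OF L t(2)] by simp
      next
        case False
        show ?thesis
          using subrepsD(3)[OF L a(1), of "2 * x - 1"] a(2) t unfolding act_dsum_right[OF False] by simp
      qed
      then show "act N \<alpha> x \<in> (\<lambda>v\<in>verts Q. {x. 2 * x - 1 \<in> L v}) (head Q \<alpha>)" using t by simp
    qed (use subrepsD(2)[OF L] in auto)
  qed
qed

lemma sub_dsum_iso:
  assumes M: "M \<in> reps Q" and N: "N \<in> reps Q" and L: "L \<in> subreps Q M" and L': "L' \<in> subreps Q N"
  shows "rep_iso Q (dsum (sub_rep M L) (sub_rep N L')) (sub_rep (dsum M N) (pair_sub L L'))"
  by (rule rep_iso_idI) (auto simp: car_dsum pair_sub_def dsum_def)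

lemma quot_dsum_iso:
  assumes M: "M \<in> reps Q" and N: "N \<in> reps Q" and L: "L \<in> subreps Q M" and L': "L' \<in> subreps Q N"
  shows "rep_iso Q (dsum (quot_rep Q M L) (quot_rep Q N L')) (quot_rep Q (dsum M N) (pair_sub L L'))"
proof (rule rep_iso_idI)
  fix v assume v: "v \<in> verts Q"
  note mem = pair_sub_mem[where L = L and L' = L', OF v subrepsD(2)[OF L v] subrepsD(2)[OF L' v]]
  have "y \<in> car (dsum (quot_rep Q M L) (quot_rep Q N L')) v \<longleftrightarrow>
      y \<in> car (quot_rep Q (dsum M N) (pair_sub L L')) v" for y
  proof
    assume "y \<in> car (dsum (quot_rep Q M L) (quot_rep Q N L')) v"
    then consider "y = 0" | x where "x \<in> car M v" "x \<notin> L v" "y = 2 * x"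
      | x where "x \<in> car N v" "x \<notin> L' v" "y = 2 * x - 1"
      by (auto simp: car_dsum)
    then show "y \<in> car (quot_rep Q (dsum M N) (pair_sub L L')) v"
      by cases (use mem in \<open>auto simp: car_dsum\<close>)
  next
    assume "y \<in> car (quot_rep Q (dsum M N) (pair_sub L L')) v"
    then consider "y = 0" | "y \<in> car (dsum M N) v" "y \<notin> pair_sub L L' v" by auto
    then show "y \<in> car (dsum (quot_rep Q M L) (quot_rep Q N L')) v"
    proof cases
      case 1
      have "2 * 0 \<in> (\<lambda>x. 2 * x) ` car (quot_rep Q M L) v" by (rule imageI) simp
      then show ?thesis using 1 unfolding car_dsum by simp
    next
      case 2
      then consider x where "x \<in> car M v" "y = 2 * x" | x where "x \<in> car N v" "y = 2 * x - 1"
        by (auto simp: car_dsum)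
      then show ?thesis
        by cases (use mem 2(2) in \<open>auto simp: car_dsum\<close>)
    qed
  qed
  then show "car (dsum (quot_rep Q M L) (quot_rep Q N L')) v =
      car (quot_rep Q (dsum M N) (pair_sub L L')) v" by blast
next
  fix \<alpha> y assume a: "\<alpha> \<in> arcs Q" "y \<in> car (dsum (quot_rep Q M L) (quot_rep Q N L')) (tail Q \<alpha>)"
  then have t: "head Q \<alpha> \<in> verts Q" by simp
  note mem = pair_sub_mem[where L = L and L' = L', OF t subrepsD(2)[OF L t] subrepsD(2)[OF L' t]]
  have "0 \<in> car (quot_rep Q M L) (tail Q \<alpha>)" by simp
  with a(2) show "act (dsum (quot_rep Q M L) (quot_rep Q N L')) \<alpha> y =
    act (quot_rep Q (dsum M N) (pair_sub L L')) \<alpha> y"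
  proof (cases rule: car_dsum_cases)
    case (1 x)
    then show ?thesis using mem(1) by simp
  next
    case (2 x)
    show ?thesis
      unfolding 2(3) act_dsum_right[OF 2(2)] quot_rep_simps(2) mem(2) by simp
  qed
qed

lemma quot_bot_iso:
  assumes R: "R \<in> reps Q"
  shows "rep_iso Q (quot_rep Q R bot_sub) R"
  by (rule rep_iso_idI) (use reps_zero[OF R] in \<open>auto simp: bot_sub_def\<close>)

lemma sub_top_iso: "rep_iso Q (sub_rep R (top_sub R)) R"
  by (rule rep_iso_idI) (auto simp: top_sub_def)

lemma iso_zero_rep_iff:
  assumes "R \<in> reps Q"
  shows "rep_iso Q R zero_rep \<longleftrightarrow> (\<forall>v\<in>verts Q. car R v = {0})"
proof
  assume "rep_iso Q R zero_rep"
  then obtain h where h: "iso_via h R zero_rep" using rep_iso_iff by blast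
  show "\<forall>v\<in>verts Q. car R v = {0}"
  proof
    fix v assume v: "v \<in> verts Q"
    have "h v x = 0" if "x \<in> car R v" for x
      using iso_viaD(5)[OF h v that] by (simp add: zero_rep_def)
    then show "car R v = {0}"
      using iso_via_nonzero[OF h assms v] reps_zero[OF assms v] by blast
  qed
next
  assume "\<forall>v\<in>verts Q. car R v = {0}"
  then show "rep_iso Q R zero_rep"
    by (intro rep_iso_idI) (auto simp: zero_rep_def act_zero[OF assms])
qed

lemma sub_zero_iff:
  assumes R: "R \<in> reps Q" and L: "L \<in> subreps Q R"
  shows "rep_iso Q (sub_rep R L) zero_rep \<longleftrightarrow> L = bot_sub"
  unfolding iso_zero_rep_iff[OF sub_rep_reps[OF R L]]
  using subreps_eqI[OF L bot_sub_subreps[OF R]] by (auto simp: bot_sub_def)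

lemma quot_zero_iff:
  assumes R: "R \<in> reps Q" and L: "L \<in> subreps Q R"
  shows "rep_iso Q (quot_rep Q R L) zero_rep \<longleftrightarrow> L = top_sub R"
proof -
  have "insert 0 (car R v - L v) = {0} \<longleftrightarrow> L v = car R v" if "v \<in> verts Q" for v
    using subrepsD(1,2)[OF L that] by auto
  then have "(\<forall>v\<in>verts Q. insert 0 (car R v - L v) = {0}) \<longleftrightarrow> (\<forall>v\<in>verts Q. L v = top_sub R v)"
    by (simp add: top_sub_def)
  then show ?thesis
    unfolding iso_zero_rep_iff[OF quot_rep_reps[OF R L]] quot_rep_simps
    using subreps_eqI[OF L top_sub_subreps[OF R]] by auto
qed


subsection \<open>Associated graded representations\<close>

text \<open>
  An arrow can neither enter the zero subrepresentation, nor enter the whole representation from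
  outside. So the ends of a flag do not influence the associated graded representation, on which
  the cancellation of flags rests.
\<close>

lemma gr_rep_insert_bot:
  assumes R: "R \<in> reps Q"
  shows "rep_iso Q (gr_rep R (insert bot_sub F)) (gr_rep R F)"
  by (rule rep_iso_idI) (auto simp: bot_sub_def)

lemma gr_rep_insert_top:
  "rep_iso Q (gr_rep R (insert (top_sub R) F)) (gr_rep R F)"
  by (rule rep_iso_idI) (auto simp: top_sub_def)

text \<open>
  A chain that starts at \<open>L\<close> cuts the arrows that enter \<open>L\<close> and keeps those within \<open>L\<close>, so \<open>L\<close>
  splits off as a summand.
\<close>

lemma gr_rep_quot:
  assumes R: "R \<in> reps Q" and L: "L \<in> subreps Q R" and F: "bot_sub \<in> F" "F \<subseteq> subreps Q (quot_rep Q R L)"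
  shows "rep_iso Q (dsum (gr_rep (quot_rep Q R L) F) (sub_rep R L)) (gr_rep R (lift_sub L ` F))"
proof (rule dsum_isoI[where a = "\<lambda>_ x. x" and b = "\<lambda>_ x. x"])
  show "gr_rep (quot_rep Q R L) F \<in> reps Q" "sub_rep R L \<in> reps Q"
    using R L by (simp_all add: gr_rep_reps quot_rep_reps sub_rep_reps)
  fix v assume v: "v \<in> verts Q"
  show "(\<lambda>x. x) ` car (gr_rep (quot_rep Q R L) F) v \<union> (\<lambda>x. x) ` car (sub_rep R L) v
      = car (gr_rep R (lift_sub L ` F)) v"
    using subrepsD(1,2)[OF L v] by auto
  fix x y assume "x \<in> car (gr_rep (quot_rep Q R L) F) v" "y \<in> car (sub_rep R L) v" "x = y"
  then show "y = 0" by auto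
next
  fix \<alpha> x assume a: "\<alpha> \<in> arcs Q" and x: "x \<in> car (gr_rep (quot_rep Q R L) F) (tail Q \<alpha>)"
  then have t: "tail Q \<alpha> \<in> verts Q" "head Q \<alpha> \<in> verts Q" by simp_all
  have lift: "y \<in> lift_sub L K v \<longleftrightarrow> y \<in> K v \<or> y \<in> L v" if "v \<in> verts Q" for K v y
    using that by (simp add: lift_sub_def)
  have LF: "L \<in> lift_sub L ` F" using lift_sub_bot_top(1)[OF R L] F(1) by (metis imageI)
  show "act (gr_rep (quot_rep Q R L) F) \<alpha> x = act (gr_rep R (lift_sub L ` F)) \<alpha> x"
  proof (cases "x = 0")
    case True
    then show ?thesis using act_zero[OF R a] by simp
  next
    case False
    then have xL: "x \<notin> L (tail Q \<alpha>)" using x by simp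
    show ?thesis
    proof (cases "act R \<alpha> x \<in> L (head Q \<alpha>)")
      case True
      then show ?thesis using xL LF by auto
    next
      case False
      then show ?thesis using xL by (auto simp: lift[OF t(1)] lift[OF t(2)])
    qed
  qed
next
  fix \<alpha> x assume a: "\<alpha> \<in> arcs Q" "x \<in> car (sub_rep R L) (tail Q \<alpha>)"
  then show "act (sub_rep R L) \<alpha> x = act (gr_rep R (lift_sub L ` F)) \<alpha> x"
    by (simp add: lift_sub_def)
qed auto

text \<open>Dually, a chain that ends at \<open>L\<close> splits off the quotient by \<open>L\<close>.\<close>

lemma gr_rep_sub:
  assumes R: "R \<in> reps Q" and L: "L \<in> subreps Q R" and F: "L \<in> F" "F \<subseteq> subreps Q (sub_rep R L)"
  shows "rep_iso Q (dsum (quot_rep Q R L) (gr_rep (sub_rep R L) F)) (gr_rep R F)"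
proof (rule dsum_isoI[where a = "\<lambda>_ x. x" and b = "\<lambda>_ x. x"])
  show "quot_rep Q R L \<in> reps Q" "gr_rep (sub_rep R L) F \<in> reps Q"
    using R L by (simp_all add: gr_rep_reps quot_rep_reps sub_rep_reps)
  fix v assume v: "v \<in> verts Q"
  show "(\<lambda>x. x) ` car (quot_rep Q R L) v \<union> (\<lambda>x. x) ` car (gr_rep (sub_rep R L) F) v = car (gr_rep R F) v"
    using subrepsD(1,2)[OF L v] by auto
  fix x y assume "x \<in> car (quot_rep Q R L) v" "y \<in> car (gr_rep (sub_rep R L) F) v" "x = y"
  then show "y = 0" by auto
next
  fix \<alpha> x assume a: "\<alpha> \<in> arcs Q" and x: "x \<in> car (quot_rep Q R L) (tail Q \<alpha>)"
  then have t: "tail Q \<alpha> \<in> verts Q" "head Q \<alpha> \<in> verts Q" by simp_all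
  show "act (quot_rep Q R L) \<alpha> x = act (gr_rep R F) \<alpha> x"
  proof (cases "x = 0")
    case True
    then show ?thesis using act_zero[OF R a] by simp
  next
    case False
    then have xL: "x \<notin> L (tail Q \<alpha>)" using x by simp
    have le: "K (head Q \<alpha>) \<subseteq> L (head Q \<alpha>)" if "K \<in> F" for K
      using subrepsD(1)[of K "sub_rep R L" "head Q \<alpha>"] F(2) that t by auto
    show ?thesis
    proof (cases "act R \<alpha> x \<in> L (head Q \<alpha>)")
      case True
      then show ?thesis using xL F(1) by auto
    next
      case False
      then have "act R \<alpha> x \<notin> K (head Q \<alpha>)" if "K \<in> F" for K using le[OF that] by blast
      then show ?thesis using False by simp
    qed
  qed
qed auto

end


section \<open>Tensors in coordinates\<close>

text \<open>
  The value at \<open>t\<close> of the linear functional that takes the values \<open>g\<close> on pure tensors. Tensors are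
  only ever inspected through such functionals.
\<close>

definition pairing :: "'k formal \<Rightarrow> ('k \<Rightarrow> complex) \<Rightarrow> complex" where
  "pairing t g = (\<Sum>k\<in>Poly_Mapping.keys t. Poly_Mapping.lookup t k * g k)"

lemma pairing_superset:
  assumes "finite S" "Poly_Mapping.keys t \<subseteq> S"
  shows "pairing t g = (\<Sum>k\<in>S. Poly_Mapping.lookup t k * g k)"
  unfolding pairing_def
  by (rule sum.mono_neutral_left) (use assms in \<open>auto simp: in_keys_iff\<close>)

lemma pairing_zero [simp]: "pairing 0 g = 0"
  by (simp add: pairing_def)

lemma pairing_single [simp]: "pairing (Poly_Mapping.single k c) g = c * g k"
  by (simp add: pairing_def)

lemma pairing_pure [simp]: "pairing (pure k) g = g k"
  by (simp add: pure_def)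

lemma pairing_add [simp]: "pairing (s + t) g = pairing s g + pairing t g"
proof -
  let ?S = "Poly_Mapping.keys s \<union> Poly_Mapping.keys t"
  have "pairing (s + t) g = (\<Sum>k\<in>?S. Poly_Mapping.lookup (s + t) k * g k)"
    by (rule pairing_superset) (auto dest: Poly_Mapping.keys_add[THEN subsetD])
  also have "\<dots> = (\<Sum>k\<in>?S. Poly_Mapping.lookup s k * g k) + (\<Sum>k\<in>?S. Poly_Mapping.lookup t k * g k)"
    by (simp add: lookup_add distrib_right sum.distrib)
  finally show ?thesis
    by (simp add: pairing_superset[of ?S s] pairing_superset[of ?S t])
qed

lemma pairing_uminus [simp]: "pairing (- t) g = - pairing t g"
  by (simp add: pairing_def sum_negf)

lemma pairing_diff [simp]: "pairing (s - t) g = pairing s g - pairing t g"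
  using pairing_add[of s "- t" g] by simp

lemma pairing_sum: "pairing (\<Sum>i\<in>I. t i) g = (\<Sum>i\<in>I. pairing (t i) g)"
  by (induction I rule: infinite_finite_induct) simp_all

lemma pairing_formal_smult [simp]: "pairing (formal_smult c t) g = c * pairing t g"
proof -
  have lookup: "Poly_Mapping.lookup (formal_smult c t) k = c * Poly_Mapping.lookup t k" for k
    by (simp add: formal_smult_def Poly_Mapping.map.rep_eq when_def)
  have "Poly_Mapping.keys (formal_smult c t) \<subseteq> Poly_Mapping.keys t"
    by (auto simp: in_keys_iff lookup)
  then have "pairing (formal_smult c t) g
      = (\<Sum>k\<in>Poly_Mapping.keys t. Poly_Mapping.lookup (formal_smult c t) k * g k)"
    by (intro pairing_superset) auto
  then show ?thesis by (simp add: lookup pairing_def sum_distrib_left mult.assoc)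
qed

lemma keys_formal_smult: "Poly_Mapping.keys (formal_smult c t) \<subseteq> Poly_Mapping.keys t"
  by (auto simp: formal_smult_def in_keys_iff Poly_Mapping.map.rep_eq when_def)

lemma pairing_formal_ext: "pairing (formal_ext F t) g = pairing t (\<lambda>k. pairing (F k) g)"
  unfolding formal_ext_def pairing_sum pairing_formal_smult by (simp add: pairing_def[of t])

lemma keys_formal_ext:
  assumes "\<And>k. k \<in> Poly_Mapping.keys t \<Longrightarrow> Poly_Mapping.keys (F k) \<subseteq> A"
  shows "Poly_Mapping.keys (formal_ext F t) \<subseteq> A"
proof -
  have "Poly_Mapping.keys (formal_ext F t)
      \<subseteq> (\<Union>k\<in>Poly_Mapping.keys t. Poly_Mapping.keys (formal_smult (Poly_Mapping.lookup t k) (F k)))"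
    unfolding formal_ext_def by (rule keys_sum)
  also have "\<dots> \<subseteq> A"
    by (rule UN_least, rule order_trans[OF keys_formal_smult assms])
  finally show ?thesis .
qed

lemma keys_pure [simp]: "Poly_Mapping.keys (pure k) = {k}"
  by (simp add: pure_def)

lemma pairing_cong:
  "(\<And>k. k \<in> Poly_Mapping.keys t \<Longrightarrow> g k = h k) \<Longrightarrow> pairing t g = pairing t h"
  by (simp add: pairing_def)

lemma pairing_sum_right: "pairing t (\<lambda>k. \<Sum>i\<in>I. g i k) = (\<Sum>i\<in>I. pairing t (g i))"
  unfolding pairing_def by (simp add: sum_distrib_left) (rule sum.swap)

lemma pairing_cmult_right: "pairing t (\<lambda>k. c * g k) = c * pairing t g"
  unfolding pairing_def by (simp add: sum_distrib_left mult.left_commute)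

lemma pairing_null_tensors:
  assumes "t \<in> null_tensors V K"
    and "\<And>\<kappa> x y. \<kappa> \<in> K \<Longrightarrow> x \<in> carrier V \<Longrightarrow> y \<in> carrier V \<Longrightarrow> g (\<kappa> (x \<oplus>\<^bsub>V\<^esub> y)) = g (\<kappa> x) + g (\<kappa> y)"
    and "\<And>\<kappa> x a. \<kappa> \<in> K \<Longrightarrow> x \<in> carrier V \<Longrightarrow> g (\<kappa> (a \<odot>\<^bsub>V\<^esub> x)) = a * g (\<kappa> x)"
  shows "pairing t g = 0"
  using assms(1) by induction (simp_all add: assms(2,3) algebra_simps)

lemma tensor2_eq_refl: "tensor2_eq V t t"
  by (simp add: tensor2_eq_def null_tensors.zero)


subsection \<open>Vector spaces with coordinates\<close>

text \<open>
  A vector space that is identified by \<open>crd\<close> with the functions of finite support on \<open>J\<close>, which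
  reduces equations between vectors to equations between complex numbers.
\<close>

locale coord_space =
  fixes V :: "(complex, 'h, 'm) module_scheme" (structure)
    and crd :: "'h \<Rightarrow> 'u \<Rightarrow> complex" and J :: "'u set"
  assumes crd_inj: "inj_on crd (carrier V)"
    and crd_image: "crd ` carrier V = {f. finite {u. f u \<noteq> 0} \<and> {u. f u \<noteq> 0} \<subseteq> J}"
    and zero_in: "\<zero> \<in> carrier V" and crd_zero: "crd \<zero> u = 0"
    and add_in: "x \<in> carrier V \<Longrightarrow> y \<in> carrier V \<Longrightarrow> x \<oplus> y \<in> carrier V"
    and crd_add: "x \<in> carrier V \<Longrightarrow> y \<in> carrier V \<Longrightarrow> crd (x \<oplus> y) u = crd x u + crd y u"
    and smult_in: "x \<in> carrier V \<Longrightarrow> c \<odot> x \<in> carrier V"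
    and crd_smult: "x \<in> carrier V \<Longrightarrow> crd (c \<odot> x) u = c * crd x u"
begin

lemma crd_outside: "x \<in> carrier V \<Longrightarrow> u \<notin> J \<Longrightarrow> crd x u = 0"
  using crd_image by blast

lemma crd_finite: "x \<in> carrier V \<Longrightarrow> finite {u. crd x u \<noteq> 0}"
  using crd_image by blast

lemma crd_eqI:
  assumes "x \<in> carrier V" "y \<in> carrier V" "\<And>u. u \<in> J \<Longrightarrow> crd x u = crd y u"
  shows "x = y"
proof -
  have "crd x = crd y" using assms crd_outside by (intro ext) metis
  then show ?thesis using crd_inj assms by (simp add: inj_on_def)
qed

definition vec :: "('u \<Rightarrow> complex) \<Rightarrow> 'h" where
  "vec = inv_into (carrier V) crd"

lemma vec:
  assumes "finite {u. f u \<noteq> 0}" "{u. f u \<noteq> 0} \<subseteq> J"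
  shows "vec f \<in> carrier V" "crd (vec f) = f"
proof -
  have "f \<in> crd ` carrier V" using assms crd_image by blast
  then show "vec f \<in> carrier V" "crd (vec f) = f"
    unfolding vec_def by (simp_all add: inv_into_into f_inv_into_f)
qed

definition bas :: "'u \<Rightarrow> 'h" where
  "bas u = vec (\<lambda>w. if w = u then 1 else 0)"

lemma bas:
  assumes "u \<in> J"
  shows "bas u \<in> carrier V" "crd (bas u) w = (if w = u then 1 else 0)"
proof -
  have s: "{w. (if w = u then 1 else 0) \<noteq> (0::complex)} = {u}" by auto
  show "bas u \<in> carrier V" "crd (bas u) w = (if w = u then 1 else 0)"
    unfolding bas_def by (simp_all add: vec[of "\<lambda>w. if w = u then 1 else 0"] s assms)
qed

lemma coord_induct:
  assumes x: "x \<in> carrier V"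
    and zero: "P \<zero>"
    and add: "\<And>x y. x \<in> carrier V \<Longrightarrow> y \<in> carrier V \<Longrightarrow> P x \<Longrightarrow> P y \<Longrightarrow> P (x \<oplus> y)"
    and smult: "\<And>c x. x \<in> carrier V \<Longrightarrow> P x \<Longrightarrow> P (c \<odot> x)"
    and basis: "\<And>u. u \<in> J \<Longrightarrow> P (bas u)"
  shows "P x"
proof -
  have "{u. crd x u \<noteq> 0} \<subseteq> S \<Longrightarrow> x \<in> carrier V \<Longrightarrow> P x" if "finite S" "S \<subseteq> J" for S x
    using that
  proof (induction S arbitrary: x rule: finite_induct)
    case empty
    then have "x = \<zero>" by (intro crd_eqI) (auto simp: zero_in crd_zero)
    then show ?case using zero by simp
  next
    case (insert u S)
    let ?f = "\<lambda>w. if w = u then 0 else crd x w"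
    have "{w. ?f w \<noteq> 0} \<subseteq> S" using insert.prems by auto
    then have y: "vec ?f \<in> carrier V" "crd (vec ?f) = ?f"
      using insert by (auto intro!: vec dest: finite_subset)
    have Py: "P (vec ?f)" using insert y \<open>{w. ?f w \<noteq> 0} \<subseteq> S\<close> by auto
    have u: "u \<in> J" using insert by simp
    have "x = vec ?f \<oplus> (crd x u \<odot> bas u)"
      by (rule crd_eqI) (simp_all add: insert.prems y bas[OF u] add_in smult_in crd_add crd_smult)
    then show ?case
      using add[OF y(1) smult_in[OF bas(1)[OF u]] Py smult[OF bas(1)[OF u] basis[OF u]]] by metis
  qed
  then show ?thesis using crd_finite[OF x] crd_outside[OF x] x by blast
qed

subsubsection \<open>The module structure\<close>

lemma abelian_group: "abelian_group V"
proof (rule abelian_groupI)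
  fix x assume x: "x \<in> carrier V"
  have "(- 1) \<odot> x \<oplus> x = \<zero>"
    by (rule crd_eqI) (simp_all add: x smult_in add_in zero_in crd_add crd_smult crd_zero)
  then show "\<exists>y\<in>carrier V. y \<oplus> x = \<zero>" using smult_in[OF x] by blast
qed (auto intro!: crd_eqI simp: add_in zero_in crd_add crd_zero)

lemma cring_complex: "cring complex_ring"
  by (rule cring_from_type_algebra)

lemma module: "Module.module complex_ring V"
proof (rule moduleI[OF cring_complex abelian_group])
qed (auto intro!: crd_eqI simp: ring_of_type_algebra_def smult_in add_in crd_add crd_smult algebra_simps)

lemma crd_minus:
  assumes "x \<in> carrier V"
  shows "\<ominus> x \<in> carrier V" "crd (\<ominus> x) u = - crd x u"
proof -
  interpret abelian_group V by (rule abelian_group)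
  show "\<ominus> x \<in> carrier V" using assms by simp
  have "crd x u + crd (\<ominus> x) u = 0"
    using crd_add[OF assms \<open>\<ominus> x \<in> carrier V\<close>, of u] r_neg[OF assms] by (simp add: crd_zero)
  then show "crd (\<ominus> x) u = - crd x u" by (metis add_eq_0_iff)
qed

lemma finsum_coord:
  assumes "\<And>i. i \<in> I \<Longrightarrow> f i \<in> carrier V"
  shows "(\<Oplus>i\<in>I. f i) \<in> carrier V" "crd (\<Oplus>i\<in>I. f i) u = (\<Sum>i\<in>I. crd (f i) u)"
proof -
  interpret abelian_group V by (rule abelian_group)
  show "(\<Oplus>i\<in>I. f i) \<in> carrier V" using assms by (intro finsum_closed) auto
  show "crd (\<Oplus>i\<in>I. f i) u = (\<Sum>i\<in>I. crd (f i) u)"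
    using assms
  proof (induction I rule: infinite_finite_induct)
    case (infinite I)
    then show ?case by (simp add: finsum_infinite crd_zero)
  next
    case (insert i I)
    then have "f \<in> I \<rightarrow> carrier V" "f i \<in> carrier V" by auto
    then show ?case using insert by (simp add: crd_add)
  qed (simp add: crd_zero)
qed

lemma formal_eval_coord:
  assumes "\<And>k. k \<in> Poly_Mapping.keys t \<Longrightarrow> F k \<in> carrier V"
  shows "formal_eval V F t \<in> carrier V" "crd (formal_eval V F t) u = pairing t (\<lambda>k. crd (F k) u)"
  unfolding formal_eval_def pairing_def
  using assms by (simp_all add: finsum_coord smult_in crd_smult)

subsubsection \<open>Equality of tensors\<close>

text \<open>
  Reducible tensors are those that the relations for the slots \<open>K\<close> turn into combinations of the
  tensors in \<open>B\<close>. With basis tensors for \<open>B\<close> this is a statement about normal forms.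
\<close>

definition reducible :: "('h \<Rightarrow> 'k) set \<Rightarrow> 'k set \<Rightarrow> 'k formal \<Rightarrow> bool" where
  "reducible K B t \<longleftrightarrow> (\<exists>b. Poly_Mapping.keys b \<subseteq> B \<and> t - b \<in> null_tensors V K)"

lemma reducible_null: "t \<in> null_tensors V K \<Longrightarrow> reducible K B t"
  unfolding reducible_def by (intro exI[of _ 0]) simp

lemma reducible_add:
  assumes "reducible K B s" "reducible K B t"
  shows "reducible K B (s + t)"
proof -
  obtain a b where "Poly_Mapping.keys a \<subseteq> B" "s - a \<in> null_tensors V K"
    and "Poly_Mapping.keys b \<subseteq> B" "t - b \<in> null_tensors V K"
    using assms unfolding reducible_def by blast
  then have "Poly_Mapping.keys (a + b) \<subseteq> B" "(s + t) - (a + b) \<in> null_tensors V K"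
    using Poly_Mapping.keys_add[of a b] null_tensors.plus[of "s - a" V K "t - b"]
    by (auto simp: algebra_simps)
  then show ?thesis unfolding reducible_def by blast
qed

lemma reducible_cong:
  assumes "s - t \<in> null_tensors V K" "reducible K B t"
  shows "reducible K B s"
  using reducible_add[OF reducible_null[OF assms(1)] assms(2)] by simp

text \<open>By linearity in one slot, it is enough to put basis vectors there.\<close>

lemma reducible_slot:
  assumes \<kappa>: "\<kappa> \<in> K" and x: "x \<in> carrier V"
    and basis: "\<And>u c. u \<in> J \<Longrightarrow> reducible K B (Poly_Mapping.single (\<kappa> (bas u)) c)"
  shows "reducible K B (Poly_Mapping.single (\<kappa> x) c)"
proof -
  have "\<forall>c. reducible K B (Poly_Mapping.single (\<kappa> x) c)"
    using x
  proof (rule coord_induct)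
    have zero: "0 \<odot> \<zero> = \<zero>"
      by (rule crd_eqI) (simp_all add: smult_in zero_in crd_smult crd_zero)
    show "\<forall>c. reducible K B (Poly_Mapping.single (\<kappa> \<zero>) c)"
    proof
      fix c show "reducible K B (Poly_Mapping.single (\<kappa> \<zero>) c)"
        using null_tensors.homogeneous[OF \<kappa> zero_in, of 0 c] zero by (intro reducible_null) simp
    qed
  next
    fix x y
    assume a: "x \<in> carrier V" "y \<in> carrier V" "\<forall>c. reducible K B (Poly_Mapping.single (\<kappa> x) c)"
      "\<forall>c. reducible K B (Poly_Mapping.single (\<kappa> y) c)"
    show "\<forall>c. reducible K B (Poly_Mapping.single (\<kappa> (x \<oplus> y)) c)"
    proof
      fix c
      have "Poly_Mapping.single (\<kappa> (x \<oplus> y)) c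
          - (Poly_Mapping.single (\<kappa> x) c + Poly_Mapping.single (\<kappa> y) c) \<in> null_tensors V K"
        using null_tensors.additive[OF \<kappa> a(1,2), of c] by (simp add: diff_diff_eq)
      then show "reducible K B (Poly_Mapping.single (\<kappa> (x \<oplus> y)) c)"
        by (rule reducible_cong) (simp add: reducible_add a(3,4))
    qed
  next
    fix a x
    assume "x \<in> carrier V" "\<forall>c. reducible K B (Poly_Mapping.single (\<kappa> x) c)"
    then show "\<forall>c. reducible K B (Poly_Mapping.single (\<kappa> (a \<odot> x)) c)"
      using reducible_cong[OF null_tensors.homogeneous[OF \<kappa>]] by blast
  qed (simp add: basis)
  then show ?thesis by blast
qed

lemma reducible_sum_singles:
  assumes "\<And>k c. k \<in> Poly_Mapping.keys t \<Longrightarrow> reducible K B (Poly_Mapping.single k c)"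
  shows "reducible K B t"
proof -
  have "reducible K B (\<Sum>k\<in>S. Poly_Mapping.single k (Poly_Mapping.lookup t k))"
    if "finite S" "S \<subseteq> Poly_Mapping.keys t" for S
    using that
  proof (induction S rule: finite_induct)
    case empty
    then show ?case using reducible_null[OF null_tensors.zero] by simp
  next
    case (insert k S)
    then have "reducible K B (Poly_Mapping.single k (Poly_Mapping.lookup t k))"
      by (intro assms) simp
    then show ?case using insert reducible_add by simp
  qed
  from this[OF finite_keys order_refl]
  have "reducible K B (\<Sum>k\<in>Poly_Mapping.keys t. Poly_Mapping.single k (Poly_Mapping.lookup t k))" .
  moreover have "(\<Sum>k\<in>Poly_Mapping.keys t. Poly_Mapping.single k (Poly_Mapping.lookup t k)) = t"
    by (rule poly_mapping_eqI) (simp add: lookup_sum lookup_single when_def in_keys_iff)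
  ultimately show ?thesis by simp
qed

text \<open>
  Here \<open>e\<close> lists the basis tensors and \<open>g\<close> the dual functionals. The functionals do not see the
  relations, so they read off the coefficients of the normal form of \<open>t\<close>; if these vanish, \<open>t\<close> is a
  consequence of the relations.
\<close>

lemma null_tensor_criterion:
  assumes red: "reducible K (e ` I) t"
    and null: "\<And>i s. i \<in> I \<Longrightarrow> s \<in> null_tensors V K \<Longrightarrow> pairing s (g i) = 0"
    and dual: "\<And>i j. i \<in> I \<Longrightarrow> j \<in> I \<Longrightarrow> g i (e j) = (if j = i then 1 else 0)"
    and t: "\<And>i. i \<in> I \<Longrightarrow> pairing t (g i) = 0"
  shows "t \<in> null_tensors V K"
proof -
  obtain s where s: "Poly_Mapping.keys s \<subseteq> e ` I" "t - s \<in> null_tensors V K"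
    using red unfolding reducible_def by blast
  have "Poly_Mapping.lookup s k = 0" for k
  proof (rule ccontr)
    assume ne: "Poly_Mapping.lookup s k \<noteq> 0"
    then have k: "k \<in> Poly_Mapping.keys s" by (simp add: in_keys_iff)
    then obtain i where i: "i \<in> I" "k = e i" using s(1) by blast
    have "g i l = (if l = k then 1 else 0)" if "l \<in> Poly_Mapping.keys s" for l
    proof -
      obtain j where "j \<in> I" "l = e j" using s(1) \<open>l \<in> Poly_Mapping.keys s\<close> by blast
      then show ?thesis using dual[OF i(1) i(1)] dual[OF i(1) \<open>j \<in> I\<close>] i(2) by (cases "j = i") auto
    qed
    then have "pairing s (g i) = (\<Sum>l\<in>Poly_Mapping.keys s. if l = k then Poly_Mapping.lookup s l else 0)"
      unfolding pairing_def by (intro sum.cong) simp_all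
    also have "\<dots> = Poly_Mapping.lookup s k" using k by simp
    finally have "pairing s (g i) = Poly_Mapping.lookup s k" .
    moreover have "pairing (t - s) (g i) = 0" by (rule null[OF i(1) s(2)])
    ultimately show False using t[OF i(1)] ne by simp
  qed
  then have "s = 0" by (intro poly_mapping_eqI) simp
  then show ?thesis using s(2) by simp
qed

lemma tensor2_eqI:
  assumes keys: "Poly_Mapping.keys s \<subseteq> carrier V \<times> carrier V" "Poly_Mapping.keys t \<subseteq> carrier V \<times> carrier V"
    and eq: "\<And>u w. u \<in> J \<Longrightarrow> w \<in> J \<Longrightarrow>
      pairing s (\<lambda>(a, b). crd a u * crd b w) = pairing t (\<lambda>(a, b). crd a u * crd b w)"
  shows "tensor2_eq V s t"
proof -
  define e where "e = (\<lambda>(u, w). (bas u, bas w))"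
  define g where "g = (\<lambda>(u, w) (a, b). crd a u * crd b w)"
  let ?R = "\<lambda>k c. reducible (slots2 V) (e ` (J \<times> J)) (Poly_Mapping.single k c)"
  have step: "?R (bas u, bas w) c" if "u \<in> J" "w \<in> J" for u w c
  proof -
    have "(bas u, bas w) \<in> e ` (J \<times> J)"
      using that by (intro image_eqI[where x = "(u, w)"]) (simp_all add: e_def)
    then show ?thesis
      unfolding reducible_def
      by (intro exI[of _ "Poly_Mapping.single (bas u, bas w) c"]) (simp add: null_tensors.zero)
  qed
  have step1: "?R (x, bas w) c" if "x \<in> carrier V" "w \<in> J" for x w c
    by (rule reducible_slot[where \<kappa> = "\<lambda>x. (x, bas w)", OF _ that(1)])
      (use that bas(1) step in \<open>auto simp: slots2_def\<close>)
  have step2: "?R (x, y) c" if "x \<in> carrier V" "y \<in> carrier V" for x y c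
    by (rule reducible_slot[where \<kappa> = "\<lambda>y. (x, y)", OF _ that(2)])
      (use that step1 in \<open>auto simp: slots2_def\<close>)
  have keys_diff: "Poly_Mapping.keys (s - t) \<subseteq> carrier V \<times> carrier V"
    using keys Poly_Mapping.keys_diff[of s t] by blast
  show ?thesis
    unfolding tensor2_eq_def
  proof (rule null_tensor_criterion)
    show "reducible (slots2 V) (e ` (J \<times> J)) (s - t)"
      by (rule reducible_sum_singles) (use step2 keys_diff in auto)
    fix i assume "i \<in> J \<times> J"
    then obtain u w where i: "i = (u, w)" "u \<in> J" "w \<in> J" by blast
    show "pairing r (g i) = 0" if "r \<in> null_tensors V (slots2 V)" for r
      using that by (rule pairing_null_tensors)
        (auto simp: slots2_def g_def i crd_add crd_smult algebra_simps)
    show "pairing (s - t) (g i) = 0" using eq[OF i(2,3)] by (simp add: g_def i)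
    show "g i (e j) = (if j = i then 1 else 0)" if "j \<in> J \<times> J" for j
      using that i bas(2) by (auto simp: g_def e_def split: if_splits)
  qed
qed

lemma tensor3_eqI:
  assumes keys: "Poly_Mapping.keys s \<subseteq> carrier V \<times> carrier V \<times> carrier V"
      "Poly_Mapping.keys t \<subseteq> carrier V \<times> carrier V \<times> carrier V"
    and eq: "\<And>u w z. u \<in> J \<Longrightarrow> w \<in> J \<Longrightarrow> z \<in> J \<Longrightarrow>
      pairing s (\<lambda>(a, b, c). crd a u * crd b w * crd c z) = pairing t (\<lambda>(a, b, c). crd a u * crd b w * crd c z)"
  shows "tensor3_eq V s t"
proof -
  define e where "e = (\<lambda>(u, w, z). (bas u, bas w, bas z))"
  define g where "g = (\<lambda>(u, w, z) (a, b, c). crd a u * crd b w * crd c z)"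
  let ?R = "\<lambda>k c. reducible (slots3 V) (e ` (J \<times> J \<times> J)) (Poly_Mapping.single k c)"
  have step: "?R (bas u, bas w, bas z) c" if "u \<in> J" "w \<in> J" "z \<in> J" for u w z c
  proof -
    have "(bas u, bas w, bas z) \<in> e ` (J \<times> J \<times> J)"
      using that by (intro image_eqI[where x = "(u, w, z)"]) (simp_all add: e_def)
    then show ?thesis
      unfolding reducible_def
      by (intro exI[of _ "Poly_Mapping.single (bas u, bas w, bas z) c"]) (simp add: null_tensors.zero)
  qed
  have step1: "?R (x, bas w, bas z) c" if "x \<in> carrier V" "w \<in> J" "z \<in> J" for x w z c
    by (rule reducible_slot[where \<kappa> = "\<lambda>x. (x, bas w, bas z)", OF _ that(1)])
      (use that bas(1) step in \<open>auto simp: slots3_def\<close>)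
  have step2: "?R (x, y, bas z) c" if "x \<in> carrier V" "y \<in> carrier V" "z \<in> J" for x y z c
    by (rule reducible_slot[where \<kappa> = "\<lambda>y. (x, y, bas z)", OF _ that(2)])
      (use that bas(1) step1 in \<open>auto simp: slots3_def\<close>)
  have step3: "?R (x, y, z) c" if "x \<in> carrier V" "y \<in> carrier V" "z \<in> carrier V" for x y z c
    by (rule reducible_slot[where \<kappa> = "\<lambda>z. (x, y, z)", OF _ that(3)])
      (use that step2 in \<open>auto simp: slots3_def\<close>)
  have keys_diff: "Poly_Mapping.keys (s - t) \<subseteq> carrier V \<times> carrier V \<times> carrier V"
    using keys Poly_Mapping.keys_diff[of s t] by blast
  show ?thesis
    unfolding tensor3_eq_def
  proof (rule null_tensor_criterion)
    show "reducible (slots3 V) (e ` (J \<times> J \<times> J)) (s - t)"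
      by (rule reducible_sum_singles) (use step3 keys_diff in auto)
    fix i assume "i \<in> J \<times> J \<times> J"
    then obtain u w z where i: "i = (u, w, z)" "u \<in> J" "w \<in> J" "z \<in> J" by blast
    show "pairing r (g i) = 0" if "r \<in> null_tensors V (slots3 V)" for r
      using that by (rule pairing_null_tensors)
        (auto simp: slots3_def g_def i crd_add crd_smult algebra_simps)
    show "pairing (s - t) (g i) = 0" using eq[OF i(2-4)] by (simp add: g_def i)
    show "g i (e j) = (if j = i then 1 else 0)" if "j \<in> J \<times> J \<times> J" for j
      using that i bas(2) by (auto simp: g_def e_def split: if_splits)
  qed
qed

end


context quiver
begin

section \<open>Finiteness of isomorphism classes\<close>

lemma iso_via_reps:
  assumes h: "iso_via h M N" and M: "M \<in> reps Q"
  shows "N \<in> reps Q"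
proof (rule repsI)
  fix v assume v: "v \<in> verts Q"
  show "finite (car N v)" using iso_viaD(4)[OF h v] reps_finite[OF M v] by (metis finite_imageI)
  show "0 \<in> car N v" using iso_viaD(2,5)[OF h v] reps_zero[OF M v] by metis
next
  fix \<alpha> y assume a: "\<alpha> \<in> arcs Q" "y \<in> car N (tail Q \<alpha>)"
  then have t: "tail Q \<alpha> \<in> verts Q" "head Q \<alpha> \<in> verts Q" by simp_all
  obtain x where x: "x \<in> car M (tail Q \<alpha>)" "y = h (tail Q \<alpha>) x"
    using a(2) iso_viaD(4)[OF h t(1)] by blast
  show "act N \<alpha> y \<in> car N (head Q \<alpha>)"
    using iso_via_act[OF h a(1) x(1)] iso_viaD(5)[OF h t(2) act_closed[OF M a(1) x(1)]] x(2) by simp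
next
  fix \<alpha> assume a: "\<alpha> \<in> arcs Q"
  then have t: "tail Q \<alpha> \<in> verts Q" "head Q \<alpha> \<in> verts Q" by simp_all
  show "act N \<alpha> 0 = 0"
    using iso_via_act[OF h a reps_zero[OF M t(1)]] iso_viaD(2)[OF h t(1)] iso_viaD(2)[OF h t(2)]
      act_zero[OF M a] by simp
next
  fix \<alpha> y z
  assume a: "\<alpha> \<in> arcs Q" "y \<in> car N (tail Q \<alpha>)" "z \<in> car N (tail Q \<alpha>)" "act N \<alpha> y = act N \<alpha> z" "act N \<alpha> z \<noteq> 0"
  then have t: "tail Q \<alpha> \<in> verts Q" "head Q \<alpha> \<in> verts Q" by simp_all
  obtain x where x: "x \<in> car M (tail Q \<alpha>)" "y = h (tail Q \<alpha>) x"
    using a(2) iso_viaD(4)[OF h t(1)] by blast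
  obtain x' where x': "x' \<in> car M (tail Q \<alpha>)" "z = h (tail Q \<alpha>) x'"
    using a(3) iso_viaD(4)[OF h t(1)] by blast
  note ac = act_closed[OF M a(1) x(1)] act_closed[OF M a(1) x'(1)]
  have e: "h (head Q \<alpha>) (act M \<alpha> x) = h (head Q \<alpha>) (act M \<alpha> x')" "h (head Q \<alpha>) (act M \<alpha> x') \<noteq> 0"
    using iso_via_act[OF h a(1) x(1)] iso_via_act[OF h a(1) x'(1)] a(4,5) x(2) x'(2) by simp_all
  have "act M \<alpha> x = act M \<alpha> x'" using inj_onD[OF iso_viaD(3)[OF h t(2)] e(1) ac] .
  moreover have "act M \<alpha> x' \<noteq> 0" using e(2) iso_viaD(2)[OF h t(2)] by (intro notI) simp
  ultimately have "x = x'" using act_inj[OF M a(1) x(1) x'(1)] by simp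
  then show "y = z" using x x' by simp
qed

definition dim_le :: "nat \<Rightarrow> ('v, 'a) rep \<Rightarrow> bool" where
  "dim_le n M \<longleftrightarrow> (\<forall>v\<in>verts Q. card (car M v) \<le> n)"

lemma dim_le_iso:
  assumes "rep_iso Q M N" "dim_le n M"
  shows "dim_le n N"
proof -
  obtain h where h: "iso_via h M N" using assms(1) rep_iso_iff by blast
  show ?thesis
    using assms(2) bij_betw_same_card[OF iso_viaD(1)[OF h]] by (simp add: dim_le_def)
qed

lemma dim_le_extension:
  assumes R: "R \<in> reps Q" and L: "L \<in> subreps Q R"
    and "dim_le m (quot_rep Q R L)" "dim_le n (sub_rep R L)"
  shows "dim_le (m + n) R"
  unfolding dim_le_def
proof
  fix v assume v: "v \<in> verts Q"
  have "car R v = car (quot_rep Q R L) v \<union> L v" using subrepsD(1,2)[OF L v] by auto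
  then have "card (car R v) \<le> card (car (quot_rep Q R L) v) + card (L v)"
    using card_Un_le by metis
  also have "\<dots> \<le> m + n" using assms(3,4) v by (intro add_mono) (auto simp: dim_le_def)
  finally show "card (car R v) \<le> m + n" .
qed

lemma dim_le_dsum:
  assumes M: "M \<in> reps Q" and N: "N \<in> reps Q" and le: "dim_le n (dsum M N)"
  shows "dim_le n M" "dim_le n N"
proof -
  have "card (car M v) \<le> card (car (dsum M N) v) \<and> card (car N v) \<le> card (car (dsum M N) v)"
    if v: "v \<in> verts Q" for v
  proof
    note fin = reps_finite[OF dsum_reps[OF M N] v]
    have "card ((\<lambda>x. 2 * x) ` car M v) = card (car M v)" by (rule card_image) (simp add: inj_on_def)
    moreover have "card ((\<lambda>x. 2 * x - 1) ` car N v) = card (car N v)"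
      by (rule card_image, rule inj_onI) presburger
    ultimately show "card (car M v) \<le> card (car (dsum M N) v)" "card (car N v) \<le> card (car (dsum M N) v)"
      using card_mono[OF fin, of "(\<lambda>x. 2 * x) ` car M v"] card_mono[OF fin, of "(\<lambda>x. 2 * x - 1) ` car N v"]
      by (simp_all add: car_dsum)
  qed
  then show "dim_le n M" "dim_le n N"
    using le unfolding dim_le_def by (meson order_trans)+
qed

lemma dim_le_gr_rep: "dim_le n (gr_rep R F) \<longleftrightarrow> dim_le n R"
  by (simp add: dim_le_def)

text \<open>
  After numbering the elements of the carriers, with \<open>0\<close> first, a representation is given by
  finitely many functions between finite sets of bounded size.
\<close>

lemma finite_dim_le_classes: "finite (cl ` {M \<in> reps Q. dim_le n M})"
proof (rule finite_subset)
  let ?T = "(\<Pi>\<^sub>E v\<in>verts Q. Pow {..<n}) \<times> (\<Pi>\<^sub>E \<alpha>\<in>arcs Q. \<Pi>\<^sub>E x\<in>{..<n}. {..<n})"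
  show "finite ((\<lambda>(c, a). cl \<lparr>car = c, act = a\<rparr>) ` ?T)"
    by (intro finite_imageI finite_cartesian_product finite_PiE) auto
  show "cl ` {M \<in> reps Q. dim_le n M} \<subseteq> (\<lambda>(c, a). cl \<lparr>car = c, act = a\<rparr>) ` ?T"
  proof (rule image_subsetI)
    fix M assume "M \<in> {M \<in> reps Q. dim_le n M}"
    then have M: "M \<in> reps Q" and le: "dim_le n M" by auto
    have "\<exists>f. bij_betw f (car M v) {..<card (car M v)} \<and> f 0 = 0" if v: "v \<in> verts Q" for v
    proof -
      have "finite (car M v)" "0 \<in> car M v" using M v reps_finite reps_zero by auto
      then have pos: "0 < card (car M v)" by (auto simp: card_gt_0_iff)
      have "card (car M v - {0}) = card ({..<card (car M v)} - {0})"
        using \<open>finite (car M v)\<close> \<open>0 \<in> car M v\<close> pos by (simp add: card_Diff_singleton)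
      then obtain g where g: "bij_betw g (car M v - {0}) ({..<card (car M v)} - {0})"
        using finite_same_card_bij \<open>finite (car M v)\<close> by (metis finite_Diff finite_lessThan)
      have "bij_betw (g(0 := 0)) (car M v - {0}) ({..<card (car M v)} - {0})"
        using g by (subst bij_betw_cong[where g = g]) simp_all
      then have "bij_betw (g(0 := 0)) (insert 0 (car M v - {0})) (insert 0 ({..<card (car M v)} - {0}))"
        using notIn_Un_bij_betw[of 0 "car M v - {0}" "g(0 := 0)" "{..<card (car M v)} - {0}"] by simp
      moreover have "insert 0 (car M v - {0}) = car M v"
        "insert 0 ({..<card (car M v)} - {0}) = {..<card (car M v)}"
        using \<open>0 \<in> car M v\<close> pos by auto
      ultimately show ?thesis by (intro exI[of _ "g(0 := 0)"]) simp
    qed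
    then obtain h where h: "\<And>v. v \<in> verts Q \<Longrightarrow> bij_betw (h v) (car M v) {..<card (car M v)}"
      "\<And>v. v \<in> verts Q \<Longrightarrow> h v 0 = 0" by metis
    have lt: "h v x < n" if "v \<in> verts Q" "x \<in> car M v" for v x
      using bij_betwE[OF h(1)[OF that(1)]] that le by (fastforce simp: dim_le_def)
    define c where "c = (\<lambda>v\<in>verts Q. h v ` car M v)"
    define g where "g v = inv_into (car M v) (h v)" for v
    have gh: "g v (h v x) = x" if "v \<in> verts Q" "x \<in> car M v" for v x
      using h(1)[OF that(1)] that by (simp add: g_def bij_betw_def)
    \<comment> \<open>off the carrier the value only has to be less than \<open>n\<close>\<close>
    define a where "a = (\<lambda>\<alpha>\<in>arcs Q. \<lambda>x\<in>{..<n}. if x \<in> h (tail Q \<alpha>) ` car M (tail Q \<alpha>)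
      then h (head Q \<alpha>) (act M \<alpha> (g (tail Q \<alpha>) x)) else x)"
    have "iso_via h M \<lparr>car = c, act = a\<rparr>"
      unfolding iso_via_def
    proof (intro conjI ballI)
      fix v assume v: "v \<in> verts Q"
      show "h v 0 = 0" by (rule h(2)[OF v])
      show "bij_betw (h v) (car M v) (car \<lparr>car = c, act = a\<rparr> v)"
        using h(1)[OF v] v by (simp add: c_def bij_betw_def)
    next
      fix \<alpha> x assume al: "\<alpha> \<in> arcs Q" and x: "x \<in> car M (tail Q \<alpha>)"
      then have t: "tail Q \<alpha> \<in> verts Q" by simp
      show "h (head Q \<alpha>) (act M \<alpha> x) = act \<lparr>car = c, act = a\<rparr> \<alpha> (h (tail Q \<alpha>) x)"
        using gh[OF t x] lt[OF t x] al x by (simp add: a_def)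
    qed
    then have "rep_iso Q M \<lparr>car = c, act = a\<rparr>" "\<lparr>car = c, act = a\<rparr> \<in> reps Q"
      using rep_iso_iff iso_via_reps M by blast+
    then have eq: "cl M = cl \<lparr>car = c, act = a\<rparr>" using iso_class_eqI[OF M] by blast
    have c: "c \<in> (\<Pi>\<^sub>E v\<in>verts Q. Pow {..<n})" unfolding c_def using lt by auto
    have "h (head Q \<alpha>) (act M \<alpha> (g (tail Q \<alpha>) x)) < n"
      if al: "\<alpha> \<in> arcs Q" "x \<in> h (tail Q \<alpha>) ` car M (tail Q \<alpha>)" for \<alpha> x
    proof -
      have t: "tail Q \<alpha> \<in> verts Q" "head Q \<alpha> \<in> verts Q" using al by simp_all
      obtain y where y: "y \<in> car M (tail Q \<alpha>)" "x = h (tail Q \<alpha>) y" using al(2) by blast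
      show ?thesis using lt[OF t(2) act_closed[OF M al(1) y(1)]] gh[OF t(1) y(1)] y(2) by simp
    qed
    then have "a \<in> (\<Pi>\<^sub>E \<alpha>\<in>arcs Q. \<Pi>\<^sub>E x\<in>{..<n}. {..<n})" unfolding a_def by (auto simp: PiE_iff)
    then show "cl M \<in> (\<lambda>(c, a). cl \<lparr>car = c, act = a\<rparr>) ` ?T"
      using c eq by (intro image_eqI[where x = "(c, a)"]) simp_all
  qed
qed

lemma dim_le_exists:
  assumes "finite F" "F \<subseteq> cl ` reps Q"
  obtains n where "\<And>M. M \<in> reps Q \<Longrightarrow> cl M \<in> F \<Longrightarrow> dim_le n M"
proof -
  let ?d = "\<lambda>U. \<Sum>v\<in>verts Q. card (car (rep_of U) v)"
  let ?n = "\<Sum>U\<in>F. ?d U"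
  have "dim_le ?n M" if M: "M \<in> reps Q" "cl M \<in> F" for M
  proof -
    have "?d (cl M) \<le> ?n" using M(2) assms(1) by (intro member_le_sum) auto
    moreover have "card (car (rep_of (cl M)) v) \<le> ?d (cl M)" if "v \<in> verts Q" for v
      using that by (intro member_le_sum) auto
    ultimately have "dim_le ?n (rep_of (cl M))"
      unfolding dim_le_def using le_trans by blast
    then show ?thesis
      using dim_le_iso[OF rep_iso_sym[OF M(1) rep_of_iso_class(2)[OF M(1)]]] by blast
  qed
  then show thesis using that by blast
qed


section \<open>The product and the antipode as sums over subrepresentations and flags\<close>

text \<open>The value at \<open>R\<close> of the product of two class functions.\<close>

definition hprod :: "('v, 'a) hall \<Rightarrow> ('v, 'a) hall \<Rightarrow> ('v, 'a) rep \<Rightarrow> complex" where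
  "hprod f g R = (\<Sum>L\<in>subreps Q R. f (cl (quot_rep Q R L)) * g (cl (sub_rep R L)))"

text \<open>
  The value at \<open>R\<close> of the antipode of a class function. The exponent \<open>Suc (card F)\<close> has the parity of
  the number of steps of \<open>F\<close>.
\<close>

definition hanti :: "('v, 'a) hall \<Rightarrow> ('v, 'a) rep \<Rightarrow> complex" where
  "hanti f R = (\<Sum>F\<in>flags R. (- 1) ^ Suc (card F) * f (cl (gr_rep R F)))"

lemma hprod_iso:
  assumes M: "M \<in> reps Q" and N: "N \<in> reps Q" and "rep_iso Q M N"
  shows "hprod f g M = hprod f g N"
proof -
  obtain h where h: "iso_via h M N" using assms(3) rep_iso_iff by blast
  have "cl (quot_rep Q M L) = cl (quot_rep Q N (push_sub h L))"
    "cl (sub_rep M L) = cl (sub_rep N (push_sub h L))" if L: "L \<in> subreps Q M" for L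
    using iso_class_eqI[OF quot_rep_reps[OF M L] quot_rep_reps[OF N push_sub_subreps[OF h L]] quot_rep_iso[OF h M L]]
      iso_class_eqI[OF sub_rep_reps[OF M L] sub_rep_reps[OF N push_sub_subreps[OF h L]] sub_rep_iso[OF h L]]
    by simp_all
  then have "hprod f g M = (\<Sum>L\<in>subreps Q M. f (cl (quot_rep Q N (push_sub h L)))
      * g (cl (sub_rep N (push_sub h L))))"
    unfolding hprod_def by (intro sum.cong) simp_all
  also have "\<dots> = hprod f g N"
    unfolding hprod_def by (rule sum.reindex_bij_betw[OF bij_push_sub[OF h M]])
  finally show ?thesis .
qed

lemma hanti_iso:
  assumes M: "M \<in> reps Q" and N: "N \<in> reps Q" and "rep_iso Q M N"
  shows "hanti f M = hanti f N"
proof -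
  obtain h where h: "iso_via h M N" using assms(3) rep_iso_iff by blast
  have inj: "inj_on (push_sub h) (subreps Q M)" using bij_push_sub[OF h M] by (simp add: bij_betw_def)
  have "cl (gr_rep M F) = cl (gr_rep N (push_sub h ` F)) \<and> card (push_sub h ` F) = card F"
    if "F \<in> flags M" for F
  proof -
    have F: "F \<subseteq> subreps Q M" using that by (simp add: flags_def sub_chains_def)
    show ?thesis
      using iso_class_eqI[OF gr_rep_reps[OF M] gr_rep_reps[OF N] gr_rep_iso[OF h M F]]
        card_image[OF inj_on_subset[OF inj F]] by simp
  qed
  then have "hanti f M = (\<Sum>F\<in>flags M. (- 1) ^ Suc (card (push_sub h ` F))
      * f (cl (gr_rep N (push_sub h ` F))))"
    unfolding hanti_def by (intro sum.cong) simp_all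
  also have "\<dots> = hanti f N"
    unfolding hanti_def by (rule sum.reindex_bij_betw[OF bij_push_flags[OF h M]])
  finally show ?thesis .
qed

text \<open>
  Both sides are sums over the pairs \<open>L \<le> K\<close> of subrepresentations of \<open>R\<close>, with factors belonging
  to \<open>R/K\<close>, \<open>K/L\<close> and \<open>L\<close>.
\<close>

lemma hprod_assoc:
  assumes R: "R \<in> reps Q"
  shows "(\<Sum>L\<in>subreps Q R. hprod f g (quot_rep Q R L) * k (cl (sub_rep R L)))
    = (\<Sum>L\<in>subreps Q R. f (cl (quot_rep Q R L)) * hprod g k (sub_rep R L))"
proof -
  let ?t = "\<lambda>L K. f (cl (quot_rep Q R K)) * g (cl (quot_rep Q (sub_rep R K) L))
    * k (cl (sub_rep R L))"
  have left: "hprod f g (quot_rep Q R L) * k (cl (sub_rep R L))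
      = (\<Sum>K | K \<in> subreps Q R \<and> sub_le L K. ?t L K)" if L: "L \<in> subreps Q R" for L
  proof -
    note RL = quot_rep_reps[OF R L]
    have "cl (quot_rep Q (quot_rep Q R L) K) = cl (quot_rep Q R (lift_sub L K))"
      "cl (sub_rep (quot_rep Q R L) K) = cl (quot_rep Q (sub_rep R (lift_sub L K)) L)"
      if K: "K \<in> subreps Q (quot_rep Q R L)" for K
    proof -
      note LK = lift_sub_subreps[OF R L K]
      have L': "L \<in> subreps Q (sub_rep R (lift_sub L K))"
        using subreps_sub_rep[OF R LK(1)] L LK(2) by simp
      show "cl (quot_rep Q (quot_rep Q R L) K) = cl (quot_rep Q R (lift_sub L K))"
        by (rule iso_class_eqI[OF quot_rep_reps[OF RL K] quot_rep_reps[OF R LK(1)] quot_quot_iso[OF L K]])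
      show "cl (sub_rep (quot_rep Q R L) K) = cl (quot_rep Q (sub_rep R (lift_sub L K)) L)"
        by (rule iso_class_eqI[OF sub_rep_reps[OF RL K]
              quot_rep_reps[OF sub_rep_reps[OF R LK(1)] L'] sub_quot_iso[OF L K]])
    qed
    then have "hprod f g (quot_rep Q R L) * k (cl (sub_rep R L))
        = (\<Sum>K\<in>subreps Q (quot_rep Q R L). ?t L (lift_sub L K))"
      unfolding hprod_def sum_distrib_right by (intro sum.cong) simp_all
    also have "\<dots> = (\<Sum>K | K \<in> subreps Q R \<and> sub_le L K. ?t L K)"
      by (rule sum.reindex_bij_betw[OF bij_lift_sub[OF R L], of "?t L"])
    finally show ?thesis .
  qed
  have right: "f (cl (quot_rep Q R K)) * hprod g k (sub_rep R K)
      = (\<Sum>L | L \<in> subreps Q R \<and> sub_le L K. ?t L K)" if K: "K \<in> subreps Q R" for K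
    unfolding hprod_def subreps_sub_rep[OF R K]
    by (simp add: sum_distrib_left mult.assoc) (simp add: sub_rep_def)
  show ?thesis
    using sum.swap_restrict[OF finite_subreps[OF R] finite_subreps[OF R], of ?t sub_le]
    by (simp add: left right)
qed

lemma hprod_one_left:
  assumes R: "R \<in> reps Q"
  shows "hprod (rep_basis Q zero_rep) f R = f (cl R)"
proof -
  have "hprod (rep_basis Q zero_rep) f R
      = (\<Sum>L\<in>subreps Q R. if L = top_sub R then f (cl (sub_rep R L)) else 0)"
    unfolding hprod_def
  proof (rule sum.cong[OF refl])
    fix L assume L: "L \<in> subreps Q R"
    show "rep_basis Q zero_rep (cl (quot_rep Q R L)) * f (cl (sub_rep R L))
        = (if L = top_sub R then f (cl (sub_rep R L)) else 0)"
      using quot_zero_iff[OF R L] iso_class_eq_iff[OF quot_rep_reps[OF R L] zero_rep_in_reps]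
      by (simp add: class_basis_def)
  qed
  also have "\<dots> = f (cl (sub_rep R (top_sub R)))"
    using finite_subreps[OF R] top_sub_subreps[OF R] by simp
  also have "cl (sub_rep R (top_sub R)) = cl R"
    by (rule iso_class_eqI[OF sub_rep_reps[OF R top_sub_subreps[OF R]] R sub_top_iso])
  finally show ?thesis .
qed

lemma hprod_one_right:
  assumes R: "R \<in> reps Q"
  shows "hprod f (rep_basis Q zero_rep) R = f (cl R)"
proof -
  have "hprod f (rep_basis Q zero_rep) R
      = (\<Sum>L\<in>subreps Q R. if L = bot_sub then f (cl (quot_rep Q R L)) else 0)"
    unfolding hprod_def
  proof (rule sum.cong[OF refl])
    fix L assume L: "L \<in> subreps Q R"
    show "f (cl (quot_rep Q R L)) * rep_basis Q zero_rep (cl (sub_rep R L))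
        = (if L = bot_sub then f (cl (quot_rep Q R L)) else 0)"
      using sub_zero_iff[OF R L] iso_class_eq_iff[OF sub_rep_reps[OF R L] zero_rep_in_reps]
      by (simp add: class_basis_def)
  qed
  also have "\<dots> = f (cl (quot_rep Q R bot_sub))"
    using finite_subreps[OF R] bot_sub_subreps[OF R] by simp
  also have "cl (quot_rep Q R bot_sub) = cl R"
    by (rule iso_class_eqI[OF quot_rep_reps[OF R bot_sub_subreps[OF R]] R quot_bot_iso[OF R]])
  finally show ?thesis .
qed

lemma hprod_dsum:
  assumes M: "M \<in> reps Q" and N: "N \<in> reps Q"
  shows "hprod f g (dsum M N) = (\<Sum>L\<in>subreps Q M. \<Sum>L'\<in>subreps Q N.
    f (cl (dsum (quot_rep Q M L) (quot_rep Q N L')))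
    * g (cl (dsum (sub_rep M L) (sub_rep N L'))))"
proof -
  let ?F = "\<lambda>L. f (cl (quot_rep Q (dsum M N) L)) * g (cl (sub_rep (dsum M N) L))"
  have "hprod f g (dsum M N) = (\<Sum>p\<in>subreps Q M \<times> subreps Q N. ?F (case p of (L, L') \<Rightarrow> pair_sub L L'))"
    unfolding hprod_def by (rule sum.reindex_bij_betw[OF bij_pair_sub[OF M N], symmetric])
  also have "\<dots> = (\<Sum>L\<in>subreps Q M. \<Sum>L'\<in>subreps Q N. ?F (pair_sub L L'))"
    by (subst sum.cartesian_product) (simp add: case_prod_beta)
  also have "\<dots> = (\<Sum>L\<in>subreps Q M. \<Sum>L'\<in>subreps Q N.
    f (cl (dsum (quot_rep Q M L) (quot_rep Q N L')))
    * g (cl (dsum (sub_rep M L) (sub_rep N L'))))"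
  proof (intro sum.cong refl)
    fix L L' assume L: "L \<in> subreps Q M" "L' \<in> subreps Q N"
    note MN = dsum_reps[OF M N] and P = pair_sub_subreps[OF M N L]
    have "cl (dsum (quot_rep Q M L) (quot_rep Q N L')) = cl (quot_rep Q (dsum M N) (pair_sub L L'))"
      by (rule iso_class_eqI[OF dsum_reps[OF quot_rep_reps[OF M L(1)] quot_rep_reps[OF N L(2)]]
            quot_rep_reps[OF MN P] quot_dsum_iso[OF M N L]])
    moreover have "cl (dsum (sub_rep M L) (sub_rep N L')) = cl (sub_rep (dsum M N) (pair_sub L L'))"
      by (rule iso_class_eqI[OF dsum_reps[OF sub_rep_reps[OF M L(1)] sub_rep_reps[OF N L(2)]]
            sub_rep_reps[OF MN P] sub_dsum_iso[OF M N L]])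
    ultimately show "?F (pair_sub L L') = f (cl (dsum (quot_rep Q M L) (quot_rep Q N L')))
      * g (cl (dsum (sub_rep M L) (sub_rep N L')))" by simp
  qed
  finally show ?thesis .
qed

subsection \<open>Cancellation of flags\<close>

text \<open>Inserting or deleting \<open>z\<close> is an involution that reverses the sign of the summands.\<close>

lemma sum_toggle_zero:
  fixes h :: "'b set \<Rightarrow> complex"
  assumes ins: "\<And>G. G \<in> T \<Longrightarrow> z \<notin> G \<Longrightarrow> insert z G \<in> T" and del: "\<And>G. G \<in> T \<Longrightarrow> z \<in> G \<Longrightarrow> G - {z} \<in> T"
    and sign: "\<And>G. G \<in> T \<Longrightarrow> z \<notin> G \<Longrightarrow> h (insert z G) = - h G"
  shows "sum h T = 0"
proof -
  let ?t = "\<lambda>G. if z \<in> G then G - {z} else insert z G"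
  have mem: "?t G \<in> T" if "G \<in> T" for G using ins del that by simp
  have val: "- h (?t G) = h G" if "G \<in> T" for G
    using sign[OF that] sign[of "G - {z}"] mem[OF that] by (auto simp: insert_absorb split: if_splits)
  have "sum h T = (\<Sum>G\<in>T. - h G)"
    by (rule sum.reindex_bij_witness[where i = ?t and j = ?t]) (use mem val in auto)
  then show ?thesis by (simp add: sum_negf)
qed

lemma sub_le_iff_le:
  assumes "K \<in> subreps Q R" "L \<in> subreps Q R"
  shows "sub_le K L \<longleftrightarrow> K \<le> L"
  using subrepsD(4)[OF assms(1)] subrepsD(4)[OF assms(2)]
  unfolding sub_le_def le_fun_def by (metis order_refl)

lemma chain_has_bounds:
  assumes R: "R \<in> reps Q" and G: "G \<in> sub_chains R" "G \<noteq> {}"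
  shows "\<exists>L\<in>G. \<forall>K\<in>G. sub_le L K" "\<exists>L\<in>G. \<forall>K\<in>G. sub_le K L"
proof -
  have fin: "finite G" and sub: "G \<subseteq> subreps Q R" and tot: "\<And>K L. K \<in> G \<Longrightarrow> L \<in> G \<Longrightarrow> sub_le K L \<or> sub_le L K"
    using sub_chains_finite[OF R G(1)] G(1) by (auto simp: sub_chains_def)
  obtain L where L: "L \<in> G" "\<forall>K\<in>G. K \<le> L \<longrightarrow> L = K" using finite_has_minimal[OF fin G(2)] by blast
  have "sub_le L K" if "K \<in> G" for K
    using tot[OF L(1) that] L that sub sub_le_iff_le sub_le_refl by (metis subsetD)
  then show "\<exists>L\<in>G. \<forall>K\<in>G. sub_le L K" using L by blast
  obtain L where L: "L \<in> G" "\<forall>K\<in>G. L \<le> K \<longrightarrow> L = K" using finite_has_maximal[OF fin G(2)] by blast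
  have "sub_le K L" if "K \<in> G" for K
    using tot[OF L(1) that] L that sub sub_le_iff_le sub_le_refl by (metis subsetD)
  then show "\<exists>L\<in>G. \<forall>K\<in>G. sub_le K L" using L by blast
qed

lemma top_eq_bot_iff:
  assumes R: "R \<in> reps Q"
  shows "top_sub R = bot_sub \<longleftrightarrow> cl R = cl zero_rep"
proof -
  have "top_sub R = bot_sub \<longleftrightarrow> (\<forall>v\<in>verts Q. top_sub R v = bot_sub v)"
    using subreps_eqI[OF top_sub_subreps[OF R] bot_sub_subreps[OF R]] by auto
  also have "\<dots> \<longleftrightarrow> (\<forall>v\<in>verts Q. car R v = {0})" by (simp add: top_sub_def bot_sub_def)
  finally show ?thesis
    using iso_zero_rep_iff[OF R] iso_class_eq_iff[OF R zero_rep_in_reps] by simp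
qed

text \<open>
  For \<open>R = 0\<close> the two ends coincide, there is nothing to toggle, and the chain with one member is the
  only one.
\<close>

lemma flag_cancellation_zero:
  fixes f :: "('v, 'a) hall"
  assumes R: "R \<in> reps Q" and eq: "top_sub R = bot_sub" and b: "b = bot_sub"
  shows "(\<Sum>G | G \<in> sub_chains R \<and> b \<in> G. (- 1) ^ Suc (card G) * f (cl (gr_rep R G)))
    = f (cl zero_rep)"
proof -
  have "L = bot_sub" if "L \<in> subreps Q R" for L
    using sub_le_antisym[OF that bot_sub_subreps[OF R]] le_top_sub[OF that] bot_sub_le[OF that] eq by simp
  then have "subreps Q R = {bot_sub}" using bot_sub_subreps[OF R] by blast
  then have "{G. G \<in> sub_chains R \<and> b \<in> G} = {{bot_sub}}"
    using b by (auto simp: sub_chains_def sub_le_refl)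
  moreover have "cl (gr_rep R {bot_sub}) = cl R"
    by (rule iso_class_eqI[OF gr_rep_reps[OF R] R], rule rep_iso_idI) (auto simp: bot_sub_def)
  ultimately show ?thesis using top_eq_bot_iff[OF R] eq by simp
qed

text \<open>The chains contain one end \<open>b\<close> of the lattice; the other end \<open>z\<close> is toggled.\<close>

lemma flag_cancellation:
  fixes f :: "('v, 'a) hall"
  assumes R: "R \<in> reps Q" and ne: "top_sub R \<noteq> bot_sub"
    and bz: "b = top_sub R \<and> z = bot_sub \<or> b = bot_sub \<and> z = top_sub R"
  shows "(\<Sum>G | G \<in> sub_chains R \<and> b \<in> G. (- 1) ^ Suc (card G) * f (cl (gr_rep R G))) = 0"
proof (rule sum_toggle_zero[where z = z])
  have z: "z \<in> subreps Q R" using bz bot_sub_subreps[OF R] top_sub_subreps[OF R] by auto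
  have zle: "sub_le z L \<or> sub_le L z" if "L \<in> subreps Q R" for L
    using bz bot_sub_le[OF that] le_top_sub[OF that] by auto
  fix G assume "G \<in> {G. G \<in> sub_chains R \<and> b \<in> G}"
  then have G: "G \<in> sub_chains R" "b \<in> G" by auto
  show "G - {z} \<in> {G. G \<in> sub_chains R \<and> b \<in> G}"
    using G bz ne by (auto simp: sub_chains_def)
  have G': "G \<subseteq> subreps Q R" "\<forall>K\<in>G. \<forall>L\<in>G. sub_le K L \<or> sub_le L K" using G by (auto simp: sub_chains_def)
  then have "\<forall>L\<in>G. sub_le z L \<or> sub_le L z" using zle by blast
  then show "insert z G \<in> {G. G \<in> sub_chains R \<and> b \<in> G}"
    using G(2) G' z sub_le_refl[of z] by (simp add: sub_chains_def disj_commute)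
  assume "z \<notin> G"
  then have "card (insert z G) = Suc (card G)" using sub_chains_finite[OF R G(1)] by simp
  moreover have "cl (gr_rep R (insert z G)) = cl (gr_rep R G)"
    using bz gr_rep_insert_bot[OF R] gr_rep_insert_top by (intro iso_class_eqI gr_rep_reps R) blast
  ultimately show "(- 1) ^ Suc (card (insert z G)) * f (cl (gr_rep R (insert z G)))
      = - ((- 1) ^ Suc (card G) * f (cl (gr_rep R G)))" by simp
qed

text \<open>Chains are sorted according to their least, or greatest, member.\<close>

lemma sum_chains_by_bound:
  assumes R: "R \<in> reps Q"
    and bound: "\<And>G. G \<in> sub_chains R \<Longrightarrow> b \<in> G \<Longrightarrow> \<exists>L\<in>G. \<forall>K\<in>G. r L K"
    and antisym: "\<And>K L. K \<in> subreps Q R \<Longrightarrow> L \<in> subreps Q R \<Longrightarrow> r K L \<Longrightarrow> r L K \<Longrightarrow> K = L"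
  shows "(\<Sum>L\<in>subreps Q R. \<Sum>G | G \<in> sub_chains R \<and> b \<in> G \<and> L \<in> G \<and> (\<forall>K\<in>G. r L K). h G)
    = (\<Sum>G | G \<in> sub_chains R \<and> b \<in> G. (h G :: complex))"
proof -
  let ?T = "\<lambda>L. {G. G \<in> sub_chains R \<and> b \<in> G \<and> L \<in> G \<and> (\<forall>K\<in>G. r L K)}"
  have "(\<Union>L\<in>subreps Q R. ?T L) = {G. G \<in> sub_chains R \<and> b \<in> G}"
  proof (intro equalityI subsetI)
    fix G assume "G \<in> {G. G \<in> sub_chains R \<and> b \<in> G}"
    then have G: "G \<in> sub_chains R" "b \<in> G" by auto
    obtain L where "L \<in> G" "\<forall>K\<in>G. r L K" using bound[OF G] by blast
    moreover have "L \<in> subreps Q R" using G \<open>L \<in> G\<close> by (auto simp: sub_chains_def)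
    ultimately show "G \<in> (\<Union>L\<in>subreps Q R. ?T L)" using G by blast
  qed blast
  moreover have "sum h (\<Union>L\<in>subreps Q R. ?T L) = (\<Sum>L\<in>subreps Q R. sum h (?T L))"
  proof (rule sum.UNION_disjoint[OF finite_subreps[OF R]])
    show "\<forall>L\<in>subreps Q R. finite (?T L)" using finite_sub_chains[OF R] by simp
    show "\<forall>L\<in>subreps Q R. \<forall>L'\<in>subreps Q R. L \<noteq> L' \<longrightarrow> ?T L \<inter> ?T L' = {}"
      using antisym by blast
  qed
  ultimately show ?thesis by simp
qed

text \<open>
  A flag of \<open>R/L\<close> is a chain in \<open>R\<close> with least member \<open>L\<close> and greatest member \<open>R\<close>, and the sum of
  its associated graded representation and \<open>L\<close> is the one of this chain. Summing over \<open>L\<close> gives all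
  chains that contain \<open>R\<close>.
\<close>

lemma hanti_left:
  fixes f :: "('v, 'a) hall"
  assumes R: "R \<in> reps Q"
  shows "(\<Sum>L\<in>subreps Q R. \<Sum>F\<in>flags (quot_rep Q R L).
      (- 1) ^ Suc (card F) * f (cl (dsum (gr_rep (quot_rep Q R L) F) (sub_rep R L))))
    = (if cl R = cl zero_rep then f (cl zero_rep) else 0)"
proof -
  let ?h = "\<lambda>G. (- 1) ^ Suc (card G) * f (cl (gr_rep R G))"
  have "(\<Sum>F\<in>flags (quot_rep Q R L).
      (- 1) ^ Suc (card F) * f (cl (dsum (gr_rep (quot_rep Q R L) F) (sub_rep R L))))
    = (\<Sum>G | G \<in> sub_chains R \<and> top_sub R \<in> G \<and> L \<in> G \<and> (\<forall>K\<in>G. sub_le L K). ?h G)"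
    if L: "L \<in> subreps Q R" for L
  proof -
    let ?S = "subreps Q (quot_rep Q R L)" and ?B = "{K \<in> subreps Q R. sub_le L K}"
    note RL = quot_rep_reps[OF R L] and bij = bij_lift_sub[OF R L]
    have inj: "inj_on (lift_sub L) ?S" using bij by (simp add: bij_betw_def)
    have "bij_betw ((`) (lift_sub L)) (flags (quot_rep Q R L))
      {G \<in> {F \<in> Pow ?B. \<forall>K\<in>F. \<forall>L\<in>F. sub_le K L \<or> sub_le L K}. L \<in> G \<and> top_sub R \<in> G}"
      unfolding flags_def
    proof (rule bij_betw_Collect)
      show "bij_betw ((`) (lift_sub L)) (sub_chains (quot_rep Q R L))
        {F \<in> Pow ?B. \<forall>K\<in>F. \<forall>L\<in>F. sub_le K L \<or> sub_le L K}"
        unfolding sub_chains_def by (rule bij_image_chains[OF bij]) (rule lift_sub_le[OF L])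
      fix F assume "F \<in> sub_chains (quot_rep Q R L)"
      then have F: "F \<subseteq> ?S" by (simp add: sub_chains_def)
      have "lift_sub L bot_sub \<in> lift_sub L ` F \<longleftrightarrow> bot_sub \<in> F"
        "lift_sub L (top_sub (quot_rep Q R L)) \<in> lift_sub L ` F \<longleftrightarrow> top_sub (quot_rep Q R L) \<in> F"
        using inj_on_image_mem_iff[OF inj _ F] bot_sub_subreps[OF RL] top_sub_subreps[OF RL] by blast+
      then show "(L \<in> lift_sub L ` F \<and> top_sub R \<in> lift_sub L ` F)
          = (bot_sub \<in> F \<and> top_sub (quot_rep Q R L) \<in> F)"
        using lift_sub_bot_top[OF R L] by simp
    qed
    moreover have "{G \<in> {F \<in> Pow ?B. \<forall>K\<in>F. \<forall>L\<in>F. sub_le K L \<or> sub_le L K}. L \<in> G \<and> top_sub R \<in> G}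
      = {G. G \<in> sub_chains R \<and> top_sub R \<in> G \<and> L \<in> G \<and> (\<forall>K\<in>G. sub_le L K)}"
      unfolding sub_chains_def by auto
    ultimately have b: "bij_betw ((`) (lift_sub L)) (flags (quot_rep Q R L))
        {G. G \<in> sub_chains R \<and> top_sub R \<in> G \<and> L \<in> G \<and> (\<forall>K\<in>G. sub_le L K)}" by simp
    have "(- 1) ^ Suc (card F) * f (cl (dsum (gr_rep (quot_rep Q R L) F) (sub_rep R L)))
        = ?h (lift_sub L ` F)" if "F \<in> flags (quot_rep Q R L)" for F
    proof -
      have F: "bot_sub \<in> F" "F \<subseteq> ?S" using that by (auto simp: flags_def sub_chains_def)
      have "cl (dsum (gr_rep (quot_rep Q R L) F) (sub_rep R L)) = cl (gr_rep R (lift_sub L ` F))"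
        by (rule iso_class_eqI[OF dsum_reps[OF gr_rep_reps[OF RL] sub_rep_reps[OF R L]] gr_rep_reps[OF R]
              gr_rep_quot[OF R L F]])
      then show ?thesis using card_image[OF inj_on_subset[OF inj F(2)]] by simp
    qed
    then show ?thesis
      using sum.reindex_bij_betw[OF b, of ?h] by simp
  qed
  then have "(\<Sum>L\<in>subreps Q R. \<Sum>F\<in>flags (quot_rep Q R L).
      (- 1) ^ Suc (card F) * f (cl (dsum (gr_rep (quot_rep Q R L) F) (sub_rep R L))))
    = (\<Sum>L\<in>subreps Q R. \<Sum>G | G \<in> sub_chains R \<and> top_sub R \<in> G \<and> L \<in> G \<and> (\<forall>K\<in>G. sub_le L K). ?h G)"
    by (rule sum.cong[OF refl])
  also have "\<dots> = (\<Sum>G | G \<in> sub_chains R \<and> top_sub R \<in> G. ?h G)"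
  proof (rule sum_chains_by_bound[OF R])
    fix G assume "G \<in> sub_chains R" "top_sub R \<in> G"
    then show "\<exists>L\<in>G. \<forall>K\<in>G. sub_le L K" by (intro chain_has_bounds(1)[OF R]) auto
  qed (rule sub_le_antisym)
  also have "\<dots> = (if top_sub R = bot_sub then f (cl zero_rep) else 0)"
    using flag_cancellation_zero[OF R, of "top_sub R" f] flag_cancellation[OF R, of "top_sub R" bot_sub f]
    by simp
  finally show ?thesis by (simp add: top_eq_bot_iff[OF R])
qed

text \<open>Dually, a flag of \<open>L\<close> is a chain in \<open>R\<close> with least member \<open>0\<close> and greatest member \<open>L\<close>.\<close>

lemma hanti_right:
  fixes f :: "('v, 'a) hall"
  assumes R: "R \<in> reps Q"
  shows "(\<Sum>L\<in>subreps Q R. \<Sum>F\<in>flags (sub_rep R L).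
      (- 1) ^ Suc (card F) * f (cl (dsum (quot_rep Q R L) (gr_rep (sub_rep R L) F))))
    = (if cl R = cl zero_rep then f (cl zero_rep) else 0)"
proof -
  let ?h = "\<lambda>G. (- 1) ^ Suc (card G) * f (cl (gr_rep R G))"
  have "(\<Sum>F\<in>flags (sub_rep R L).
      (- 1) ^ Suc (card F) * f (cl (dsum (quot_rep Q R L) (gr_rep (sub_rep R L) F))))
    = (\<Sum>G | G \<in> sub_chains R \<and> bot_sub \<in> G \<and> L \<in> G \<and> (\<forall>K\<in>G. sub_le K L). ?h G)"
    if L: "L \<in> subreps Q R" for L
  proof (rule sum.cong)
    have top: "top_sub (sub_rep R L) = L"
      using subrepsD(4)[OF L] by (auto simp: top_sub_def fun_eq_iff)
    show "flags (sub_rep R L) = {G. G \<in> sub_chains R \<and> bot_sub \<in> G \<and> L \<in> G \<and> (\<forall>K\<in>G. sub_le K L)}"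
      unfolding flags_def sub_chains_def subreps_sub_rep[OF R L] top by auto
    fix F assume "F \<in> {G. G \<in> sub_chains R \<and> bot_sub \<in> G \<and> L \<in> G \<and> (\<forall>K\<in>G. sub_le K L)}"
    then have F: "L \<in> F" "F \<subseteq> subreps Q (sub_rep R L)"
      unfolding subreps_sub_rep[OF R L] by (auto simp: sub_chains_def)
    have "cl (dsum (quot_rep Q R L) (gr_rep (sub_rep R L) F)) = cl (gr_rep R F)"
      by (rule iso_class_eqI[OF dsum_reps[OF quot_rep_reps[OF R L] gr_rep_reps[OF sub_rep_reps[OF R L]]]
            gr_rep_reps[OF R] gr_rep_sub[OF R L F]])
    then show "(- 1) ^ Suc (card F) * f (cl (dsum (quot_rep Q R L) (gr_rep (sub_rep R L) F))) = ?h F"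
      by simp
  qed
  then have "(\<Sum>L\<in>subreps Q R. \<Sum>F\<in>flags (sub_rep R L).
      (- 1) ^ Suc (card F) * f (cl (dsum (quot_rep Q R L) (gr_rep (sub_rep R L) F))))
    = (\<Sum>L\<in>subreps Q R. \<Sum>G | G \<in> sub_chains R \<and> bot_sub \<in> G \<and> L \<in> G \<and> (\<forall>K\<in>G. sub_le K L). ?h G)"
    by (rule sum.cong[OF refl])
  also have "\<dots> = (\<Sum>G | G \<in> sub_chains R \<and> bot_sub \<in> G. ?h G)"
  proof (rule sum_chains_by_bound[OF R, where r = "\<lambda>L K. sub_le K L"])
    fix G assume "G \<in> sub_chains R" "bot_sub \<in> G"
    then show "\<exists>L\<in>G. \<forall>K\<in>G. sub_le K L" by (intro chain_has_bounds(2)[OF R]) auto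
  qed (rule sub_le_antisym)
  also have "\<dots> = (if top_sub R = bot_sub then f (cl zero_rep) else 0)"
    using flag_cancellation_zero[OF R, of bot_sub f] flag_cancellation[OF R, of bot_sub "top_sub R" f]
    by simp
  finally show ?thesis by (simp add: top_eq_bot_iff[OF R])
qed

end


section \<open>Hereditary additive classes of representations\<close>

text \<open>The closure properties on which the Hopf algebra structure depends.\<close>

locale hall_class = quiver Q for Q :: "('v, 'a) pre_digraph" +
  fixes C :: "('v, 'a) rep set"
  assumes C_reps: "C \<subseteq> reps Q"
    and C_emb: "M \<in> reps Q \<Longrightarrow> N \<in> C \<Longrightarrow> rep_emb M N \<Longrightarrow> M \<in> C"
    and C_dsum: "M \<in> C \<Longrightarrow> N \<in> C \<Longrightarrow> dsum M N \<in> C"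
    and C_zero: "zero_rep \<in> C"
begin

abbreviation cls :: "('v, 'a) rep set set" where
  "cls \<equiv> cl ` C"

lemma C_repsD: "M \<in> C \<Longrightarrow> M \<in> reps Q"
  using C_reps by blast

lemma C_sub: "R \<in> C \<Longrightarrow> L \<in> subreps Q R \<Longrightarrow> sub_rep R L \<in> C"
  using sub_rep_reps sub_rep_emb C_emb C_repsD by blast

lemma C_quot: "R \<in> C \<Longrightarrow> L \<in> subreps Q R \<Longrightarrow> quot_rep Q R L \<in> C"
  using quot_rep_reps quot_rep_emb C_emb C_repsD by blast

lemma C_gr: "R \<in> C \<Longrightarrow> gr_rep R F \<in> C"
  using gr_rep_reps gr_rep_emb C_emb C_repsD by blast

lemma C_iso:
  assumes "M \<in> reps Q" "cl M \<in> cls"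
  shows "M \<in> C"
proof -
  obtain N where N: "N \<in> C" "cl M = cl N" using assms(2) by blast
  then have "rep_iso Q M N" using iso_class_eq_iff[OF assms(1) C_repsD[OF N(1)]] by simp
  then show ?thesis using C_emb[OF assms(1) N(1)] rep_iso_emb[OF assms(1)] by blast
qed

lemma rep_of_cls:
  assumes "U \<in> cls"
  shows "rep_of U \<in> C" "cl (rep_of U) = U"
proof -
  obtain M where M: "M \<in> C" "U = cl M" using assms by blast
  show "cl (rep_of U) = U" using M iso_class_rep_of C_repsD by simp
  then show "rep_of U \<in> C" using M rep_of_iso_class(1)[OF C_repsD[OF M(1)]] assms C_iso by simp
qed

text \<open>
  Finite supports amount to bounded dimensions, which is how products and antipodes are seen to
  have finite support.
\<close>

lemma finite_dim_le_cls: "finite {U \<in> cls. dim_le n (rep_of U)}"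
proof (rule finite_subset[OF _ finite_dim_le_classes])
  show "{U \<in> cls. dim_le n (rep_of U)} \<subseteq> cl ` {M \<in> reps Q. dim_le n M}"
  proof
    fix U assume "U \<in> {U \<in> cls. dim_le n (rep_of U)}"
    then show "U \<in> cl ` {M \<in> reps Q. dim_le n M}"
      using rep_of_cls C_repsD by (intro image_eqI[where x = "rep_of U"]) auto
  qed
qed

definition fin_fun :: "('v, 'a) hall \<Rightarrow> bool" where
  "fin_fun f \<longleftrightarrow> finite {U. f U \<noteq> 0} \<and> {U. f U \<noteq> 0} \<subseteq> cls"

lemma fin_fun_dim:
  assumes "fin_fun f"
  obtains n where "\<And>M. M \<in> reps Q \<Longrightarrow> f (cl M) \<noteq> 0 \<Longrightarrow> dim_le n M"
proof -
  have "{U. f U \<noteq> 0} \<subseteq> cl ` reps Q" using assms C_reps unfolding fin_fun_def by blast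
  then obtain n where "\<And>M. M \<in> reps Q \<Longrightarrow> cl M \<in> {U. f U \<noteq> 0} \<Longrightarrow> dim_le n M"
    using dim_le_exists assms unfolding fin_fun_def by metis
  then show thesis using that by blast
qed

lemma fin_funI:
  assumes "\<And>U. f U \<noteq> 0 \<Longrightarrow> U \<in> cls \<and> dim_le n (rep_of U)"
  shows "fin_fun f"
  unfolding fin_fun_def using assms finite_subset[OF _ finite_dim_le_cls[of n], of "{U. f U \<noteq> 0}"]
  by blast

definition hprod_fun :: "('v, 'a) hall \<Rightarrow> ('v, 'a) hall \<Rightarrow> ('v, 'a) hall" where
  "hprod_fun f g U = (if U \<in> cls then hprod f g (rep_of U) else 0)"

definition hanti_fun :: "('v, 'a) hall \<Rightarrow> ('v, 'a) hall" where
  "hanti_fun f U = (if U \<in> cls then hanti f (rep_of U) else 0)"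

lemma hprod_fun: "M \<in> C \<Longrightarrow> hprod_fun f g (cl M) = hprod f g M"
  using hprod_iso[OF C_repsD rep_of_iso_class(1)[OF C_repsD] rep_of_iso_class(2)[OF C_repsD]]
  by (simp add: hprod_fun_def)

lemma hanti_fun: "M \<in> C \<Longrightarrow> hanti_fun f (cl M) = hanti f M"
  using hanti_iso[OF C_repsD rep_of_iso_class(1)[OF C_repsD] rep_of_iso_class(2)[OF C_repsD]]
  by (simp add: hanti_fun_def)

lemma fin_fun_hprod:
  assumes f: "fin_fun f" and g: "fin_fun g"
  shows "fin_fun (hprod_fun f g)"
proof -
  obtain m where m: "\<And>M. M \<in> reps Q \<Longrightarrow> f (cl M) \<noteq> 0 \<Longrightarrow> dim_le m M"
    using fin_fun_dim[OF f] by blast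
  obtain n where n: "\<And>M. M \<in> reps Q \<Longrightarrow> g (cl M) \<noteq> 0 \<Longrightarrow> dim_le n M"
    using fin_fun_dim[OF g] by blast
  show ?thesis
  proof (rule fin_funI[where n = "m + n"])
    fix U assume ne: "hprod_fun f g U \<noteq> 0"
    then have U: "U \<in> cls" "hprod f g (rep_of U) \<noteq> 0" by (auto simp: hprod_fun_def split: if_splits)
    have R: "rep_of U \<in> reps Q" using rep_of_cls(1)[OF U(1)] C_repsD by blast
    obtain L where L: "L \<in> subreps Q (rep_of U)" "f (cl (quot_rep Q (rep_of U) L)) \<noteq> 0"
      "g (cl (sub_rep (rep_of U) L)) \<noteq> 0"
      using U(2) unfolding hprod_def by (metis (mono_tags, lifting) mult_eq_0_iff sum.neutral)
    show "U \<in> cls \<and> dim_le (m + n) (rep_of U)"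
      using dim_le_extension[OF R L(1) m[OF quot_rep_reps[OF R L(1)] L(2)] n[OF sub_rep_reps[OF R L(1)] L(3)]]
        U(1) by blast
  qed
qed

lemma fin_fun_hanti:
  assumes f: "fin_fun f"
  shows "fin_fun (hanti_fun f)"
proof -
  obtain n where n: "\<And>M. M \<in> reps Q \<Longrightarrow> f (cl M) \<noteq> 0 \<Longrightarrow> dim_le n M"
    using fin_fun_dim[OF f] by blast
  show ?thesis
  proof (rule fin_funI[where n = n])
    fix U assume ne: "hanti_fun f U \<noteq> 0"
    then have U: "U \<in> cls" "hanti f (rep_of U) \<noteq> 0" by (auto simp: hanti_fun_def split: if_splits)
    have R: "rep_of U \<in> reps Q" using rep_of_cls(1)[OF U(1)] C_repsD by blast
    obtain F where F: "f (cl (gr_rep (rep_of U) F)) \<noteq> 0"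
      using U(2) unfolding hanti_def by (metis (mono_tags, lifting) mult_eq_0_iff sum.neutral)
    show "U \<in> cls \<and> dim_le n (rep_of U)"
      using n[OF gr_rep_reps[OF R] F] U(1) dim_le_gr_rep by blast
  qed
qed

lemma class_basis_fin: "U \<in> cls \<Longrightarrow> fin_fun (class_basis U)"
  by (simp add: fin_fun_def class_basis_def)

end


section \<open>Hopf algebras with Hall coordinates\<close>

text \<open>
  In coordinates the structure is the one of the Hall algebra of \<open>C\<close>. For the Hall algebra \<open>crd\<close> is
  the identity; for a quotient it restricts functions to a smaller class.
\<close>

locale hall_coords = hall_class Q C + coord_space H crd "iso_class Q ` C"
  for Q :: "('v, 'a) pre_digraph" and C :: "('v, 'a) rep set"
    and H :: "'h hopf" (structure) and crd :: "'h \<Rightarrow> ('v, 'a) hall" +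
  assumes mult_in: "x \<in> carrier H \<Longrightarrow> y \<in> carrier H \<Longrightarrow> x \<otimes> y \<in> carrier H"
    and crd_mult: "x \<in> carrier H \<Longrightarrow> y \<in> carrier H \<Longrightarrow> M \<in> C \<Longrightarrow>
      crd (x \<otimes> y) (cl M) = hprod (crd x) (crd y) M"
    and one_in: "\<one> \<in> carrier H"
    and crd_one: "crd \<one> = rep_basis Q zero_rep"
    and comult_keys: "x \<in> carrier H \<Longrightarrow> Poly_Mapping.keys (comult H x) \<subseteq> carrier H \<times> carrier H"
    and comult_pairing: "x \<in> carrier H \<Longrightarrow> M \<in> C \<Longrightarrow> N \<in> C \<Longrightarrow>
      pairing (comult H x) (\<lambda>(a, b). crd a (cl M) * crd b (cl N))
        = crd x (cl (dsum M N))"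
    and counit_crd: "x \<in> carrier H \<Longrightarrow> counit H x = crd x (cl zero_rep)"
begin

lemma class_eqI:
  assumes "x \<in> carrier H" "y \<in> carrier H" "\<And>M. M \<in> C \<Longrightarrow> crd x (cl M) = crd y (cl M)"
  shows "x = y"
  by (rule crd_eqI[OF assms(1,2)]) (use assms(3) in blast)

lemma crd_dsum_assoc:
  assumes "M \<in> C" "N \<in> C" "P \<in> C"
  shows "cl (dsum (dsum M N) P) = cl (dsum M (dsum N P))"
  by (intro iso_class_eqI dsum_assoc dsum_reps) (use assms C_repsD in auto)

lemma crd_mult_expand:
  assumes "x \<in> carrier H" "y \<in> carrier H" "M \<in> C"
  shows "crd (x \<otimes> y) (cl M)
    = (\<Sum>L\<in>subreps Q M. crd x (cl (quot_rep Q M L)) * crd y (cl (sub_rep M L)))"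
  using crd_mult[OF assms] by (simp add: hprod_def)

lemma ring: "ring H"
proof (rule ringI[OF abelian_group])
  show "Group.monoid H"
  proof (rule monoidI)
    fix x y z assume c: "x \<in> carrier H" "y \<in> carrier H" "z \<in> carrier H"
    show "(x \<otimes> y) \<otimes> z = x \<otimes> (y \<otimes> z)"
    proof (rule class_eqI)
      fix M assume M: "M \<in> C"
      have "crd ((x \<otimes> y) \<otimes> z) (cl M)
          = (\<Sum>L\<in>subreps Q M. hprod (crd x) (crd y) (quot_rep Q M L) * crd z (cl (sub_rep M L)))"
        unfolding crd_mult_expand[OF mult_in[OF c(1,2)] c(3) M]
        using c M by (intro sum.cong refl) (simp add: crd_mult C_quot)
      also have "\<dots> = (\<Sum>L\<in>subreps Q M. crd x (cl (quot_rep Q M L)) * hprod (crd y) (crd z) (sub_rep M L))"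
        by (rule hprod_assoc[OF C_repsD[OF M]])
      also have "\<dots> = crd (x \<otimes> (y \<otimes> z)) (cl M)"
        unfolding crd_mult_expand[OF c(1) mult_in[OF c(2,3)] M]
        using c M by (intro sum.cong refl) (simp add: crd_mult C_sub)
      finally show "crd ((x \<otimes> y) \<otimes> z) (cl M) = crd (x \<otimes> (y \<otimes> z)) (cl M)" .
    qed (use c mult_in in auto)
  next
    fix x assume c: "x \<in> carrier H"
    show "\<one> \<otimes> x = x"
      by (rule class_eqI) (use c in \<open>auto simp: mult_in one_in crd_mult crd_one hprod_one_left C_repsD\<close>)
    show "x \<otimes> \<one> = x"
      by (rule class_eqI) (use c in \<open>auto simp: mult_in one_in crd_mult crd_one hprod_one_right C_repsD\<close>)
  qed (auto simp: mult_in one_in)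
next
  fix x y z assume c: "x \<in> carrier H" "y \<in> carrier H" "z \<in> carrier H"
  show "(x \<oplus> y) \<otimes> z = x \<otimes> z \<oplus> y \<otimes> z"
    by (rule class_eqI) (use c in \<open>auto simp: mult_in add_in crd_add crd_mult hprod_def distrib_right sum.distrib\<close>)
  show "z \<otimes> (x \<oplus> y) = z \<otimes> x \<oplus> z \<otimes> y"
    by (rule class_eqI) (use c in \<open>auto simp: mult_in add_in crd_add crd_mult hprod_def distrib_left sum.distrib\<close>)
qed

lemma comult_pairing':
  assumes "x \<in> carrier H" "M \<in> C" "N \<in> C"
  shows "pairing (comult H x) (\<lambda>k. crd (fst k) (cl M) * crd (snd k) (cl N))
    = crd x (cl (dsum M N))"
  using comult_pairing[OF assms] by (simp add: case_prod_beta')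

lemma hprod_zero_rep: "hprod f g zero_rep = f (cl zero_rep) * g (cl zero_rep)"
proof -
  note Z = zero_rep_in_reps
  have top: "top_sub zero_rep = bot_sub" using top_eq_bot_iff[OF Z] by simp
  have bot: "bot_sub \<in> subreps Q zero_rep" by (rule bot_sub_subreps[OF Z])
  have "L = bot_sub" if "L \<in> subreps Q zero_rep" for L
    using sub_le_antisym[OF that bot] le_top_sub[OF that] bot_sub_le[OF that] top by simp
  then have "subreps Q zero_rep = {bot_sub}" using bot by blast
  moreover have "cl (quot_rep Q zero_rep bot_sub) = cl zero_rep"
    by (rule iso_class_eqI[OF quot_rep_reps[OF Z bot] Z quot_bot_iso[OF Z]])
  moreover have "cl (sub_rep zero_rep bot_sub) = cl zero_rep"
    using sub_top_iso[of zero_rep] top by (intro iso_class_eqI sub_rep_reps Z bot) simp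
  ultimately show ?thesis by (simp add: hprod_def)
qed

lemma dsum_zero_iff:
  assumes "M \<in> C" "N \<in> C"
  shows "cl (dsum M N) = cl zero_rep
    \<longleftrightarrow> cl M = cl zero_rep \<and> cl N = cl zero_rep"
proof -
  note r = C_repsD[OF assms(1)] C_repsD[OF assms(2)]
  have "car (dsum M N) v = {0} \<longleftrightarrow> car M v = {0} \<and> car N v = {0}" if v: "v \<in> verts Q" for v
  proof
    assume *: "car (dsum M N) v = {0}"
    have "x = 0" if "x \<in> car M v" for x
    proof -
      have "2 * x \<in> car (dsum M N) v" using that by (simp add: car_dsum)
      then have "2 * x = 0" using * by blast
      then show ?thesis by presburger
    qed
    moreover have "y = 0" if "y \<in> car N v" for y
    proof -
      have "2 * y - 1 \<in> car (dsum M N) v" using that by (simp add: car_dsum)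
      then have "2 * y - 1 = 0" using * by blast
      then show ?thesis by presburger
    qed
    ultimately show "car M v = {0} \<and> car N v = {0}"
      using reps_zero[OF r(1) v] reps_zero[OF r(2) v] by blast
  qed (simp add: car_dsum)
  then show ?thesis
    using r dsum_reps[OF r] iso_zero_rep_iff
    by (simp add: iso_class_eq_iff zero_rep_in_reps) blast
qed

subsection \<open>The bialgebra axioms\<close>

lemma keys_tensor_mult:
  assumes "Poly_Mapping.keys s \<subseteq> carrier H \<times> carrier H" "Poly_Mapping.keys t \<subseteq> carrier H \<times> carrier H"
  shows "Poly_Mapping.keys (tensor_mult H s t) \<subseteq> carrier H \<times> carrier H"
  unfolding tensor_mult_def
proof (rule keys_formal_ext, clarify)
  fix a b p q
  assume ab: "(a, b) \<in> Poly_Mapping.keys s"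
    and pq: "(p, q) \<in> Poly_Mapping.keys (formal_ext (\<lambda>(c, d). pure (a \<otimes> c, b \<otimes> d)) t)"
  have "Poly_Mapping.keys (formal_ext (\<lambda>(c, d). pure (a \<otimes> c, b \<otimes> d)) t) \<subseteq> carrier H \<times> carrier H"
    by (rule keys_formal_ext) (use ab assms mult_in in fastforce)
  then show "p \<in> carrier H \<and> q \<in> carrier H" using pq by blast
qed

text \<open>
  At \<open>(M, N)\<close> both sides are the sum over pairs of subrepresentations of \<open>M\<close> and \<open>N\<close>, the left one
  because these pairs are the subrepresentations of \<open>M \<oplus> N\<close>.
\<close>

lemma comult_multiplicative:
  assumes x: "x \<in> carrier H" and y: "y \<in> carrier H"
  shows "tensor2_eq H (comult H (x \<otimes> y)) (tensor_mult H (comult H x) (comult H y))"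
proof (rule tensor2_eqI)
  show "Poly_Mapping.keys (comult H (x \<otimes> y)) \<subseteq> carrier H \<times> carrier H"
    using comult_keys mult_in x y by blast
  show "Poly_Mapping.keys (tensor_mult H (comult H x) (comult H y)) \<subseteq> carrier H \<times> carrier H"
    by (rule keys_tensor_mult) (use comult_keys x y in auto)
  fix U W assume "U \<in> cls" "W \<in> cls"
  then obtain M N where M: "M \<in> C" "U = cl M" and N: "N \<in> C" "W = cl N" by blast
  let ?g = "\<lambda>(a, b). crd a U * crd b W"
  let ?q = "\<lambda>R L. cl (quot_rep Q R L)" and ?s = "\<lambda>R L. cl (sub_rep R L)"
  have inner: "pairing (comult H y) (\<lambda>k. ?g (fst l \<otimes> fst k, snd l \<otimes> snd k))
      = (\<Sum>L\<in>subreps Q M. \<Sum>L'\<in>subreps Q N. crd y (cl (dsum (sub_rep M L) (sub_rep N L')))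
        * (crd (fst l) (?q M L) * crd (snd l) (?q N L')))"
    if l: "l \<in> Poly_Mapping.keys (comult H x)" for l
  proof -
    have lc: "fst l \<in> carrier H" "snd l \<in> carrier H" using l comult_keys[OF x] by auto
    have "pairing (comult H y) (\<lambda>k. ?g (fst l \<otimes> fst k, snd l \<otimes> snd k))
      = pairing (comult H y) (\<lambda>k. \<Sum>L\<in>subreps Q M. \<Sum>L'\<in>subreps Q N.
        (crd (fst l) (?q M L) * crd (snd l) (?q N L')) * (crd (fst k) (?s M L) * crd (snd k) (?s N L')))"
    proof (rule pairing_cong)
      fix k assume "k \<in> Poly_Mapping.keys (comult H y)"
      then have "fst k \<in> carrier H" "snd k \<in> carrier H" using comult_keys[OF y] by auto
      then show "?g (fst l \<otimes> fst k, snd l \<otimes> snd k) = (\<Sum>L\<in>subreps Q M. \<Sum>L'\<in>subreps Q N.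
        (crd (fst l) (?q M L) * crd (snd l) (?q N L')) * (crd (fst k) (?s M L) * crd (snd k) (?s N L')))"
        using lc M N by (simp add: crd_mult_expand sum_product mult_ac)
    qed
    also have "\<dots> = (\<Sum>L\<in>subreps Q M. \<Sum>L'\<in>subreps Q N.
        (crd (fst l) (?q M L) * crd (snd l) (?q N L')) * crd y (cl (dsum (sub_rep M L) (sub_rep N L'))))"
      unfolding pairing_sum_right pairing_cmult_right
      using M N by (intro sum.cong refl) (simp add: comult_pairing'[OF y] C_sub)
    finally show ?thesis by (simp add: mult.commute)
  qed
  have "pairing (tensor_mult H (comult H x) (comult H y)) ?g
      = pairing (comult H x) (\<lambda>l. pairing (comult H y) (\<lambda>k. ?g (fst l \<otimes> fst k, snd l \<otimes> snd k)))"
    unfolding tensor_mult_def by (simp add: pairing_formal_ext case_prod_beta')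
  also have "\<dots> = pairing (comult H x) (\<lambda>l. \<Sum>L\<in>subreps Q M. \<Sum>L'\<in>subreps Q N.
      crd y (cl (dsum (sub_rep M L) (sub_rep N L'))) * (crd (fst l) (?q M L) * crd (snd l) (?q N L')))"
    by (rule pairing_cong) (rule inner)
  also have "\<dots> = (\<Sum>L\<in>subreps Q M. \<Sum>L'\<in>subreps Q N. crd y (cl (dsum (sub_rep M L) (sub_rep N L')))
      * crd x (cl (dsum (quot_rep Q M L) (quot_rep Q N L'))))"
    unfolding pairing_sum_right pairing_cmult_right
    using M N by (intro sum.cong refl) (simp add: comult_pairing'[OF x] C_quot)
  also have "\<dots> = hprod (crd x) (crd y) (dsum M N)"
    unfolding hprod_dsum[OF C_repsD[OF M(1)] C_repsD[OF N(1)]] by (simp add: mult.commute)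
  also have "\<dots> = pairing (comult H (x \<otimes> y)) ?g"
    using comult_pairing[OF mult_in[OF x y] M(1) N(1)] crd_mult[OF x y C_dsum[OF M(1) N(1)]] M N by simp
  finally show "pairing (comult H (x \<otimes> y)) ?g = pairing (tensor_mult H (comult H x) (comult H y)) ?g" by simp
qed

text \<open>Both sides evaluate \<open>x\<close> at a sum of three representations.\<close>

lemma coassociative:
  assumes x: "x \<in> carrier H"
  shows "tensor3_eq H (comult_id H (comult H x)) (id_comult H (comult H x))"
proof (rule tensor3_eqI)
  have c: "fst k \<in> carrier H \<and> snd k \<in> carrier H" if "k \<in> Poly_Mapping.keys (comult H y)" "y \<in> carrier H" for k y
    using comult_keys[OF that(2)] that(1) by auto
  show "Poly_Mapping.keys (comult_id H (comult H x)) \<subseteq> carrier H \<times> carrier H \<times> carrier H"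
    unfolding comult_id_def case_prod_beta'
    by (intro keys_formal_ext) (use c x in auto)
  show "Poly_Mapping.keys (id_comult H (comult H x)) \<subseteq> carrier H \<times> carrier H \<times> carrier H"
    unfolding id_comult_def case_prod_beta'
    by (intro keys_formal_ext) (use c x in auto)
  fix U W Z assume "U \<in> cls" "W \<in> cls" "Z \<in> cls"
  then obtain M N P where M: "M \<in> C" "U = cl M" and N: "N \<in> C" "W = cl N"
    and P: "P \<in> C" "Z = cl P" by blast
  let ?g = "\<lambda>(a, b, c). crd a U * crd b W * crd c Z"
  have "pairing (comult_id H (comult H x)) ?g
      = pairing (comult H x) (\<lambda>k. pairing (comult H (fst k)) (\<lambda>l. crd (snd k) Z * (crd (fst l) U * crd (snd l) W)))"
    unfolding comult_id_def by (simp add: pairing_formal_ext case_prod_beta' mult_ac)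
  also have "\<dots> = pairing (comult H x) (\<lambda>k. crd (fst k) (cl (dsum M N)) * crd (snd k) Z)"
    by (rule pairing_cong) (use c x M N in \<open>simp add: pairing_cmult_right comult_pairing'\<close>)
  also have "\<dots> = crd x (cl (dsum (dsum M N) P))"
    using comult_pairing'[OF x C_dsum[OF M(1) N(1)] P(1)] P by simp
  also have "\<dots> = crd x (cl (dsum M (dsum N P)))"
    using crd_dsum_assoc M N P by simp
  also have "\<dots> = pairing (comult H x) (\<lambda>k. crd (fst k) U * crd (snd k) (cl (dsum N P)))"
    using comult_pairing'[OF x M(1) C_dsum[OF N(1) P(1)]] M by simp
  also have "\<dots> = pairing (comult H x) (\<lambda>k. pairing (comult H (snd k)) (\<lambda>l. crd (fst k) U * (crd (fst l) W * crd (snd l) Z)))"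
    by (rule pairing_cong) (use c x P N in \<open>simp add: pairing_cmult_right comult_pairing'\<close>)
  also have "\<dots> = pairing (id_comult H (comult H x)) ?g"
    unfolding id_comult_def by (simp add: pairing_formal_ext case_prod_beta' mult_ac)
  finally show "pairing (comult_id H (comult H x)) ?g = pairing (id_comult H (comult H x)) ?g" .
qed

lemma comult_unit: "tensor2_eq H (comult H \<one>) (pure (\<one>, \<one>))"
proof (rule tensor2_eqI)
  fix U W assume "U \<in> cls" "W \<in> cls"
  then obtain M N where M: "M \<in> C" "U = cl M" and N: "N \<in> C" "W = cl N" by blast
  show "pairing (comult H \<one>) (\<lambda>(a, b). crd a U * crd b W)
      = pairing (pure (\<one>, \<one>)) (\<lambda>(a, b). crd a U * crd b W)"
    unfolding M(2) N(2) comult_pairing[OF one_in M(1) N(1)]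
    using dsum_zero_iff[OF M(1) N(1)] by (simp add: crd_one class_basis_def)
qed (use comult_keys one_in in auto)

lemma counit_laws:
  assumes x: "x \<in> carrier H"
  shows "formal_eval H (\<lambda>(a, b). counit H a \<odot> b) (comult H x) = x"
    and "formal_eval H (\<lambda>(a, b). counit H b \<odot> a) (comult H x) = x"
proof -
  have c: "fst k \<in> carrier H" "snd k \<in> carrier H" if "k \<in> Poly_Mapping.keys (comult H x)" for k
    using comult_keys[OF x] that by auto
  note Z = C_zero
  show "formal_eval H (\<lambda>(a, b). counit H a \<odot> b) (comult H x) = x"
    unfolding case_prod_beta'
  proof (rule class_eqI[OF _ x])
    fix M assume M: "M \<in> C"
    have "crd (formal_eval H (\<lambda>k. counit H (fst k) \<odot> snd k) (comult H x)) (cl M)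
        = pairing (comult H x) (\<lambda>k. crd (counit H (fst k) \<odot> snd k) (cl M))"
      by (rule formal_eval_coord(2)) (use c smult_in in blast)
    also have "\<dots> = pairing (comult H x) (\<lambda>k. crd (fst k) (cl zero_rep) * crd (snd k) (cl M))"
      by (rule pairing_cong) (use c in \<open>simp add: crd_smult counit_crd\<close>)
    also have "\<dots> = crd x (cl (dsum zero_rep M))" by (rule comult_pairing'[OF x Z M])
    also have "cl (dsum zero_rep M) = cl M"
      using C_repsD[OF M] zero_rep_in_reps by (intro iso_class_eqI dsum_reps dsum_zero_left)
    finally show "crd (formal_eval H (\<lambda>k. counit H (fst k) \<odot> snd k) (comult H x)) (cl M)
        = crd x (cl M)" .
  qed (use c smult_in in \<open>blast intro: formal_eval_coord(1)\<close>)
  show "formal_eval H (\<lambda>(a, b). counit H b \<odot> a) (comult H x) = x"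
    unfolding case_prod_beta'
  proof (rule class_eqI[OF _ x])
    fix M assume M: "M \<in> C"
    have "crd (formal_eval H (\<lambda>k. counit H (snd k) \<odot> fst k) (comult H x)) (cl M)
        = pairing (comult H x) (\<lambda>k. crd (counit H (snd k) \<odot> fst k) (cl M))"
      by (rule formal_eval_coord(2)) (use c smult_in in blast)
    also have "\<dots> = pairing (comult H x) (\<lambda>k. crd (fst k) (cl M) * crd (snd k) (cl zero_rep))"
      by (rule pairing_cong) (use c in \<open>simp add: crd_smult counit_crd\<close>)
    also have "\<dots> = crd x (cl (dsum M zero_rep))" by (rule comult_pairing'[OF x M Z])
    also have "cl (dsum M zero_rep) = cl M"
      using C_repsD[OF M] zero_rep_in_reps by (intro iso_class_eqI dsum_reps dsum_zero_right)
    finally show "crd (formal_eval H (\<lambda>k. counit H (snd k) \<odot> fst k) (comult H x)) (cl M)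
        = crd x (cl M)" .
  qed (use c smult_in in \<open>blast intro: formal_eval_coord(1)\<close>)
qed

subsection \<open>The antipode\<close>

text \<open>
  After expanding the products, each side of the convolution identity at \<open>R\<close> is a sum of values of
  \<open>x\<close> over pairs of a subrepresentation and a flag, in which the flags cancel.
\<close>

lemma is_antipodeI:
  assumes S_in: "\<And>x. x \<in> carrier H \<Longrightarrow> S x \<in> carrier H"
    and crd_S: "\<And>x. x \<in> carrier H \<Longrightarrow> crd (S x) = hanti_fun (crd x)"
  shows "is_antipode H S"
  unfolding is_antipode_def
proof (intro conjI ballI)
  have S: "crd (S x) (cl M) = hanti (crd x) M" if "x \<in> carrier H" "M \<in> C" for x M
    using that by (simp add: crd_S hanti_fun)
  show "linear_on H H S"
    unfolding linear_on_def
  proof (intro conjI ballI allI)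
    show "S ` carrier H \<subseteq> carrier H" using S_in by blast
    fix x assume x: "x \<in> carrier H"
    { fix y assume y: "y \<in> carrier H"
      show "S (x \<oplus> y) = S x \<oplus> S y"
      proof (rule class_eqI)
        fix M assume M: "M \<in> C"
        show "crd (S (x \<oplus> y)) (cl M) = crd (S x \<oplus> S y) (cl M)"
          unfolding crd_add[OF S_in[OF x] S_in[OF y]] S[OF add_in[OF x y] M] S[OF x M] S[OF y M]
            hanti_def crd_add[OF x y] distrib_left sum.distrib by (rule refl)
      qed (use x y S_in add_in in auto) }
    fix c
    show "S (c \<odot> x) = c \<odot> S x"
      by (rule class_eqI) (use x in \<open>auto simp: S_in smult_in S crd_smult hanti_def sum_distrib_left mult_ac\<close>)
  qed
  fix x assume x: "x \<in> carrier H"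
  have c: "fst k \<in> carrier H" "snd k \<in> carrier H" if "k \<in> Poly_Mapping.keys (comult H x)" for k
    using comult_keys[OF x] that by auto
  have unit: "counit H x \<odot> \<one> \<in> carrier H" by (intro smult_in one_in)
  have crd_unit: "crd (counit H x \<odot> \<one>) (cl R)
      = (if cl R = cl zero_rep then crd x (cl zero_rep) else 0)" for R
    by (simp add: crd_smult one_in crd_one class_basis_def counit_crd[OF x])
  show "formal_eval H (\<lambda>(a, b). S a \<otimes> b) (comult H x) = counit H x \<odot> \<one>"
    unfolding case_prod_beta'
  proof (rule class_eqI[OF _ unit])
    fix R assume R: "R \<in> C"
    have "crd (formal_eval H (\<lambda>k. S (fst k) \<otimes> snd k) (comult H x)) (cl R)
        = pairing (comult H x) (\<lambda>k. crd (S (fst k) \<otimes> snd k) (cl R))"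
      by (rule formal_eval_coord(2)) (use c S_in mult_in in blast)
    also have "\<dots> = pairing (comult H x) (\<lambda>k. \<Sum>L\<in>subreps Q R. \<Sum>F\<in>flags (quot_rep Q R L). (- 1) ^ Suc (card F)
        * (crd (fst k) (cl (gr_rep (quot_rep Q R L) F)) * crd (snd k) (cl (sub_rep R L))))"
      by (rule pairing_cong)
        (use c R in \<open>simp add: crd_mult_expand S_in S C_quot hanti_def sum_distrib_right mult.assoc\<close>)
    also have "\<dots> = (\<Sum>L\<in>subreps Q R. \<Sum>F\<in>flags (quot_rep Q R L). (- 1) ^ Suc (card F)
        * crd x (cl (dsum (gr_rep (quot_rep Q R L) F) (sub_rep R L))))"
      unfolding pairing_sum_right pairing_cmult_right
      using R by (intro sum.cong refl) (simp add: comult_pairing'[OF x] C_quot C_sub C_gr)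
    also have "\<dots> = crd (counit H x \<odot> \<one>) (cl R)"
      unfolding crd_unit by (rule hanti_left[OF C_repsD[OF R]])
    finally show "crd (formal_eval H (\<lambda>k. S (fst k) \<otimes> snd k) (comult H x)) (cl R)
        = crd (counit H x \<odot> \<one>) (cl R)" .
  qed (use c S_in mult_in in \<open>blast intro: formal_eval_coord(1)\<close>)
  show "formal_eval H (\<lambda>(a, b). a \<otimes> S b) (comult H x) = counit H x \<odot> \<one>"
    unfolding case_prod_beta'
  proof (rule class_eqI[OF _ unit])
    fix R assume R: "R \<in> C"
    have "crd (formal_eval H (\<lambda>k. fst k \<otimes> S (snd k)) (comult H x)) (cl R)
        = pairing (comult H x) (\<lambda>k. crd (fst k \<otimes> S (snd k)) (cl R))"
      by (rule formal_eval_coord(2)) (use c S_in mult_in in blast)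
    also have "\<dots> = pairing (comult H x) (\<lambda>k. \<Sum>L\<in>subreps Q R. \<Sum>F\<in>flags (sub_rep R L). (- 1) ^ Suc (card F)
        * (crd (fst k) (cl (quot_rep Q R L)) * crd (snd k) (cl (gr_rep (sub_rep R L) F))))"
      by (rule pairing_cong)
        (use c R in \<open>simp add: crd_mult_expand S_in S C_sub hanti_def sum_distrib_left mult_ac\<close>)
    also have "\<dots> = (\<Sum>L\<in>subreps Q R. \<Sum>F\<in>flags (sub_rep R L). (- 1) ^ Suc (card F)
        * crd x (cl (dsum (quot_rep Q R L) (gr_rep (sub_rep R L) F))))"
      unfolding pairing_sum_right pairing_cmult_right
      using R by (intro sum.cong refl) (simp add: comult_pairing'[OF x] C_quot C_sub C_gr)
    also have "\<dots> = crd (counit H x \<odot> \<one>) (cl R)"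
      unfolding crd_unit by (rule hanti_right[OF C_repsD[OF R]])
    finally show "crd (formal_eval H (\<lambda>k. fst k \<otimes> S (snd k)) (comult H x)) (cl R)
        = crd (counit H x \<odot> \<one>) (cl R)" .
  qed (use c S_in mult_in in \<open>blast intro: formal_eval_coord(1)\<close>)
qed

lemma antipode_exists: "\<exists>S. is_antipode H S"
proof
  show "is_antipode H (\<lambda>x. vec (hanti_fun (crd x)))"
  proof (rule is_antipodeI)
    fix x assume x: "x \<in> carrier H"
    then have "fin_fun (crd x)" using crd_finite crd_outside unfolding fin_fun_def by blast
    then have "fin_fun (hanti_fun (crd x))" by (rule fin_fun_hanti)
    then show "vec (hanti_fun (crd x)) \<in> carrier H" "crd (vec (hanti_fun (crd x))) = hanti_fun (crd x)"
      by (auto simp: fin_fun_def intro!: vec)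
  qed
qed

lemma hopf_algebra: "hopf_algebra H"
proof (intro hopf_algebra.intro ring module hopf_algebra_axioms.intro)
  fix x y c assume x: "x \<in> carrier H" and y: "y \<in> carrier H"
  show "(c \<odot> x) \<otimes> y = c \<odot> (x \<otimes> y)"
    by (rule class_eqI)
      (use x y in \<open>auto simp: smult_in mult_in crd_smult crd_mult hprod_def sum_distrib_left mult_ac\<close>)
  show "x \<otimes> (c \<odot> y) = c \<odot> (x \<otimes> y)"
    by (rule class_eqI)
      (use x y in \<open>auto simp: smult_in mult_in crd_smult crd_mult hprod_def sum_distrib_left mult_ac\<close>)
  show "tensor2_eq H (comult H (x \<oplus> y)) (comult H x + comult H y)"
  proof (rule tensor2_eqI)
    show "Poly_Mapping.keys (comult H x + comult H y) \<subseteq> carrier H \<times> carrier H"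
      using Poly_Mapping.keys_add[of "comult H x" "comult H y"] comult_keys x y by blast
    fix U W assume "U \<in> cls" "W \<in> cls"
    then show "pairing (comult H (x \<oplus> y)) (\<lambda>(a, b). crd a U * crd b W)
        = pairing (comult H x + comult H y) (\<lambda>(a, b). crd a U * crd b W)"
      using x y by (auto simp: comult_pairing add_in crd_add)
  qed (use comult_keys add_in x y in blast)
  show "counit H (x \<oplus> y) = counit H x + counit H y"
    using x y by (simp add: counit_crd add_in crd_add)
  show "tensor2_eq H (comult H (x \<otimes> y)) (tensor_mult H (comult H x) (comult H y))"
    by (rule comult_multiplicative[OF x y])
  show "counit H (x \<otimes> y) = counit H x * counit H y"
    using x y C_zero by (simp add: counit_crd mult_in crd_mult hprod_zero_rep)
next
  fix x c assume x: "x \<in> carrier H"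
  show "Poly_Mapping.keys (comult H x) \<subseteq> carrier H \<times> carrier H" by (rule comult_keys[OF x])
  show "tensor2_eq H (comult H (c \<odot> x)) (formal_smult c (comult H x))"
  proof (rule tensor2_eqI)
    show "Poly_Mapping.keys (formal_smult c (comult H x)) \<subseteq> carrier H \<times> carrier H"
      using keys_formal_smult[of c "comult H x"] comult_keys[OF x] by blast
    fix U W assume "U \<in> cls" "W \<in> cls"
    then show "pairing (comult H (c \<odot> x)) (\<lambda>(a, b). crd a U * crd b W)
        = pairing (formal_smult c (comult H x)) (\<lambda>(a, b). crd a U * crd b W)"
      using x by (auto simp: comult_pairing smult_in crd_smult)
  qed (use comult_keys smult_in x in blast)
  show "counit H (c \<odot> x) = c * counit H x"
    using x by (simp add: counit_crd smult_in crd_smult)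
  show "tensor3_eq H (comult_id H (comult H x)) (id_comult H (comult H x))" by (rule coassociative[OF x])
  show "formal_eval H (\<lambda>(a, b). counit H a \<odot> b) (comult H x) = x"
    "formal_eval H (\<lambda>(a, b). counit H b \<odot> a) (comult H x) = x"
    by (rule counit_laws[OF x])+
qed (use comult_unit antipode_exists in \<open>auto simp: counit_crd one_in crd_one class_basis_def\<close>)

end


section \<open>The Hall algebra of a class of representations\<close>

context hall_class
begin

abbreviation hall_C :: "('v, 'a) hall hopf" where
  "hall_C \<equiv> hall_algebra Q C"

lemma hall_carrier: "carrier hall_C = {f. fin_fun f}"
  by (auto simp: hall_algebra_def Let_def fin_fun_def)

lemma hall_simps:
  "\<one>\<^bsub>hall_C\<^esub> = rep_basis Q zero_rep"
  "\<zero>\<^bsub>hall_C\<^esub> = (\<lambda>_. 0)"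
  "f \<oplus>\<^bsub>hall_C\<^esub> g = (\<lambda>U. f U + g U)"
  "c \<odot>\<^bsub>hall_C\<^esub> f = (\<lambda>U. c * f U)"
  "counit hall_C f = f (cl zero_rep)"
  by (simp_all add: hall_algebra_def Let_def)

text \<open>
  The Hall numbers count subrepresentations of \<open>R\<close> by the classes of sub and quotient; the double sum
  over classes is the sum over subrepresentations, sorted by these classes.
\<close>

lemma hall_mult:
  assumes f: "fin_fun f" and g: "fin_fun g"
  shows "f \<otimes>\<^bsub>hall_C\<^esub> g = hprod_fun f g"
proof
  fix U
  show "(f \<otimes>\<^bsub>hall_C\<^esub> g) U = hprod_fun f g U"
  proof (cases "U \<in> cls")
    case True
    let ?R = "rep_of U" and ?F = "{A. f A \<noteq> 0}" and ?G = "{B. g B \<noteq> 0}"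
    let ?q = "\<lambda>L. cl (quot_rep Q ?R L)" and ?s = "\<lambda>L. cl (sub_rep ?R L)"
    have R: "?R \<in> reps Q" using rep_of_cls(1)[OF True] C_repsD by blast
    have num: "of_nat (hall_number Q (rep_of A) (rep_of B) ?R)
        = (\<Sum>L\<in>subreps Q ?R. if ?q L = A \<and> ?s L = B then 1 else (0::complex))"
      if "A \<in> cls" "B \<in> cls" for A B
    proof -
      have "rep_iso Q (sub_rep ?R L) (rep_of B) \<longleftrightarrow> ?s L = B"
        "rep_iso Q (quot_rep Q ?R L) (rep_of A) \<longleftrightarrow> ?q L = A" if "L \<in> subreps Q ?R" for L
        using iso_class_eq_iff[OF sub_rep_reps[OF R that] C_repsD[OF rep_of_cls(1)[OF \<open>B \<in> cls\<close>]]]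
          iso_class_eq_iff[OF quot_rep_reps[OF R that] C_repsD[OF rep_of_cls(1)[OF \<open>A \<in> cls\<close>]]]
          rep_of_cls(2)[OF \<open>A \<in> cls\<close>] rep_of_cls(2)[OF \<open>B \<in> cls\<close>] by simp_all
      then have "{L \<in> subreps Q ?R. rep_iso Q (sub_rep ?R L) (rep_of B) \<and> rep_iso Q (quot_rep Q ?R L) (rep_of A)}
          = {L \<in> subreps Q ?R. ?q L = A \<and> ?s L = B}" by auto
      then show ?thesis
        using finite_subreps[OF R]
        by (simp add: hall_number_def sum.inter_filter[symmetric])
    qed
    have AB: "A \<in> cls" "B \<in> cls" if "A \<in> ?F" "B \<in> ?G" for A B
      using that f g by (auto simp: fin_fun_def)
    have fin: "finite ?F" "finite ?G" using f g by (auto simp: fin_fun_def)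
    have "(f \<otimes>\<^bsub>hall_C\<^esub> g) U = (\<Sum>A\<in>?F. \<Sum>B\<in>?G. f A * g B * of_nat (hall_number Q (rep_of A) (rep_of B) ?R))"
      using True by (simp add: hall_algebra_def Let_def)
    also have "\<dots> = (\<Sum>A\<in>?F. \<Sum>B\<in>?G. \<Sum>L\<in>subreps Q ?R. if ?q L = A \<and> ?s L = B then f A * g B else 0)"
      by (intro sum.cong refl) (use AB in \<open>simp add: num sum_distrib_left if_distrib cong: if_cong\<close>)
    also have "\<dots> = (\<Sum>A\<in>?F. \<Sum>L\<in>subreps Q ?R. \<Sum>B\<in>?G. if ?q L = A \<and> ?s L = B then f A * g B else 0)"
      by (intro sum.cong refl sum.swap)
    also have "\<dots> = (\<Sum>L\<in>subreps Q ?R. \<Sum>A\<in>?F. \<Sum>B\<in>?G. if ?q L = A \<and> ?s L = B then f A * g B else 0)"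
      by (rule sum.swap)
    also have "\<dots> = (\<Sum>L\<in>subreps Q ?R. f (?q L) * g (?s L))"
    proof (intro sum.cong refl)
      fix L
      have "(\<Sum>A\<in>?F. \<Sum>B\<in>?G. if ?q L = A \<and> ?s L = B then f A * g B else 0)
          = (\<Sum>A\<in>?F. if ?q L = A then f A * g (?s L) else 0)"
      proof (intro sum.cong refl)
        fix A
        have "(\<Sum>B\<in>?G. if ?q L = A \<and> ?s L = B then f A * g B else 0)
            = (if ?q L = A then (\<Sum>B\<in>?G. if ?s L = B then f A * g B else 0) else 0)" by simp
        then show "(\<Sum>B\<in>?G. if ?q L = A \<and> ?s L = B then f A * g B else 0)
            = (if ?q L = A then f A * g (?s L) else 0)"
          using fin(2) by (auto simp: sum.delta')
      qed
      then show "(\<Sum>A\<in>?F. \<Sum>B\<in>?G. if ?q L = A \<and> ?s L = B then f A * g B else 0) = f (?q L) * g (?s L)"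
        using fin(1) by (auto simp: sum.delta')
    qed
    finally show ?thesis using True by (simp add: hprod_fun_def hprod_def)
  next
    case False
    then show ?thesis by (simp add: hprod_fun_def hall_algebra_def Let_def)
  qed
qed

text \<open>
  The pairs of classes in the support have bounded dimension, so the sum that defines the coproduct
  is finite and has the intended values.
\<close>

lemma hall_comult:
  assumes f: "fin_fun f"
  shows "Poly_Mapping.keys (comult hall_C f) \<subseteq>
      {(class_basis U, class_basis W) | U W. U \<in> cls \<and> W \<in> cls \<and> f (cl (dsum (rep_of U) (rep_of W))) \<noteq> 0}"
    and "M \<in> C \<Longrightarrow> N \<in> C \<Longrightarrow>
      pairing (comult hall_C f) (\<lambda>(a, b). a (cl M) * b (cl N)) = f (cl (dsum M N))"
proof -
  let ?d = "\<lambda>(U, W). f (cl (dsum (rep_of U) (rep_of W)))"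
  let ?P = "{p. p \<in> cls \<times> cls \<and> ?d p \<noteq> 0}"
  have eq: "comult hall_C f = (\<Sum>p\<in>?P. Poly_Mapping.single (class_basis (fst p), class_basis (snd p)) (?d p))"
    by (simp add: hall_algebra_def Let_def case_prod_beta' mem_Times_iff)
  obtain n where n: "\<And>M. M \<in> reps Q \<Longrightarrow> f (cl M) \<noteq> 0 \<Longrightarrow> dim_le n M"
    using fin_fun_dim[OF f] by blast
  have "?P \<subseteq> {U \<in> cls. dim_le n (rep_of U)} \<times> {U \<in> cls. dim_le n (rep_of U)}"
  proof
    fix p assume "p \<in> ?P"
    then obtain U W where p: "p = (U, W)" "U \<in> cls" "W \<in> cls" "?d (U, W) \<noteq> 0" by auto
    note r = C_repsD[OF rep_of_cls(1)[OF p(2)]] C_repsD[OF rep_of_cls(1)[OF p(3)]]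
    have "dim_le n (dsum (rep_of U) (rep_of W))" using n[OF dsum_reps[OF r]] p(4) by simp
    then show "p \<in> {U \<in> cls. dim_le n (rep_of U)} \<times> {U \<in> cls. dim_le n (rep_of U)}"
      using dim_le_dsum[OF r] p by simp
  qed
  then have fin: "finite ?P"
    by (rule finite_subset) (intro finite_cartesian_product finite_dim_le_cls)
  show "Poly_Mapping.keys (comult hall_C f) \<subseteq>
      {(class_basis U, class_basis W) | U W. U \<in> cls \<and> W \<in> cls \<and> f (cl (dsum (rep_of U) (rep_of W))) \<noteq> 0}"
  proof -
    have "Poly_Mapping.keys (comult hall_C f) \<subseteq>
        (\<Union>p\<in>?P. Poly_Mapping.keys (Poly_Mapping.single (class_basis (fst p), class_basis (snd p)) (?d p)))"
      unfolding eq by (rule keys_sum)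
    also have "\<dots> \<subseteq> {(class_basis U, class_basis W) | U W. U \<in> cls \<and> W \<in> cls \<and>
        f (cl (dsum (rep_of U) (rep_of W))) \<noteq> 0}"
    proof (rule UN_least)
      fix p assume "p \<in> ?P"
      then obtain U W where "p = (U, W)" "U \<in> cls" "W \<in> cls" "?d (U, W) \<noteq> 0" by auto
      then show "Poly_Mapping.keys (Poly_Mapping.single (class_basis (fst p), class_basis (snd p)) (?d p))
          \<subseteq> {(class_basis U, class_basis W) | U W. U \<in> cls \<and> W \<in> cls \<and>
            f (cl (dsum (rep_of U) (rep_of W))) \<noteq> 0}"
        by (simp del: split_paired_Ex) blast
    qed
    finally show ?thesis .
  qed
  assume M: "M \<in> C" and N: "N \<in> C"
  let ?m = "(cl M, cl N)"
  have "pairing (comult hall_C f) (\<lambda>(a, b). a (cl M) * b (cl N))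
      = (\<Sum>p\<in>?P. if p = ?m then ?d p else 0)"
    unfolding eq pairing_sum pairing_single
    by (intro sum.cong refl) (auto simp: class_basis_def)
  also have "\<dots> = ?d ?m"
    using fin M N by auto
  also have "?d ?m = f (cl (dsum M N))"
  proof -
    note r = C_repsD[OF M] C_repsD[OF N]
    have "cl (dsum M N) = cl (dsum (rep_of (cl M)) (rep_of (cl N)))"
      using r rep_of_iso_class by (intro iso_class_eqI dsum_reps dsum_iso_cong) auto
    then show ?thesis by simp
  qed
  finally show "pairing (comult hall_C f) (\<lambda>(a, b). a (cl M) * b (cl N)) = f (cl (dsum M N))" .
qed

lemma fin_fun_add: "fin_fun f \<Longrightarrow> fin_fun g \<Longrightarrow> fin_fun (\<lambda>U. f U + g U)"
proof -
  assume *: "fin_fun f" "fin_fun g"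
  have "{U. f U + g U \<noteq> 0} \<subseteq> {U. f U \<noteq> 0} \<union> {U. g U \<noteq> 0}" by auto
  then show ?thesis using * unfolding fin_fun_def by (meson finite_Un finite_subset le_supI order_trans)
qed

lemma fin_fun_smult: "fin_fun f \<Longrightarrow> fin_fun (\<lambda>U. c * f U)"
proof -
  assume *: "fin_fun f"
  have "{U. c * f U \<noteq> 0} \<subseteq> {U. f U \<noteq> 0}" by auto
  then show ?thesis using * unfolding fin_fun_def by (meson finite_subset order_trans)
qed

lemma hall_coords_hall: "hall_coords Q C hall_C (\<lambda>f. f)"
proof (intro hall_coords.intro coord_space.intro hall_coords_axioms.intro)
  show "hall_class Q C" by (rule hall_class_axioms)
  show "inj_on (\<lambda>f. f) (carrier hall_C)" by simp
  show "(\<lambda>f. f) ` carrier hall_C = {f. finite {u. f u \<noteq> 0} \<and> {u. f u \<noteq> 0} \<subseteq> cls}"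
    by (simp add: hall_carrier fin_fun_def)
  show "\<zero>\<^bsub>hall_C\<^esub> \<in> carrier hall_C" by (simp add: hall_carrier hall_simps fin_fun_def)
  show "\<one>\<^bsub>hall_C\<^esub> \<in> carrier hall_C" using C_zero by (simp add: hall_carrier hall_simps class_basis_fin)
next
  fix f g assume "f \<in> carrier hall_C" "g \<in> carrier hall_C"
  then have f: "fin_fun f" and g: "fin_fun g" by (simp_all add: hall_carrier)
  show "f \<oplus>\<^bsub>hall_C\<^esub> g \<in> carrier hall_C" using f g by (simp add: hall_carrier hall_simps fin_fun_add)
  show "f \<otimes>\<^bsub>hall_C\<^esub> g \<in> carrier hall_C" using f g by (simp add: hall_carrier hall_mult fin_fun_hprod)
  show "(f \<otimes>\<^bsub>hall_C\<^esub> g) (cl M) = hprod f g M" if "M \<in> C" for M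
    using f g that by (simp add: hall_mult hprod_fun)
next
  fix f assume "f \<in> carrier hall_C"
  then have f: "fin_fun f" by (simp add: hall_carrier)
  show "c \<odot>\<^bsub>hall_C\<^esub> f \<in> carrier hall_C" for c using f by (simp add: hall_carrier hall_simps fin_fun_smult)
  show "Poly_Mapping.keys (comult hall_C f) \<subseteq> carrier hall_C \<times> carrier hall_C"
  proof (rule order_trans[OF hall_comult(1)[OF f]], rule subsetI)
    fix k assume "k \<in> {(class_basis U, class_basis W) | U W. U \<in> cls \<and> W \<in> cls \<and>
      f (cl (dsum (rep_of U) (rep_of W))) \<noteq> 0}"
    then obtain U W where "k = (class_basis U, class_basis W)" "U \<in> cls" "W \<in> cls" by blast
    then show "k \<in> carrier hall_C \<times> carrier hall_C" by (simp add: hall_carrier class_basis_fin)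
  qed
  show "pairing (comult hall_C f) (\<lambda>(a, b). a (cl M) * b (cl N)) = f (cl (dsum M N))"
    if "M \<in> C" "N \<in> C" for M N
    using hall_comult(2)[OF f that] .
qed (simp_all add: hall_simps)

sublocale hall: hall_coords Q C hall_C "\<lambda>f. f"
  by (rule hall_coords_hall)

end


section \<open>The quotient by a hereditary subclass\<close>

locale hall_subclass = hall_class Q C + small: hall_class Q D
  for Q :: "('v, 'a) pre_digraph" and C D :: "('v, 'a) rep set" +
  assumes D_C: "D \<subseteq> C"
begin

definition compl_ideal :: "('v, 'a) hall set" where
  "compl_ideal = lin_span hall_C {rep_basis Q M | M. M \<in> C \<and> M \<notin> D}"

lemma small_cls: "small.cls \<subseteq> cls"
  using D_C by blast

text \<open>In this form the Hopf ideal property becomes a statement about values on \<open>D\<close>.\<close>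

lemma mem_compl_ideal: "f \<in> compl_ideal \<longleftrightarrow> f \<in> carrier hall_C \<and> (\<forall>U\<in>small.cls. f U = 0)"
proof
  let ?B = "{rep_basis Q M | M. M \<in> C \<and> M \<notin> D}"
  assume "f \<in> compl_ideal"
  then obtain F c where F: "finite F" "F \<subseteq> ?B" "f = (\<Oplus>\<^bsub>hall_C\<^esub>b\<in>F. c b \<odot>\<^bsub>hall_C\<^esub> b)"
    unfolding compl_ideal_def lin_span_def by blast
  have b: "b \<in> carrier hall_C" if "b \<in> F" for b
    using that F(2) class_basis_fin by (auto simp: hall_carrier)
  then have cb: "c b \<odot>\<^bsub>hall_C\<^esub> b \<in> carrier hall_C" if "b \<in> F" for b
    using that hall.smult_in by blast
  have "f U = 0" if U: "U \<in> small.cls" for U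
  proof -
    have "b U = 0" if b: "b \<in> F" for b
    proof -
      obtain M where M: "b = rep_basis Q M" "M \<in> C" "M \<notin> D" using F(2) b by blast
      then have "cl M \<noteq> U" using small.C_iso C_repsD U by blast
      then show ?thesis using M by (simp add: class_basis_def)
    qed
    then show ?thesis
      unfolding F(3) using hall.finsum_coord(2)[where f = "\<lambda>b. c b \<odot>\<^bsub>hall_C\<^esub> b" and I = F and u = U, OF cb]
      by (simp add: hall_simps) (simp add: sum.neutral \<open>\<And>b. b \<in> F \<Longrightarrow> b U = 0\<close>)
  qed
  then show "f \<in> carrier hall_C \<and> (\<forall>U\<in>small.cls. f U = 0)"
    using hall.finsum_coord(1)[OF cb] F(3) by simp
next
  assume "f \<in> carrier hall_C \<and> (\<forall>U\<in>small.cls. f U = 0)"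
  then have f: "fin_fun f" and z: "\<And>U. U \<in> small.cls \<Longrightarrow> f U = 0" by (auto simp: hall_carrier)
  let ?S = "{U. f U \<noteq> 0}"
  let ?F = "class_basis ` ?S :: ('v, 'a) hall set"
  have fin: "finite ?S" and S: "?S \<subseteq> cls" using f by (auto simp: fin_fun_def)
  have inj: "inj_on (class_basis :: _ \<Rightarrow> ('v, 'a) hall) ?S"
  proof (rule inj_onI)
    fix U W :: "('v, 'a) rep set" assume "class_basis U = (class_basis W :: ('v, 'a) hall)"
    then have "class_basis U W = (class_basis W W :: complex)" by (rule fun_cong)
    then show "U = W" by (simp add: class_basis_def split: if_splits)
  qed
  \<comment> \<open>a linear combination is indexed by its vectors; this recovers \<open>f U\<close> from \<open>class_basis U\<close>\<close>
  define c where "c b = (\<Sum>U\<in>?S. f U * b U)" for b :: "('v, 'a) hall"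
  have c: "c (class_basis U) = f U" if "U \<in> ?S" for U
    using fin that by (simp add: c_def class_basis_def if_distrib cong: if_cong)
  have carr: "c b \<odot>\<^bsub>hall_C\<^esub> b \<in> carrier hall_C" if "b \<in> ?F" for b
    using that S class_basis_fin by (intro hall.smult_in) (auto simp: hall_carrier)
  have "(\<Oplus>\<^bsub>hall_C\<^esub>b\<in>?F. c b \<odot>\<^bsub>hall_C\<^esub> b) = f"
  proof
    fix W
    have "(\<Oplus>\<^bsub>hall_C\<^esub>b\<in>?F. c b \<odot>\<^bsub>hall_C\<^esub> b) W = (\<Sum>b\<in>?F. c b * b W)"
      using hall.finsum_coord(2)[of ?F "\<lambda>b. c b \<odot>\<^bsub>hall_C\<^esub> b" W] carr by (simp add: hall_simps)
    also have "\<dots> = (\<Sum>U\<in>?S. if W = U then f U else 0)"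
      unfolding sum.reindex[OF inj] by (intro sum.cong refl) (use c in \<open>simp add: class_basis_def\<close>)
    also have "\<dots> = f W" using fin by simp
    finally show "(\<Oplus>\<^bsub>hall_C\<^esub>b\<in>?F. c b \<odot>\<^bsub>hall_C\<^esub> b) W = f W" .
  qed
  moreover have "?F \<subseteq> {rep_basis Q M | M. M \<in> C \<and> M \<notin> D}"
  proof
    fix b assume "b \<in> ?F"
    then obtain U where U: "b = class_basis U" "f U \<noteq> 0" by blast
    then obtain M where M: "M \<in> C" "U = cl M" using S by blast
    moreover have "M \<notin> D" using z M U by blast
    ultimately show "b \<in> {rep_basis Q M | M. M \<in> C \<and> M \<notin> D}" using U by blast
  qed
  ultimately show "f \<in> compl_ideal"
    unfolding compl_ideal_def lin_span_def mem_Collect_eq using fin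
    by (intro exI[of _ ?F] exI[of _ c]) simp
qed

lemma D_repC: "M \<in> D \<Longrightarrow> M \<in> C"
  using D_C by blast

lemma small_class_values:
  assumes "\<And>M. M \<in> D \<Longrightarrow> f (cl M) = 0"
  shows "\<forall>U\<in>small.cls. f U = 0"
  using assms by blast

text \<open>
  For \<open>R \<in> D\<close> all representations that occur in the values at \<open>R\<close> of products and antipodes lie in
  \<open>D\<close>. If \<open>[U] \<otimes> [W]\<close> occurs in the coproduct of \<open>f\<close>, then \<open>f\<close> does not vanish on \<open>U \<oplus> W\<close>, so that
  \<open>U\<close> and \<open>W\<close> are not both in \<open>D\<close>.
\<close>

lemma hopf_ideal_compl: "hopf_ideal compl_ideal hall_C"
proof -
  interpret H: hopf_algebra hall_C by (rule hall.hopf_algebra)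
  have sub: "submodule compl_ideal complex_ring hall_C"
  proof (rule module.submoduleI[OF hall.module])
    show "compl_ideal \<subseteq> carrier hall_C" "\<zero>\<^bsub>hall_C\<^esub> \<in> compl_ideal"
      using hall.zero_in by (auto simp: mem_compl_ideal hall_simps)
  next
    fix f assume "f \<in> compl_ideal"
    then show "\<ominus>\<^bsub>hall_C\<^esub> f \<in> compl_ideal" using hall.crd_minus by (simp add: mem_compl_ideal)
  next
    fix f g assume "f \<in> compl_ideal" "g \<in> compl_ideal"
    then show "f \<oplus>\<^bsub>hall_C\<^esub> g \<in> compl_ideal" using hall.add_in hall.crd_add by (simp add: mem_compl_ideal)
  next
    fix c f assume "f \<in> compl_ideal"
    then show "c \<odot>\<^bsub>hall_C\<^esub> f \<in> compl_ideal" using hall.smult_in hall.crd_smult by (simp add: mem_compl_ideal)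
  qed
  have "ideal compl_ideal hall_C"
  proof (rule idealI[OF hall.ring])
    show "subgroup compl_ideal (add_monoid hall_C)" by (rule submodule.axioms(1)[OF sub])
    fix f g assume "f \<in> compl_ideal" and g: "g \<in> carrier hall_C"
    then have f: "f \<in> carrier hall_C" and z: "\<And>M. M \<in> D \<Longrightarrow> f (cl M) = 0"
      by (auto simp: mem_compl_ideal)
    show "g \<otimes>\<^bsub>hall_C\<^esub> f \<in> compl_ideal"
      unfolding mem_compl_ideal
    proof (intro conjI small_class_values)
      show "g \<otimes>\<^bsub>hall_C\<^esub> f \<in> carrier hall_C" by (rule hall.mult_in[OF g f])
      fix M assume M: "M \<in> D"
      show "(g \<otimes>\<^bsub>hall_C\<^esub> f) (cl M) = 0"
        unfolding hall.crd_mult[OF g f D_repC[OF M]] hprod_def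
        by (intro sum.neutral ballI) (simp add: z small.C_sub[OF M])
    qed
    show "f \<otimes>\<^bsub>hall_C\<^esub> g \<in> compl_ideal"
      unfolding mem_compl_ideal
    proof (intro conjI small_class_values)
      show "f \<otimes>\<^bsub>hall_C\<^esub> g \<in> carrier hall_C" by (rule hall.mult_in[OF f g])
      fix M assume M: "M \<in> D"
      show "(f \<otimes>\<^bsub>hall_C\<^esub> g) (cl M) = 0"
        unfolding hall.crd_mult[OF f g D_repC[OF M]] hprod_def
        by (intro sum.neutral ballI) (simp add: z small.C_quot[OF M])
    qed
  qed
  moreover have "\<forall>f\<in>compl_ideal. \<exists>t. Poly_Mapping.keys t \<subseteq> compl_ideal \<times> carrier hall_C \<union> carrier hall_C \<times> compl_ideal \<and>
      tensor2_eq hall_C (comult hall_C f) t"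
  proof (intro ballI exI conjI)
    fix f assume "f \<in> compl_ideal"
    then have f: "fin_fun f" and z: "\<And>M. M \<in> D \<Longrightarrow> f (cl M) = 0"
      by (auto simp: mem_compl_ideal hall_carrier)
    show "Poly_Mapping.keys (comult hall_C f) \<subseteq> compl_ideal \<times> carrier hall_C \<union> carrier hall_C \<times> compl_ideal"
    proof
      fix k assume "k \<in> Poly_Mapping.keys (comult hall_C f)"
      from subsetD[OF hall_comult(1)[OF f] this] obtain U W where k: "k = (class_basis U, class_basis W)" "U \<in> cls" "W \<in> cls"
        "f (cl (dsum (rep_of U) (rep_of W))) \<noteq> 0"
        by blast
      have bas: "class_basis U \<in> carrier hall_C" "class_basis W \<in> carrier hall_C"
        using k class_basis_fin by (auto simp: hall_carrier)
      have "\<not> (U \<in> small.cls \<and> W \<in> small.cls)"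
        using k(4) z[OF small.C_dsum[OF small.rep_of_cls(1)[of U] small.rep_of_cls(1)[of W]]] by blast
      then have "class_basis U \<in> compl_ideal \<or> class_basis W \<in> compl_ideal"
        unfolding mem_compl_ideal using bas by (auto simp: class_basis_def)
      then show "k \<in> compl_ideal \<times> carrier hall_C \<union> carrier hall_C \<times> compl_ideal"
        using k bas by blast
    qed
    show "tensor2_eq hall_C (comult hall_C f) (comult hall_C f)" by (rule tensor2_eq_refl)
  qed
  moreover have "\<forall>f\<in>compl_ideal. counit hall_C f = 0"
    using small.C_zero by (auto simp: mem_compl_ideal hall_simps)
  moreover have "is_antipode hall_C hanti_fun \<and> hanti_fun ` compl_ideal \<subseteq> compl_ideal"
  proof (intro conjI image_subsetI)
    have S: "hanti_fun f \<in> carrier hall_C" if "f \<in> carrier hall_C" for f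
      using that fin_fun_hanti by (simp add: hall_carrier)
    then show "is_antipode hall_C hanti_fun" by (rule hall.is_antipodeI) simp_all
    fix f assume "f \<in> compl_ideal"
    then have f: "f \<in> carrier hall_C" and z: "\<And>M. M \<in> D \<Longrightarrow> f (cl M) = 0"
      by (auto simp: mem_compl_ideal)
    show "hanti_fun f \<in> compl_ideal"
      unfolding mem_compl_ideal
    proof (intro conjI small_class_values S[OF f])
      fix M assume M: "M \<in> D"
      show "hanti_fun f (cl M) = 0"
        unfolding hanti_fun[OF D_repC[OF M]] hanti_def
        by (intro sum.neutral ballI) (simp add: z small.C_gr[OF M])
    qed
  qed
  ultimately show ?thesis
    unfolding hopf_ideal_def using H.hopf_algebra_axioms sub by blast
qed

lemma compl_ideal_ideal: "ideal compl_ideal hall_C"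
  using hopf_ideal_compl unfolding hopf_ideal_def by blast

definition trunc :: "('v, 'a) hall \<Rightarrow> ('v, 'a) hall" where
  "trunc f U = (if U \<in> small.cls then f U else 0)"

definition coset :: "('v, 'a) hall \<Rightarrow> ('v, 'a) hall set" where
  "coset f = compl_ideal +>\<^bsub>hall_C\<^esub> f"

definition coset_rep :: "('v, 'a) hall set \<Rightarrow> ('v, 'a) hall" where
  "coset_rep Z = (SOME f. f \<in> Z)"

abbreviation quot :: "('v, 'a) hall set hopf" where
  "quot \<equiv> hopf_quot hall_C compl_ideal"

text \<open>A coset is determined by the restriction of its members to the classes of \<open>D\<close>.\<close>

lemma coset_eq:
  assumes f: "f \<in> carrier hall_C"
  shows "coset f = {g \<in> carrier hall_C. trunc g = trunc f}"
proof -
  interpret abelian_group hall_C by (rule hall.abelian_group)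
  have tr: "trunc g = trunc f \<longleftrightarrow> (\<forall>U\<in>small.cls. g U = f U)" for g
    by (auto simp: trunc_def fun_eq_iff)
  show ?thesis
  proof (intro equalityI subsetI)
    fix g assume "g \<in> coset f"
    then obtain h where "h \<in> compl_ideal" "g = h \<oplus>\<^bsub>hall_C\<^esub> f"
      unfolding coset_def a_r_coset_def' by blast
    then show "g \<in> {g \<in> carrier hall_C. trunc g = trunc f}"
      unfolding tr using hall.add_in hall.crd_add f by (simp add: mem_compl_ideal)
  next
    fix g assume "g \<in> {g \<in> carrier hall_C. trunc g = trunc f}"
    then have g: "g \<in> carrier hall_C" "\<And>U. U \<in> small.cls \<Longrightarrow> g U = f U" unfolding tr by auto
    let ?h = "g \<ominus>\<^bsub>hall_C\<^esub> f"
    have "?h U = g U - f U" for U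
      using g(1) f hall.crd_minus[OF f] hall.crd_add[of g "\<ominus>\<^bsub>hall_C\<^esub> f"] by (simp add: minus_eq)
    then have "?h \<in> compl_ideal" using g f by (simp add: mem_compl_ideal)
    moreover have "g = ?h \<oplus>\<^bsub>hall_C\<^esub> f" using g(1) f by (simp add: minus_eq a_assoc l_neg)
    ultimately show "g \<in> coset f" unfolding coset_def a_r_coset_def' by blast
  qed
qed

lemma coset_rep:
  assumes "f \<in> carrier hall_C"
  shows "coset_rep (coset f) \<in> carrier hall_C" "trunc (coset_rep (coset f)) = trunc f"
proof -
  have "f \<in> coset f" using assms coset_eq by simp
  then have "coset_rep (coset f) \<in> coset f" unfolding coset_rep_def
    by (rule someI[where P = "\<lambda>g. g \<in> coset f"])
  then show "coset_rep (coset f) \<in> carrier hall_C" "trunc (coset_rep (coset f)) = trunc f"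
    unfolding coset_eq[OF assms] by auto
qed

lemma coset_eq_iff:
  "f \<in> carrier hall_C \<Longrightarrow> g \<in> carrier hall_C \<Longrightarrow> coset f = coset g \<longleftrightarrow> trunc f = trunc g"
  using coset_eq[of f] coset_eq[of g] coset_rep(2)[of f] coset_rep(2)[of g] by auto

lemma coset_ops:
  assumes "f \<in> carrier hall_C" "g \<in> carrier hall_C"
  shows "coset f \<oplus>\<^bsub>quot\<^esub> coset g = coset (f \<oplus>\<^bsub>hall_C\<^esub> g)" "coset f \<otimes>\<^bsub>quot\<^esub> coset g = coset (f \<otimes>\<^bsub>hall_C\<^esub> g)"
proof -
  interpret ideal compl_ideal hall_C by (rule compl_ideal_ideal)
  show "coset f \<oplus>\<^bsub>quot\<^esub> coset g = coset (f \<oplus>\<^bsub>hall_C\<^esub> g)"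
    using a_rcos_sum[OF assms] by (simp add: hopf_quot_def FactRing_def coset_def)
  show "coset f \<otimes>\<^bsub>quot\<^esub> coset g = coset (f \<otimes>\<^bsub>hall_C\<^esub> g)"
    using rcoset_mult_add[OF assms] by (simp add: hopf_quot_def FactRing_def coset_def)
qed

lemma quot_simps:
  "carrier quot = coset ` carrier hall_C"
  "\<one>\<^bsub>quot\<^esub> = coset \<one>\<^bsub>hall_C\<^esub>"
  "\<zero>\<^bsub>quot\<^esub> = compl_ideal"
  "c \<odot>\<^bsub>quot\<^esub> Z = coset (c \<odot>\<^bsub>hall_C\<^esub> coset_rep Z)"
  "comult quot Z = tensor_map coset (comult hall_C (coset_rep Z))"
  "counit quot Z = counit hall_C (coset_rep Z)"
  unfolding coset_def[abs_def] coset_rep_def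
  by (auto simp: hopf_quot_def FactRing_def A_RCOSETS_def')

lemma trunc_coset_rep_quot:
  assumes "f \<in> carrier hall_C" "U \<in> small.cls"
  shows "coset_rep (coset f) U = f U"
  using fun_cong[OF coset_rep(2)[OF assms(1)], of U] assms(2) by (simp add: trunc_def)

text \<open>
  Restriction to \<open>D\<close> gives coordinates on the quotient. On \<open>D\<close> all formulas for the operations agree
  with those of the Hall algebra of \<open>C\<close>, as they only involve representations in \<open>D\<close>.
\<close>

lemma hall_coords_quot: "hall_coords Q D quot (\<lambda>Z. trunc (coset_rep Z))"
proof (intro hall_coords.intro coord_space.intro hall_coords_axioms.intro)
  show "hall_class Q D" by (rule small.hall_class_axioms)
  show "inj_on (\<lambda>Z. trunc (coset_rep Z)) (carrier quot)"
  proof (rule inj_onI)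
    fix Z Y assume "Z \<in> carrier quot" "Y \<in> carrier quot" and eq: "trunc (coset_rep Z) = trunc (coset_rep Y)"
    then obtain f g where f: "f \<in> carrier hall_C" "Z = coset f" and g: "g \<in> carrier hall_C" "Y = coset g"
      by (auto simp: quot_simps)
    then show "Z = Y" using eq coset_rep(2) coset_eq_iff by simp
  qed
  show "(\<lambda>Z. trunc (coset_rep Z)) ` carrier quot = {f :: ('v, 'a) hall. finite {u. f u \<noteq> 0} \<and> {u. f u \<noteq> 0} \<subseteq> small.cls}"
  proof (intro equalityI subsetI)
    fix g assume "g \<in> (\<lambda>Z. trunc (coset_rep Z)) ` carrier quot"
    then obtain f where f: "f \<in> carrier hall_C" "g = trunc f" by (auto simp: quot_simps coset_rep)
    have "{u. trunc f u \<noteq> 0} \<subseteq> {u. f u \<noteq> 0} \<inter> small.cls" by (auto simp: trunc_def)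
    then show "g \<in> {f. finite {u. f u \<noteq> 0} \<and> {u. f u \<noteq> 0} \<subseteq> small.cls}"
      using f hall.crd_finite[OF f(1)] by (auto intro: finite_subset)
  next
    fix g :: "('v, 'a) hall" assume g: "g \<in> {f. finite {u. f u \<noteq> 0} \<and> {u. f u \<noteq> 0} \<subseteq> small.cls}"
    then have "g \<in> carrier hall_C" using small_cls by (auto simp: hall_carrier fin_fun_def)
    moreover have "trunc g = g" using g by (auto simp: trunc_def fun_eq_iff)
    ultimately show "g \<in> (\<lambda>Z. trunc (coset_rep Z)) ` carrier quot"
      using coset_rep(2)[of g] by (intro image_eqI[where x = "coset g"]) (simp_all add: quot_simps)
  qed
  have zero: "compl_ideal = coset \<zero>\<^bsub>hall_C\<^esub>"
    using hall.zero_in by (auto simp: coset_eq mem_compl_ideal trunc_def fun_eq_iff hall_simps)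
  show "\<zero>\<^bsub>quot\<^esub> \<in> carrier quot" unfolding quot_simps(1,3) using zero hall.zero_in by blast
  show "trunc (coset_rep \<zero>\<^bsub>quot\<^esub>) U = 0" for U
    unfolding quot_simps(3) unfolding zero coset_rep(2)[OF hall.zero_in] by (simp add: trunc_def hall_simps)
  show "\<one>\<^bsub>quot\<^esub> \<in> carrier quot" using hall.one_in by (simp add: quot_simps)
  show "trunc (coset_rep \<one>\<^bsub>quot\<^esub>) = rep_basis Q zero_rep"
    unfolding quot_simps coset_rep(2)[OF hall.one_in]
    using small.C_zero by (auto simp: trunc_def hall_simps class_basis_def fun_eq_iff)
next
  fix Z Y assume "Z \<in> carrier quot" "Y \<in> carrier quot"
  then obtain f g where f: "f \<in> carrier hall_C" "Z = coset f" and g: "g \<in> carrier hall_C" "Y = coset g"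
    by (auto simp: quot_simps)
  have ZY: "Z \<oplus>\<^bsub>quot\<^esub> Y = coset (f \<oplus>\<^bsub>hall_C\<^esub> g)" "Z \<otimes>\<^bsub>quot\<^esub> Y = coset (f \<otimes>\<^bsub>hall_C\<^esub> g)"
    using coset_ops f g by simp_all
  note fg = hall.add_in[OF f(1) g(1)] hall.mult_in[OF f(1) g(1)]
  show "Z \<oplus>\<^bsub>quot\<^esub> Y \<in> carrier quot" "Z \<otimes>\<^bsub>quot\<^esub> Y \<in> carrier quot"
    unfolding ZY quot_simps using fg by blast+
  show "trunc (coset_rep (Z \<oplus>\<^bsub>quot\<^esub> Y)) U = trunc (coset_rep Z) U + trunc (coset_rep Y) U" for U
    unfolding f(2) g(2) coset_ops[OF f(1) g(1)] coset_rep(2)[OF fg(1)] coset_rep(2)[OF f(1)] coset_rep(2)[OF g(1)]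
    by (simp add: trunc_def hall_simps)
  show "trunc (coset_rep (Z \<otimes>\<^bsub>quot\<^esub> Y)) (cl M) = hprod (trunc (coset_rep Z)) (trunc (coset_rep Y)) M"
    if M: "M \<in> D" for M
    unfolding f(2) g(2) coset_ops[OF f(1) g(1)] coset_rep(2)[OF fg(2)] coset_rep(2)[OF f(1)] coset_rep(2)[OF g(1)]
    using M small.C_sub[OF M] small.C_quot[OF M]
    by (simp add: trunc_def hall.crd_mult[OF f(1) g(1) D_repC[OF M]] hprod_def)
next
  fix Z assume "Z \<in> carrier quot"
  then obtain f where f: "f \<in> carrier hall_C" "Z = coset f" by (auto simp: quot_simps)
  let ?z = "coset_rep Z"
  have z: "?z \<in> carrier hall_C" "trunc ?z = trunc f" using coset_rep[OF f(1)] f(2) by simp_all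
  show "c \<odot>\<^bsub>quot\<^esub> Z \<in> carrier quot" for c
    using hall.smult_in[OF z(1)] by (simp add: quot_simps)
  show "trunc (coset_rep (c \<odot>\<^bsub>quot\<^esub> Z)) U = c * trunc (coset_rep Z) U" for c U
    unfolding quot_simps coset_rep(2)[OF hall.smult_in[OF z(1)]] by (simp add: trunc_def hall_simps)
  show "Poly_Mapping.keys (comult quot Z) \<subseteq> carrier quot \<times> carrier quot"
    unfolding quot_simps tensor_map_def
    by (rule keys_formal_ext) (use hall.comult_keys[OF z(1)] in auto)
  show "pairing (comult quot Z) (\<lambda>(a, b). trunc (coset_rep a) (cl M) * trunc (coset_rep b) (cl N))
      = trunc (coset_rep Z) (cl (dsum M N))" if M: "M \<in> D" and N: "N \<in> D" for M N
  proof -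
    have "pairing (comult quot Z) (\<lambda>(a, b). trunc (coset_rep a) (cl M) * trunc (coset_rep b) (cl N))
      = pairing (comult hall_C ?z) (\<lambda>(a, b). trunc (coset_rep (coset a)) (cl M)
          * trunc (coset_rep (coset b)) (cl N))"
      unfolding quot_simps tensor_map_def by (simp add: pairing_formal_ext case_prod_beta')
    also have "\<dots> = pairing (comult hall_C ?z) (\<lambda>(a, b). a (cl M) * b (cl N))"
      by (rule pairing_cong)
        (use hall.comult_keys[OF z(1)] M N in \<open>auto simp: trunc_def trunc_coset_rep_quot\<close>)
    also have "\<dots> = ?z (cl (dsum M N))"
      by (rule hall.comult_pairing[OF z(1) D_repC[OF M] D_repC[OF N]])
    finally show ?thesis using small.C_dsum[OF M N] by (simp add: trunc_def)
  qed
  show "counit quot Z = trunc (coset_rep Z) (cl zero_rep)"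
    using small.C_zero by (simp add: quot_simps hall_simps trunc_def)
qed

text \<open>
  The coordinates of the quotient are elements of the Hall algebra of \<open>D\<close>, and the operations have
  the same description on both sides.
\<close>

lemma hopf_isomorphic_quot: "hopf_isomorphic quot (hall_algebra Q D)"
proof -
  interpret A: hall_coords Q D quot "\<lambda>Z. trunc (coset_rep Z)" by (rule hall_coords_quot)
  let ?B = "hall_algebra Q D" and ?f = "\<lambda>Z. trunc (coset_rep Z)"
  have im: "?f ` carrier quot = carrier ?B"
    using A.crd_image small.hall.crd_image by simp
  then have f_in: "?f Z \<in> carrier ?B" if "Z \<in> carrier quot" for Z using that by blast
  have "?f \<in> hopf_iso quot ?B"
    unfolding hopf_iso_def
  proof (intro CollectI conjI ballI)
    have mult: "?f (Z \<otimes>\<^bsub>quot\<^esub> Y) = ?f Z \<otimes>\<^bsub>?B\<^esub> ?f Y" if "Z \<in> carrier quot" "Y \<in> carrier quot" for Z Y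
      by (rule small.hall.class_eqI) (use that in \<open>simp_all add: f_in A.mult_in small.hall.mult_in A.crd_mult small.hall.crd_mult\<close>)
    have add: "?f (Z \<oplus>\<^bsub>quot\<^esub> Y) = ?f Z \<oplus>\<^bsub>?B\<^esub> ?f Y" if "Z \<in> carrier quot" "Y \<in> carrier quot" for Z Y
      using that by (auto simp: A.crd_add small.hall_simps)
    have one: "?f \<one>\<^bsub>quot\<^esub> = \<one>\<^bsub>?B\<^esub>" using A.crd_one by (simp add: small.hall_simps)
    show "?f \<in> ring_iso quot ?B"
      unfolding ring_iso_def ring_hom_def bij_betw_def
      using mult add one im A.crd_inj f_in by auto
    show "linear_on quot ?B ?f"
      unfolding linear_on_def using add f_in by (auto simp: A.crd_smult small.hall_simps)
    fix Z assume Z: "Z \<in> carrier quot"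
    show "tensor2_eq ?B (comult ?B (?f Z)) (tensor_map ?f (comult quot Z))"
    proof (rule small.hall.tensor2_eqI)
      show "Poly_Mapping.keys (comult ?B (?f Z)) \<subseteq> carrier ?B \<times> carrier ?B"
        by (rule small.hall.comult_keys[OF f_in[OF Z]])
      show "Poly_Mapping.keys (tensor_map ?f (comult quot Z)) \<subseteq> carrier ?B \<times> carrier ?B"
        unfolding tensor_map_def by (rule keys_formal_ext) (use A.comult_keys[OF Z] f_in in auto)
      fix U W assume "U \<in> small.cls" "W \<in> small.cls"
      then obtain M N where M: "M \<in> D" "U = cl M" and N: "N \<in> D" "W = cl N" by blast
      have "pairing (tensor_map ?f (comult quot Z)) (\<lambda>(a, b). a U * b W)
          = pairing (comult quot Z) (\<lambda>(a, b). ?f a U * ?f b W)"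
        unfolding tensor_map_def by (simp add: pairing_formal_ext case_prod_beta')
      then show "pairing (comult ?B (?f Z)) (\<lambda>(a, b). a U * b W)
          = pairing (tensor_map ?f (comult quot Z)) (\<lambda>(a, b). a U * b W)"
        using A.comult_pairing[OF Z M(1) N(1)] small.hall.comult_pairing[OF f_in[OF Z] M(1) N(1)] M N by simp
    qed
    show "counit ?B (?f Z) = counit quot Z"
      using A.counit_crd[OF Z] by (simp add: small.hall_simps)
  qed
  then show ?thesis
    unfolding hopf_isomorphic_def using A.hopf_algebra small.hall.hopf_algebra by blast
qed

end


section \<open>Nilpotent representations and representations of finite nice length\<close>

context quiver
begin

lemma hall_class_reps: "hall_class Q (reps Q)"
  by unfold_locales (auto intro: dsum_reps zero_rep_in_reps)

lemma zero_rep_nilpotent: "nilpotent_rep Q zero_rep"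
proof -
  have "fold (act zero_rep) p 0 = 0" for p by (induction p) (simp_all add: zero_rep_def)
  moreover have "x = 0" if "x \<in> car zero_rep u" for x and u :: 'v using that by (simp add: zero_rep_def)
  ultimately show ?thesis unfolding nilpotent_rep_def by metis
qed

lemma hall_class_nil: "hall_class Q (nil_reps Q)"
  by unfold_locales
    (auto simp: nil_reps_def intro: dsum_reps zero_rep_in_reps zero_rep_nilpotent nilpotent_dsum nilpotent_rep_emb)

lemma nice_length_zero: "nice_length Q zero_rep < \<infinity>"
  unfolding nice_length_finite_iff
  by (intro exI[of _ 0] exI[of _ "\<lambda>_ _. 0"]) (auto simp: rel_nice_grading_iff separates_def zero_rep_def)

lemma hall_class_nice:
  assumes "hall_class Q C"
  shows "hall_class Q {M \<in> C. nice_length Q M < \<infinity>}"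
proof -
  interpret hall_class Q C by fact
  show ?thesis
  proof unfold_locales
    show "{M \<in> C. nice_length Q M < \<infinity>} \<subseteq> reps Q" using C_reps by blast
    show "zero_rep \<in> {M \<in> C. nice_length Q M < \<infinity>}" using C_zero nice_length_zero by blast
    fix M N
    { assume "M \<in> reps Q" "N \<in> {M \<in> C. nice_length Q M < \<infinity>}" "rep_emb M N"
      then show "M \<in> {M \<in> C. nice_length Q M < \<infinity>}" using C_emb nice_length_emb by blast }
    { assume "M \<in> {M \<in> C. nice_length Q M < \<infinity>}" "N \<in> {M \<in> C. nice_length Q M < \<infinity>}"
      then show "dsum M N \<in> {M \<in> C. nice_length Q M < \<infinity>}"
        using C_dsum nice_length_dsum C_repsD by blast }
  qed
qed

lemma hall_subclass_nice:
  assumes "hall_class Q C"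
  shows "hall_subclass Q C {M \<in> C. nice_length Q M < \<infinity>}"
  using assms hall_class_nice[OF assms]
  by (intro hall_subclass.intro hall_subclass_axioms.intro) auto

lemma compl_ideal_nice:
  assumes "hall_class Q C"
  shows "hall_subclass.compl_ideal Q C {M \<in> C. nice_length Q M < \<infinity>}
    = lin_span (hall_algebra Q C) {rep_basis Q M | M. M \<in> C \<and> nice_length Q M = \<infinity>}"
proof -
  interpret hall_subclass Q C "{M \<in> C. nice_length Q M < \<infinity>}" by (rule hall_subclass_nice[OF assms])
  have "{rep_basis Q M | M. M \<in> C \<and> M \<notin> {M \<in> C. nice_length Q M < \<infinity>}}
      = {rep_basis Q M | M. M \<in> C \<and> nice_length Q M = \<infinity>}" by auto
  then show ?thesis unfolding compl_ideal_def by simp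
qed

end

theorem theoremG:
  fixes Q :: "('v, 'a) pre_digraph"
  assumes "fin_digraph Q"
  shows "hopf_ideal (non_nice_span Q) (hall Q) \<and>
    hopf_ideal (nil_non_nice_span Q) (hall_nil Q) \<and>
    hopf_isomorphic (hopf_quot (hall Q) (non_nice_span Q)) (hall_nice Q) \<and>
    hopf_isomorphic (hopf_quot (hall_nil Q) (nil_non_nice_span Q)) (hall_nil_nice Q)"
proof -
  interpret quiver Q using assms by (rule quiver.intro)
  interpret all: hall_subclass Q "reps Q" "{M \<in> reps Q. nice_length Q M < \<infinity>}"
    by (rule hall_subclass_nice[OF hall_class_reps])
  interpret nil: hall_subclass Q "nil_reps Q" "{M \<in> nil_reps Q. nice_length Q M < \<infinity>}"
    by (rule hall_subclass_nice[OF hall_class_nil])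
  have "all.compl_ideal = non_nice_span Q" "nil.compl_ideal = nil_non_nice_span Q"
    unfolding non_nice_span_def nil_non_nice_span_def
    by (rule compl_ideal_nice[OF hall_class_reps], rule compl_ideal_nice[OF hall_class_nil])
  then show ?thesis
    using all.hopf_ideal_compl nil.hopf_ideal_compl all.hopf_isomorphic_quot nil.hopf_isomorphic_quot
    by simp
qed


end
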